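(* Let $\mathbb{K}$ be a field of characteristic zero, let $n$ be a positive integer with $n\ne 4,5,6,8$, and let $m=\binom n2$. If $n$ is odd, there is no matrix group $H\subseteq\mathrm{GL}_m(\mathbb{K})$ whose invariant ring $I(H)$ lies strictly between the ring of symmetric polynomials and $\mathcal{I}_n$, i.e. such that $I(\mathfrak{S}_m)\subsetneq I(H)\subsetneq\mathcal{I}_n$. If $n$ is even, there is no matrix group $H\subseteq\mathrm{GL}_m(\mathbb{K})$ whose invariant ring lies strictly between the ring of alternate polynomials and $\mathcal{I}_n$, i.e. such that $I(\mathcal{A}_m)\subsetneq I(H)\subsetneq\mathcal{I}_n$.
   Context: $\mathbb{K}[x_{\{i,j\}}]$ is the polynomial ring in the $m=\binom n2$ variables indexed by the pairs $\{i,j\}$, $1\le i<j\le n$; the symmetric group $\mathfrak{S}_n$ acts on it by $\sigma\cdot x_{\{i,j\}}=x_{\{\sigma(i),\sigma(j)\}}$, and $\mathcal{I}_n:=\mathbb{K}[x_{\{i,j\}}]^{\mathfrak{S}_n}$. A matrix group is a finite subgroup $H$ of $\mathrm{GL}_m(\mathbb{K})$, acting on $\mathbb{K}[x_{\{i,j\}}]$, viewed as the ring of polynomial functions on $\mathbb{K}^m$, by $\sigma\cdot p=p\circ\sigma^{-1}$; $I(H)$ denotes its ring of invariant polynomials. $\mathfrak{S}_m$ is the group of all permutations of the $m$ variables, so $I(\mathfrak{S}_m)$ is the ring of symmetric polynomials; $\mathcal{A}_m$ is the alternating subgroup of $\mathfrak{S}_m$, and the ring of alternate polynomials is $I(\mathcal{A}_m)$.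 *)

theory Defs
  imports
    "HOL-Combinatorics.Permutations"
    "HOL-Algebra.Sym_Groups"
    "Jordan_Normal_Form.Matrix"
    "HOL-Library.Poly_Mapping"
begin

section \<open>Polynomials\<close>

text \<open>
  Polynomials with variables in \<open>'v\<close> and coefficients in \<open>'k\<close>: finitely supported families of
  coefficients indexed by monomials, a monomial being a finitely supported family of exponents.
  The library's multiplication on this type is the convolution product.
\<close>

type_synonym ('v, 'k) mpoly = "('v \<Rightarrow>\<^sub>0 nat) \<Rightarrow>\<^sub>0 'k"

definition const :: "'k \<Rightarrow> ('v, 'k::zero) mpoly" where
  "const c = Poly_Mapping.single 0 c"

definition var :: "'v \<Rightarrow> ('v, 'k::zero_neq_one) mpoly" where
  "var v = Poly_Mapping.single (Poly_Mapping.single v 1) 1"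

definition poly_ring :: "'v set \<Rightarrow> ('v, 'k::zero) mpoly set" where
  "poly_ring V = {p. \<forall>t\<in>Poly_Mapping.keys p. Poly_Mapping.keys t \<subseteq> V}"

text \<open>
  Evaluation in an arbitrary commutative algebra with structure map \<open>h\<close>. For \<open>h = const\<close> this is
  the substitution of polynomials for the variables, for \<open>h = (\<lambda>c. c)\<close> it is the value at a point.
\<close>

definition eval_poly ::
  "('k::zero \<Rightarrow> 'a::comm_semiring_1) \<Rightarrow> ('v \<Rightarrow> 'a) \<Rightarrow> ('v, 'k) mpoly \<Rightarrow> 'a" where
  "eval_poly h g p = (\<Sum>t\<in>Poly_Mapping.keys p. h (Poly_Mapping.lookup p t) * (\<Prod>v\<in>Poly_Mapping.keys t. g v ^ Poly_Mapping.lookup t v))"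

definition subst_poly ::
  "('v \<Rightarrow> ('w, 'k) mpoly) \<Rightarrow> ('v, 'k::comm_semiring_1) mpoly \<Rightarrow> ('w, 'k) mpoly" where
  "subst_poly = eval_poly const"

definition permute_vars :: "('v \<Rightarrow> 'v) \<Rightarrow> ('v, 'k::comm_semiring_1) mpoly \<Rightarrow> ('v, 'k) mpoly" where
  "permute_vars \<pi> = subst_poly (\<lambda>v. var (\<pi> v))"


section \<open>The variables \<open>x\<^bsub>{i,j}\<^esub>\<close> and permutation invariants\<close>

definition pairs :: "nat \<Rightarrow> nat set set" where
  "pairs n = {{i, j} | i j. 1 \<le> i \<and> i < j \<and> j \<le> n}"

definition graph_invariants :: "nat \<Rightarrow> (nat set, 'k::field) mpoly set" where
  "graph_invariants n =
    {p \<in> poly_ring (pairs n). \<forall>\<sigma>\<in>carrier (sym_group n). permute_vars (\<lambda>a. \<sigma> ` a) p = p}"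

definition symmetric_polys :: "'v set \<Rightarrow> ('v, 'k::field) mpoly set" where
  "symmetric_polys V = {p \<in> poly_ring V. \<forall>\<pi>. \<pi> permutes V \<longrightarrow> permute_vars \<pi> p = p}"

text \<open>
  Invariance under the alternating group only; so symmetric polynomials are alternate in this sense
  (these are not the polynomials that change sign under odd permutations).
\<close>

definition alternate_polys :: "'v set \<Rightarrow> ('v, 'k::field) mpoly set" where
  "alternate_polys V =
    {p \<in> poly_ring V. \<forall>\<pi>. \<pi> permutes V \<and> evenperm \<pi> \<longrightarrow> permute_vars \<pi> p = p}"


section \<open>Matrix groups and their invariants\<close>

definition GL :: "nat \<Rightarrow> ('k::field) mat monoid" where
  "GL m = units_of (ring_mat TYPE('k) m ())"

definition matrix_group :: "nat \<Rightarrow> ('k::field) mat set \<Rightarrow> bool" where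
  "matrix_group m H \<longleftrightarrow> finite H \<and> subgroup H (GL m)"

text \<open>
  To let \<open>m \<times> m\<close> matrices act on polynomials in \<open>m\<close> variables, the variables have to be listed in
  some order \<open>e 0, \<dots>, e (m - 1)\<close>; then \<open>var (e i)\<close> is the \<open>i\<close>-th coordinate function on \<open>K\<^sup>m\<close>.
  \<open>comp_mat e m B p\<close> is the polynomial \<open>p \<circ> B\<close>: the \<open>i\<close>-th coordinate function is replaced by the
  linear form given by the \<open>i\<close>-th row of \<open>B\<close>. See lemma \<open>poly_fun_comp_mat\<close> below.
\<close>

definition coord :: "(nat \<Rightarrow> 'v) \<Rightarrow> nat \<Rightarrow> 'v \<Rightarrow> nat" where
  "coord e m = the_inv_into {..<m} e"

definition poly_fun :: "(nat \<Rightarrow> 'v) \<Rightarrow> nat \<Rightarrow> ('v, 'k::field) mpoly \<Rightarrow> 'k vec \<Rightarrow> 'k" where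
  "poly_fun e m p a = eval_poly (\<lambda>c. c) (\<lambda>v. a $ coord e m v) p"

definition comp_mat ::
  "(nat \<Rightarrow> 'v) \<Rightarrow> nat \<Rightarrow> ('k::field) mat \<Rightarrow> ('v, 'k) mpoly \<Rightarrow> ('v, 'k) mpoly" where
  "comp_mat e m B = subst_poly (\<lambda>v. \<Sum>j<m. const (B $$ (coord e m v, j)) * var (e j))"

definition mat_action ::
  "(nat \<Rightarrow> 'v) \<Rightarrow> nat \<Rightarrow> ('k::field) mat \<Rightarrow> ('v, 'k) mpoly \<Rightarrow> ('v, 'k) mpoly" where
  "mat_action e m A p = comp_mat e m (inv\<^bsub>GL m\<^esub> A) p"

definition mat_invariants ::
  "(nat \<Rightarrow> 'v) \<Rightarrow> nat \<Rightarrow> ('k::field) mat set \<Rightarrow> ('v, 'k) mpoly set" where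
  "mat_invariants e m H = {p \<in> poly_ring (e ` {..<m}). \<forall>A\<in>H. mat_action e m A p = p}"


section \<open>Consistency of the definitions\<close>

lemma pairs_eq: "pairs n = {a. a \<subseteq> {1..n} \<and> card a = 2}"
proof (intro Set.set_eqI iffI)
  fix a assume "a \<in> pairs n"
  then show "a \<in> {a. a \<subseteq> {1..n} \<and> card a = 2}"
    by (auto simp: pairs_def)
next
  fix a assume "a \<in> {a. a \<subseteq> {1..n} \<and> card a = 2}"
  then obtain i j where ij: "a = {i, j}" "i \<noteq> j" "a \<subseteq> {1..n}"
    by (auto simp: card_2_iff)
  then have "a = {min i j, max i j}" "1 \<le> min i j" "min i j < max i j" "max i j \<le> n"
    by (auto simp: min_def max_def)
  then show "a \<in> pairs n"
    unfolding pairs_def by blast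
qed

lemma card_pairs: "finite (pairs n) \<and> card (pairs n) = n choose 2"
  unfolding pairs_eq using n_subsets[of "{1..n}" 2]
  by (auto intro: finite_subset[of _ "Pow {1..n}"])

lemma ex_enumeration_pairs: "\<exists>e. bij_betw e {..<n choose 2} (pairs n)"
  using card_pairs[of n] ex_bij_betw_nat_finite[of "pairs n"] by (auto simp: atLeast0LessThan)

lemma eval_poly_superset:
  assumes "finite S" "Poly_Mapping.keys p \<subseteq> S" "h 0 = 0"
  shows "eval_poly h g p = (\<Sum>t\<in>S. h (Poly_Mapping.lookup p t) * (\<Prod>v\<in>Poly_Mapping.keys t. g v ^ Poly_Mapping.lookup t v))"
  unfolding eval_poly_def
  by (rule sum.mono_neutral_left) (use assms in \<open>auto simp: in_keys_iff\<close>)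

lemma eval_poly_cong:
  assumes "p \<in> poly_ring V" "\<And>v. v \<in> V \<Longrightarrow> f v = g v"
  shows "eval_poly h f p = eval_poly h g p"
  unfolding eval_poly_def
proof (rule sum.cong)
  fix t assume "t \<in> Poly_Mapping.keys p"
  then have "Poly_Mapping.keys t \<subseteq> V" using assms(1) by (simp add: poly_ring_def)
  then have "(\<Prod>v\<in>Poly_Mapping.keys t. f v ^ Poly_Mapping.lookup t v)
      = (\<Prod>v\<in>Poly_Mapping.keys t. g v ^ Poly_Mapping.lookup t v)"
    by (intro prod.cong) (auto simp: assms(2) subsetD)
  then show "h (Poly_Mapping.lookup p t) * (\<Prod>v\<in>Poly_Mapping.keys t. f v ^ Poly_Mapping.lookup t v)
      = h (Poly_Mapping.lookup p t) * (\<Prod>v\<in>Poly_Mapping.keys t. g v ^ Poly_Mapping.lookup t v)"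
    by simp
qed simp

lemma eval_id_add:
  fixes p q :: "('v, 'k::comm_semiring_1) mpoly"
  shows "eval_poly (\<lambda>c. c) g (p + q) = eval_poly (\<lambda>c. c) g p + eval_poly (\<lambda>c. c) g q"
proof -
  let ?S = "Poly_Mapping.keys p \<union> Poly_Mapping.keys q"
  have "Poly_Mapping.keys (p + q) \<subseteq> ?S" by (rule Poly_Mapping.keys_add)
  then show ?thesis
    by (subst (1 2 3) eval_poly_superset[where S = ?S])
       (auto simp: lookup_add sum.distrib[symmetric] distrib_right)
qed

lemma eval_id_single:
  fixes c :: "'k::comm_semiring_1"
  shows "eval_poly (\<lambda>c. c) g (Poly_Mapping.single t c) = c * (\<Prod>v\<in>Poly_Mapping.keys t. g v ^ Poly_Mapping.lookup t v)"
  by (subst eval_poly_superset[where S = "{t}"]) auto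

lemma eval_id_sum:
  fixes f :: "'b \<Rightarrow> ('v, 'k::comm_semiring_1) mpoly"
  shows "eval_poly (\<lambda>c. c) g (sum f A) = (\<Sum>a\<in>A. eval_poly (\<lambda>c. c) g (f a))"
proof (induction A rule: infinite_finite_induct)
  case (insert x A)
  then show ?case by (simp add: eval_id_add)
qed (simp_all add: eval_poly_def)

lemma mpoly_as_sum:
  "(p :: ('v, 'k::comm_semiring_1) mpoly) = (\<Sum>t\<in>Poly_Mapping.keys p. Poly_Mapping.single t (Poly_Mapping.lookup p t))"
  by (rule poly_mapping_eqI)
     (auto simp: lookup_sum lookup_single when_def in_keys_iff)

lemma monom_value_add:
  fixes g :: "'v \<Rightarrow> 'k::comm_semiring_1"
  shows "(\<Prod>v\<in>Poly_Mapping.keys (s + t). g v ^ Poly_Mapping.lookup (s + t) v)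
    = (\<Prod>v\<in>Poly_Mapping.keys s. g v ^ Poly_Mapping.lookup s v) * (\<Prod>v\<in>Poly_Mapping.keys t. g v ^ Poly_Mapping.lookup t v)"
proof -
  let ?S = "Poly_Mapping.keys s \<union> Poly_Mapping.keys t"
  have ext: "(\<Prod>v\<in>Poly_Mapping.keys u. g v ^ Poly_Mapping.lookup u v) = (\<Prod>v\<in>?S. g v ^ Poly_Mapping.lookup u v)" if "Poly_Mapping.keys u \<subseteq> ?S" for u
    by (rule prod.mono_neutral_left) (use that in \<open>auto simp: in_keys_iff\<close>)
  show ?thesis
    using Poly_Mapping.keys_add[of s t]
    by (subst (1 2 3) ext) (auto simp: lookup_add power_add prod.distrib)
qed

lemma eval_id_mult:
  fixes p q :: "('v, 'k::comm_semiring_1) mpoly"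
  shows "eval_poly (\<lambda>c. c) g (p * q) = eval_poly (\<lambda>c. c) g p * eval_poly (\<lambda>c. c) g q"
proof -
  have "p * q = (\<Sum>s\<in>Poly_Mapping.keys p. \<Sum>t\<in>Poly_Mapping.keys q. Poly_Mapping.single (s + t) (Poly_Mapping.lookup p s * Poly_Mapping.lookup q t))"
    by (subst mpoly_as_sum[of p], subst mpoly_as_sum[of q]) (simp add: sum_product mult_single)
  then have "eval_poly (\<lambda>c. c) g (p * q) = (\<Sum>s\<in>Poly_Mapping.keys p. \<Sum>t\<in>Poly_Mapping.keys q.
      (Poly_Mapping.lookup p s * Poly_Mapping.lookup q t) *
      ((\<Prod>v\<in>Poly_Mapping.keys s. g v ^ Poly_Mapping.lookup s v) *
       (\<Prod>v\<in>Poly_Mapping.keys t. g v ^ Poly_Mapping.lookup t v)))"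
    by (simp only: eval_id_sum eval_id_single monom_value_add)
  then show ?thesis
    by (simp add: eval_poly_def sum_product ac_simps)
qed

lemma eval_id_const: "eval_poly (\<lambda>c. c) g (const c) = (c :: 'k::comm_semiring_1)"
  by (simp add: const_def eval_id_single)

lemma eval_id_var: "eval_poly (\<lambda>c. c) g (var v) = (g v :: 'k::comm_semiring_1)"
  by (simp add: var_def eval_id_single)

lemma eval_id_power:
  "eval_poly (\<lambda>c. c) g (p ^ k) = (eval_poly (\<lambda>c. c) g p :: 'k::comm_semiring_1) ^ k"
proof (induction k)
  case 0
  show ?case using eval_id_const[of g 1] by (simp add: const_def)
qed (simp add: eval_id_mult)

lemma eval_id_prod:
  "eval_poly (\<lambda>c. c) g (prod f A) = (\<Prod>a\<in>A. eval_poly (\<lambda>c. c) g (f a) :: 'k::comm_semiring_1)"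
proof (induction A rule: infinite_finite_induct)
  case (insert x A)
  then show ?case by (simp add: eval_id_mult)
qed (use eval_id_const[of g 1] in \<open>simp_all add: const_def\<close>)

lemma eval_subst_poly:
  fixes p :: "('v, 'k::comm_semiring_1) mpoly"
  shows "eval_poly (\<lambda>c. c) g (subst_poly f p) = eval_poly (\<lambda>c. c) (\<lambda>v. eval_poly (\<lambda>c. c) g (f v)) p"
  unfolding subst_poly_def eval_poly_def[of const]
  by (simp add: eval_id_sum eval_id_mult eval_id_const eval_id_prod eval_id_power)
     (simp add: eval_poly_def)

lemma poly_fun_comp_mat:
  assumes "inj_on e {..<m}" "p \<in> poly_ring (e ` {..<m})"
    and "B \<in> carrier_mat m m" "a \<in> carrier_vec m"
  shows "poly_fun e m (comp_mat e m B p) a = poly_fun e m p (B *\<^sub>v a)"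
proof -
  have c: "coord e m (e i) = i" if "i < m" for i
    using that assms(1) by (simp add: coord_def the_inv_into_f_f)
  have lin: "eval_poly (\<lambda>c. c) (\<lambda>v. a $ coord e m v)
      (\<Sum>j<m. const (B $$ (coord e m v, j)) * var (e j)) = (B *\<^sub>v a) $ coord e m v"
    if "v \<in> e ` {..<m}" for v
    using that assms(3,4)
    by (auto simp: c eval_id_sum eval_id_mult eval_id_const eval_id_var scalar_prod_def
        lessThan_atLeast0)
  show ?thesis
    unfolding poly_fun_def comp_mat_def eval_subst_poly
    by (rule eval_poly_cong[OF assms(2) lin])
qed

lemma poly_fun_mat_action:
  fixes p :: "('v, 'k::field) mpoly"
  assumes "inj_on e {..<m}" "p \<in> poly_ring (e ` {..<m})"
    and "A \<in> carrier (GL m)" "a \<in> carrier_vec m"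
  shows "poly_fun e m (mat_action e m A p) a = poly_fun e m p ((inv\<^bsub>GL m\<^esub> A) *\<^sub>v a)"
proof -
  interpret R: semiring "ring_mat TYPE('k) m ()" by (rule semiring_mat)
  have "inv\<^bsub>GL m\<^esub> A \<in> carrier (GL m)"
    using group.inv_closed[OF R.units_group] assms(3) unfolding GL_def by simp
  then have "inv\<^bsub>GL m\<^esub> A \<in> carrier_mat m m"
    by (auto simp: GL_def units_of_def Units_def ring_mat_def)
  then show ?thesis
    unfolding mat_action_def by (rule poly_fun_comp_mat[OF assms(1,2) _ assms(4)])
qed

text \<open>Permuting the variables is the action of a permutation matrix.\<close>

lemma permute_vars_eq_comp_mat:
  fixes p :: "('v, 'k::field) mpoly"
  assumes "inj_on e {..<m}" "p \<in> poly_ring (e ` {..<m})" "\<pi> permutes e ` {..<m}"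
  shows "permute_vars \<pi> p = comp_mat e m (mat m m (\<lambda>(i, j). if e j = \<pi> (e i) then 1 else 0)) p"
proof -
  have "(\<Sum>j<m. const (mat m m (\<lambda>(i, j). if e j = \<pi> (e i) then 1 else 0) $$ (coord e m v, j)) * var (e j))
      = (var (\<pi> v) :: ('v, 'k) mpoly)" (is "?l = _") if v: "v \<in> e ` {..<m}" for v
  proof -
    obtain i where i: "i < m" "v = e i" using v by auto
    have "\<pi> v \<in> e ` {..<m}" using v assms(3) by (simp add: permutes_in_image)
    then obtain k where k: "k < m" "\<pi> v = e k" by auto
    have "coord e m v = i" using i assms(1) by (simp add: coord_def the_inv_into_f_f)
    then have "?l = (\<Sum>j<m. if j = k then var (e j) else 0)"
      using i k assms(1)
      by (intro sum.cong) (auto simp: const_def inj_on_eq_iff)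
    then show ?thesis using k by simp
  qed
  then show ?thesis
    unfolding permute_vars_def comp_mat_def subst_poly_def
    by (intro eval_poly_cong[OF assms(2)]) (rule sym)
qed

end

theory Submission
  imports Defs "HOL-Computational_Algebra.Polynomial"
begin

text \<open>
  Since all power sums are invariant under \<open>H\<close>, every matrix of \<open>H\<close> maps unit vectors to unit
  vectors, so \<open>H\<close> is a group \<open>P\<close> of permutations of the variables. The orbit sum of a monomial with
  distinct exponents shows that \<open>P\<close> contains the image of \<open>\<SS>\<^sub>n\<close>, properly because the inclusion of
  invariant rings is strict. For \<open>n \<le> 3\<close> the image is the full symmetric group, and it remains to
  prove that for \<open>n = 7\<close> and \<open>n \<ge> 9\<close> every proper overgroup \<open>P\<close> contains \<open>\<AA>\<^sub>m\<close>.

  The automorphisms of the triangular graph are induced by \<open>\<SS>\<^sub>n\<close>, so \<open>P\<close> moves some adjacent pair of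
  edges to a disjoint one and is doubly transitive. Then the orbit of a triangle under \<open>P\<close> is a
  2-design on the edges, invariant under \<open>\<SS>\<^sub>n\<close>; counting the blocks through two adjacent and
  through two disjoint edges shows, except for one possibility with \<open>n = 11\<close> that is ruled out
  separately, that every triple is a block, and \<open>P\<close> is triply transitive. Following Bochert,
  starting from the image of a transposition, which moves \<open>2 (n - 2)\<close> edges, commutators of suitable
  conjugates produce elements of smaller and smaller support, and finally a 3-cycle or a
  transposition. For \<open>n \<le> 11\<close> plain commutators are not enough, and the powers of the product of
  two conjugate involutions are used as well.
\<close>


section \<open>Finite permutation groups and triple transitivity\<close>

text \<open>The parity of n enters through a transposition of two vertices: on the edges it is a
  product of n - 2 disjoint transpositions, so it is odd exactly when n is odd. A group that
  contains it and the alternating group is then the full symmetric group, whereas for even n the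
  image of the symmetric group of the vertices lies inside the alternating group. The number of
  edges limits the descent. Averaging yields two conjugates of support size k that share at most 1 +
  (k - 1)(k - 2) div (m - 2) points, and a commutator moves at most three times as many. Starting
  from k = 2 (n - 2), this decreases strictly down to 3 when n >= 12. With 55 or 45 edges it stalls
  at 18 or 15, with 36 edges it does not improve 14, and with 21 edges it improves neither 10 nor 6.
  For n = 8 the design argument must fail: Sp(6,2) contains S_8 and is doubly but not triply
  transitive on the 28 edges. Characteristic zero serves to read multiplicities off power sums and
  to keep the coefficients of orbit sums from vanishing.\<close>

definition moved :: "('a \<Rightarrow> 'a) \<Rightarrow> 'a set" where
  "moved \<pi> = {x. \<pi> x \<noteq> x}"

lemma in_moved_iff: "x \<in> moved \<pi> \<longleftrightarrow> \<pi> x \<noteq> x"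
  by (simp add: moved_def)

locale perm_group =
  fixes \<Omega> :: "'a set" and P :: "('a \<Rightarrow> 'a) set"
  assumes finite_Omega: "finite \<Omega>"
    and permutes: "\<pi> \<in> P \<Longrightarrow> \<pi> permutes \<Omega>"
    and id_mem: "id \<in> P"
    and comp_mem: "\<pi> \<in> P \<Longrightarrow> \<rho> \<in> P \<Longrightarrow> \<pi> \<circ> \<rho> \<in> P"
    and inv_mem: "\<pi> \<in> P \<Longrightarrow> Hilbert_Choice.inv \<pi> \<in> P"
begin

lemma finite_P: "finite P"
  by (rule finite_subset[OF _ finite_permutations[OF finite_Omega]]) (use permutes in auto)

lemma inj: "\<pi> \<in> P \<Longrightarrow> inj \<pi>"
  using permutes permutes_inj by blast

lemma apply_eq_iff [simp]: "\<pi> \<in> P \<Longrightarrow> \<pi> x = \<pi> y \<longleftrightarrow> x = y"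
  using inj by (simp add: inj_eq)

lemma inverse_simps [simp]:
  assumes "\<pi> \<in> P"
  shows "\<pi> (Hilbert_Choice.inv \<pi> x) = x" "Hilbert_Choice.inv \<pi> (\<pi> x) = x"
  using permutes_inverses[OF permutes[OF assms]] by auto

lemma in_Omega_iff [simp]: "\<pi> \<in> P \<Longrightarrow> \<pi> x \<in> \<Omega> \<longleftrightarrow> x \<in> \<Omega>"
  using permutes permutes_in_image by metis

lemma moved_subset: "\<pi> \<in> P \<Longrightarrow> moved \<pi> \<subseteq> \<Omega>"
  using permutes permutes_not_in by (fastforce simp: moved_def)

lemma finite_moved: "\<pi> \<in> P \<Longrightarrow> finite (moved \<pi>)"
  using moved_subset finite_Omega finite_subset by blast

lemma moved_closed: "\<pi> \<in> P \<Longrightarrow> \<pi> x \<in> moved \<pi> \<longleftrightarrow> x \<in> moved \<pi>"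
  by (simp add: moved_def)

definition conj_by :: "('a \<Rightarrow> 'a) \<Rightarrow> ('a \<Rightarrow> 'a) \<Rightarrow> 'a \<Rightarrow> 'a" where
  "conj_by h x = h \<circ> x \<circ> Hilbert_Choice.inv h"

lemma conj_by_mem: "h \<in> P \<Longrightarrow> x \<in> P \<Longrightarrow> conj_by h x \<in> P"
  unfolding conj_by_def by (intro comp_mem inv_mem)

lemma conj_by_apply: "h \<in> P \<Longrightarrow> conj_by h x (h a) = h (x a)"
  by (simp add: conj_by_def)

lemma moved_conj_by:
  assumes "h \<in> P"
  shows "moved (conj_by h x) = h ` moved x"
proof (intro Set.set_eqI iffI)
  fix a assume "a \<in> moved (conj_by h x)"
  then have "x (Hilbert_Choice.inv h a) \<noteq> Hilbert_Choice.inv h a"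
    using assms by (auto simp: moved_def conj_by_def)
  then show "a \<in> h ` moved x"
    using assms by (intro image_eqI[of _ _ "Hilbert_Choice.inv h a"]) (auto simp: moved_def)
next
  fix a assume "a \<in> h ` moved x"
  then show "a \<in> moved (conj_by h x)"
    using assms by (auto simp: moved_def conj_by_def)
qed

lemma card_moved_conj_by: "h \<in> P \<Longrightarrow> card (moved (conj_by h x)) = card (moved x)"
  by (simp add: moved_conj_by card_image inj inj_on_subset[OF inj])

definition commutator :: "('a \<Rightarrow> 'a) \<Rightarrow> ('a \<Rightarrow> 'a) \<Rightarrow> 'a \<Rightarrow> 'a" where
  "commutator z x = Hilbert_Choice.inv z \<circ> Hilbert_Choice.inv x \<circ> z \<circ> x"

lemma commutator_mem: "z \<in> P \<Longrightarrow> x \<in> P \<Longrightarrow> commutator z x \<in> P"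
  unfolding commutator_def by (intro comp_mem inv_mem)

text \<open>The commutator fixes p exactly when x and z commute at p. If p is moved by x only,
  commuting can fail only because z moves x p, which then lies in the overlap; likewise with x and z
  exchanged.\<close>

lemma moved_commutator:
  assumes "x \<in> P" "z \<in> P"
  defines "D \<equiv> moved x \<inter> moved z"
  shows "moved (commutator z x) \<subseteq> D \<union> z -` D \<union> x -` D"
proof
  fix p assume p: "p \<in> moved (commutator z x)"
  have *: "z (x p) \<noteq> x (z p)"
  proof
    assume "z (x p) = x (z p)"
    then have "commutator z x p = p" using assms(1,2) by (simp add: commutator_def)
    with p show False by (simp add: moved_def)
  qed
  show "p \<in> D \<union> z -` D \<union> x -` D"
  proof (cases "x p = p")
    case True
    with * have "x (z p) \<noteq> z p" by auto
    moreover have "z p \<noteq> p" using * True by auto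
    ultimately show ?thesis using assms(2) by (auto simp: D_def moved_def)
  next
    case False
    show ?thesis
    proof (cases "z p = p")
      case True
      with * have "z (x p) \<noteq> x p" by auto
      then show ?thesis using False assms(1) by (auto simp: D_def moved_def)
    next
      case z: False
      then show ?thesis using False by (auto simp: D_def moved_def)
    qed
  qed
qed

lemma card_vimage: "z \<in> P \<Longrightarrow> card (z -` D) = card D"
  by (rule card_vimage_inj) (auto simp: inj permutes_surj[OF permutes])

text \<open>The factor 3 in the later commutator bounds arises here: the overlap and its preimages
  under \<open>x\<close> and \<open>z\<close>.\<close>

lemma card_moved_commutator:
  assumes "x \<in> P" "z \<in> P"
  shows "card (moved (commutator z x)) \<le> 3 * card (moved x \<inter> moved z)"
proof -
  let ?D = "moved x \<inter> moved z"
  have fin: "finite ?D" using assms finite_moved by auto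
  have f: "finite (z -` ?D)" "finite (x -` ?D)"
    using finite_vimageI[OF fin inj] assms by blast+
  have "card (moved (commutator z x)) \<le> card (?D \<union> z -` ?D \<union> x -` ?D)"
    using moved_commutator[OF assms] fin f by (intro card_mono) auto
  also have "\<dots> \<le> card ?D + card (z -` ?D) + card (x -` ?D)"
    by (meson add_mono card_Un_le le_refl order_trans)
  finally show ?thesis using card_vimage[of _ ?D] assms by (simp del: vimage_Int)
qed

text \<open>Here z fixes x \<alpha>, while x (z \<alpha>) differs from x \<alpha>.\<close>

lemma commutator_ne_id:
  assumes "x \<in> P" "z \<in> P" "\<alpha> \<in> moved z" "x \<alpha> \<notin> moved z"
  shows "commutator z x \<noteq> id"
proof
  assume "commutator z x = id"
  then have "z (x \<alpha>) = x (z \<alpha>)"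
    using assms(1,2) by (metis comp_apply commutator_def id_apply inverse_simps(1))
  then show False using assms by (auto simp: moved_def)
qed

text \<open>Says that the minimal degree of \<open>P\<close> is at most \<open>k\<close>.\<close>

definition has_small :: "nat \<Rightarrow> bool" where
  "has_small k \<longleftrightarrow> (\<exists>x\<in>P. x \<noteq> id \<and> card (moved x) \<le> k)"

lemma has_small_mono: "has_small k \<Longrightarrow> k \<le> l \<Longrightarrow> has_small l"
  unfolding has_small_def by force

end

section \<open>Triply transitive groups and Bochert's averaging\<close>

locale triply_transitive = perm_group +
  assumes card_ge_3: "card \<Omega> \<ge> 3"
    and trans3: "\<lbrakk>a \<in> \<Omega>; b \<in> \<Omega>; c \<in> \<Omega>; a \<noteq> b; a \<noteq> c; b \<noteq> c;
      a' \<in> \<Omega>; b' \<in> \<Omega>; c' \<in> \<Omega>; a' \<noteq> b'; a' \<noteq> c'; b' \<noteq> c'\<rbrakk>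
      \<Longrightarrow> \<exists>\<pi>\<in>P. \<pi> a = a' \<and> \<pi> b = b' \<and> \<pi> c = c'"
begin

lemma trans2:
  assumes "a \<in> \<Omega>" "b \<in> \<Omega>" "a \<noteq> b" "a' \<in> \<Omega>" "b' \<in> \<Omega>" "a' \<noteq> b'"
  shows "\<exists>\<pi>\<in>P. \<pi> a = a' \<and> \<pi> b = b'"
proof -
  have ex: "\<exists>c\<in>\<Omega>. c \<noteq> u \<and> c \<noteq> v" for u v
  proof (rule ccontr)
    assume "\<not> ?thesis"
    then have "\<Omega> \<subseteq> {u, v}" by auto
    then have "card \<Omega> \<le> card {u, v}" by (intro card_mono) auto
    also have "\<dots> \<le> 2" by (simp add: card_insert_if)
    finally show False using card_ge_3 by simp
  qed
  from ex[of a b] ex[of a' b'] obtain c c' where "c \<in> \<Omega>" "c \<noteq> a" "c \<noteq> b" "c' \<in> \<Omega>" "c' \<noteq> a'" "c' \<noteq> b'"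
    by auto
  then show ?thesis using trans3[of a b c a' b' c'] assms by auto
qed

text \<open>
  Averaging over the elements that take \<open>\<alpha>\<close> to \<open>\<alpha>\<close> and a fixed point of \<open>x\<close> to \<open>x \<alpha>\<close>: by triple
  transitivity the remaining points are spread evenly.
\<close>

lemma small_overlap:
  assumes x: "x \<in> P" and \<alpha>: "\<alpha> \<in> moved x" and small: "card (moved x) < card \<Omega>"
  defines "M \<equiv> moved x"
  shows "\<exists>h\<in>P. \<alpha> \<in> h ` M \<and> x \<alpha> \<notin> h ` M \<and>
    (card (M \<inter> h ` M) - 1) * (card \<Omega> - 2) \<le> (card M - 1) * (card M - 2)"
proof -
  define \<beta> where "\<beta> = x \<alpha>"
  have M: "M \<subseteq> \<Omega>" "finite M" using x moved_subset finite_moved by (auto simp: M_def)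
  have ab: "\<alpha> \<in> M" "\<beta> \<in> M" "\<alpha> \<noteq> \<beta>"
    using \<alpha> x by (auto simp: M_def \<beta>_def moved_def)
  obtain b where b: "b \<in> \<Omega>" "b \<notin> M"
    using small M by (metis M_def card_mono finite_Omega leD subsetI finite_subset)
  \<comment> \<open>Taking the fixed point b to x \<alpha> keeps x \<alpha> out of the image of M,
    and fixing \<alpha> keeps \<alpha> inside: this is what \<open>commutator_ne_id\<close> asks of
    the conjugate.\<close>
  define K where "K = {h\<in>P. h \<alpha> = \<alpha> \<and> h b = \<beta>}"
  have finK: "finite K" using finite_P by (simp add: K_def)
  have "K \<noteq> {}" using trans2[of \<alpha> b \<alpha> \<beta>] ab b M by (auto simp: K_def)
  \<comment> \<open>Composition with elements that fix \<alpha> and \<beta> permutes the values h g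
    among the other card \<Omega> - 2 points, so all fibres over these have the same size.\<close>
  have count: "card {h\<in>K. h g = \<gamma>} * (card \<Omega> - 2) = card K"
    if g: "g \<in> M - {\<alpha>}" and \<gamma>: "\<gamma> \<in> \<Omega> - {\<alpha>, \<beta>}" for g \<gamma>
  proof -
    have le: "card {h\<in>K. h g = \<gamma>1} \<le> card {h\<in>K. h g = \<gamma>2}"
      if "\<gamma>1 \<in> \<Omega> - {\<alpha>, \<beta>}" "\<gamma>2 \<in> \<Omega> - {\<alpha>, \<beta>}" for \<gamma>1 \<gamma>2
    proof -
      have "\<exists>k\<in>P. k \<alpha> = \<alpha> \<and> k \<beta> = \<beta> \<and> k \<gamma>1 = \<gamma>2"
        by (rule trans3) (use that ab M in auto)
      then obtain k where k: "k \<in> P" "k \<alpha> = \<alpha>" "k \<beta> = \<beta>" "k \<gamma>1 = \<gamma>2" by auto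
      show ?thesis
      proof (rule card_inj_on_le[of "\<lambda>h. k \<circ> h"])
        show "inj_on (\<lambda>h. k \<circ> h) {h\<in>K. h g = \<gamma>1}"
          using k by (auto simp: inj_on_def fun_eq_iff)
        show "(\<lambda>h. k \<circ> h) ` {h\<in>K. h g = \<gamma>1} \<subseteq> {h\<in>K. h g = \<gamma>2}"
          using k comp_mem by (auto simp: K_def)
      qed (use finK in simp)
    qed
    have g': "g \<in> \<Omega>" "g \<noteq> \<alpha>" "g \<noteq> b" using g b M by auto
    have "card K = card (\<Union>\<delta>\<in>\<Omega> - {\<alpha>, \<beta>}. {h\<in>K. h g = \<delta>})"
    proof (rule arg_cong[of _ _ card], intro Set.set_eqI iffI)
      fix h assume h: "h \<in> K"
      then have "h g \<in> \<Omega> - {\<alpha>, \<beta>}"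
        using g' by (auto simp: K_def)
      with h show "h \<in> (\<Union>\<delta>\<in>\<Omega> - {\<alpha>, \<beta>}. {h\<in>K. h g = \<delta>})" by auto
    qed auto
    also have "\<dots> = (\<Sum>\<delta>\<in>\<Omega> - {\<alpha>, \<beta>}. card {h\<in>K. h g = \<delta>})"
      by (rule card_UN_disjoint) (use finite_Omega finK in auto)
    also have "\<dots> = (\<Sum>\<delta>\<in>\<Omega> - {\<alpha>, \<beta>}. card {h\<in>K. h g = \<gamma>})"
      by (intro sum.cong refl antisym le) (use \<gamma> in auto)
    also have "\<dots> = card {h\<in>K. h g = \<gamma>} * (card \<Omega> - 2)"
      using ab M finite_Omega by (simp add: card_Diff_subset subset_iff numeral_2_eq_2)
    finally show ?thesis by simp
  qed
  \<comment> \<open>Double counting of the pairs (g, \<gamma>) with h g = \<gamma>. Since \<alpha>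
    always lies in the overlap and \<beta> never does, both are set aside; this leaves (card M - 1)
    (card M - 2) pairs, each realised by the same number of h.\<close>
  define N where "N = (\<lambda>h. card ((M - {\<alpha>, \<beta>}) \<inter> h ` (M - {\<alpha>})))"
  have "(\<Sum>h\<in>K. N h) * (card \<Omega> - 2)
      = (\<Sum>h\<in>K. \<Sum>\<gamma>\<in>M - {\<alpha>, \<beta>}. \<Sum>g\<in>M - {\<alpha>}. if h g = \<gamma> then 1 else 0) * (card \<Omega> - 2)"
  proof -
    have "N h = (\<Sum>\<gamma>\<in>M - {\<alpha>, \<beta>}. \<Sum>g\<in>M - {\<alpha>}. if h g = \<gamma> then 1 else 0)" if h: "h \<in> K" for h
    proof -
      have "(\<Sum>g\<in>M - {\<alpha>}. if h g = \<gamma> then 1 else 0) = (if \<gamma> \<in> h ` (M - {\<alpha>}) then 1 else (0::nat))" for \<gamma>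
      proof (cases "\<gamma> \<in> h ` (M - {\<alpha>})")
        case True
        then obtain g0 where g0: "g0 \<in> M - {\<alpha>}" "h g0 = \<gamma>" by auto
        have "(\<Sum>g\<in>M - {\<alpha>}. if h g = \<gamma> then 1 else (0::nat)) = (\<Sum>g\<in>M - {\<alpha>}. if g = g0 then 1 else 0)"
          using h g0 by (intro sum.cong) (auto simp: K_def)
        then show ?thesis using True g0 M by simp
      next
        case False
        then have "(\<Sum>g\<in>M - {\<alpha>}. if h g = \<gamma> then 1 else (0::nat)) = (\<Sum>g\<in>M - {\<alpha>}. 0)"
          by (intro sum.cong) auto
        with False show ?thesis by simp
      qed
      then show ?thesis using M by (simp add: N_def sum.If_cases)
    qed
    then show ?thesis by simp
  qed
  also have "\<dots> = (\<Sum>\<gamma>\<in>M - {\<alpha>, \<beta>}. \<Sum>g\<in>M - {\<alpha>}. (\<Sum>h\<in>K. if h g = \<gamma> then 1 else 0) * (card \<Omega> - 2))"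
    by (subst sum.swap, subst sum.swap) (simp add: sum_distrib_right)
  also have "\<dots> = (\<Sum>\<gamma>\<in>M - {\<alpha>, \<beta>}. \<Sum>g\<in>M - {\<alpha>}. card K)"
  proof (intro sum.cong refl)
    fix \<gamma> g assume "\<gamma> \<in> M - {\<alpha>, \<beta>}" "g \<in> M - {\<alpha>}"
    then show "(\<Sum>h\<in>K. if h g = \<gamma> then 1 else 0) * (card \<Omega> - 2) = card K"
      using count[of g \<gamma>] M finK by (auto simp: sum.If_cases Int_def)
  qed
  also have "\<dots> = card K * ((card M - 1) * (card M - 2))"
    using ab M by (simp add: card_Diff_subset subset_iff numeral_2_eq_2)
  finally have avg: "(\<Sum>h\<in>K. N h * (card \<Omega> - 2)) = (\<Sum>h\<in>K. (card M - 1) * (card M - 2))"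
    by (simp add: sum_distrib_right)
  have "\<exists>h\<in>K. N h * (card \<Omega> - 2) \<le> (card M - 1) * (card M - 2)"
  proof (rule ccontr)
    assume "\<not> ?thesis"
    then have "(\<Sum>h\<in>K. (card M - 1) * (card M - 2)) < (\<Sum>h\<in>K. N h * (card \<Omega> - 2))"
      using finK \<open>K \<noteq> {}\<close> by (intro sum_strict_mono) auto
    with avg show False by simp
  qed
  then obtain h where h: "h \<in> K" and N: "N h * (card \<Omega> - 2) \<le> (card M - 1) * (card M - 2)" by auto
  have hP: "h \<in> P" "h \<alpha> = \<alpha>" "h b = \<beta>" using h by (auto simp: K_def)
  have \<beta>: "\<beta> \<notin> h ` M" using hP b by (metis apply_eq_iff imageE)
  have "M \<inter> h ` M \<subseteq> insert \<alpha> ((M - {\<alpha>, \<beta>}) \<inter> h ` (M - {\<alpha>}))"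
    using \<beta> hP by auto
  then have "card (M \<inter> h ` M) \<le> card (insert \<alpha> ((M - {\<alpha>, \<beta>}) \<inter> h ` (M - {\<alpha>})))"
    using M by (intro card_mono) auto
  also have "\<dots> \<le> Suc (N h)" by (simp add: N_def card_insert_le_m1 M card_insert_if)
  finally have "card (M \<inter> h ` M) - 1 \<le> N h" by simp
  then have "(card (M \<inter> h ` M) - 1) * (card \<Omega> - 2) \<le> (card M - 1) * (card M - 2)"
    using N by (meson le_trans mult_le_mono1)
  moreover have "\<alpha> \<in> h ` M" using hP ab by (metis image_eqI)
  ultimately show ?thesis using \<beta> hP by (auto simp: \<beta>_def)
qed

text \<open>One round of the descent: the commutator of x with the conjugate from
  \<open>small_overlap\<close>. The overlap minus one is a natural number, so the average may be
  rounded down.\<close>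

lemma has_small_step:
  assumes "has_small k" "k < card \<Omega>"
  shows "has_small (3 * Suc (((k - 1) * (k - 2)) div (card \<Omega> - 2)))"
proof -
  obtain x where x: "x \<in> P" "x \<noteq> id" "card (moved x) \<le> k"
    using assms(1) by (auto simp: has_small_def)
  obtain \<alpha> where \<alpha>: "\<alpha> \<in> moved x" using x by (auto simp: moved_def fun_eq_iff)
  obtain h where h: "h \<in> P" "\<alpha> \<in> h ` moved x" "x \<alpha> \<notin> h ` moved x"
    and c: "(card (moved x \<inter> h ` moved x) - 1) * (card \<Omega> - 2) \<le> (card (moved x) - 1) * (card (moved x) - 2)"
    using small_overlap[OF x(1) \<alpha>] x assms(2) by force
  let ?z = "conj_by h x"
  have z: "?z \<in> P" "moved ?z = h ` moved x"
    using h x by (auto simp: conj_by_mem moved_conj_by)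
  have "(card (moved x) - 1) * (card (moved x) - 2) \<le> (k - 1) * (k - 2)"
    using x(3) by (intro mult_le_mono) auto
  with c have "(card (moved x \<inter> moved ?z) - 1) * (card \<Omega> - 2) \<le> (k - 1) * (k - 2)"
    using z by simp
  then have "card (moved x \<inter> moved ?z) - 1 \<le> ((k - 1) * (k - 2)) div (card \<Omega> - 2)"
    using card_ge_3 by (simp add: less_eq_div_iff_mult_less_eq)
  then have "card (moved x \<inter> moved ?z) \<le> Suc (((k - 1) * (k - 2)) div (card \<Omega> - 2))"
    by simp
  then have "card (moved (commutator ?z x)) \<le> 3 * Suc (((k - 1) * (k - 2)) div (card \<Omega> - 2))"
    using card_moved_commutator[OF x(1) z(1)] by simp
  moreover have "commutator ?z x \<noteq> id"
    using commutator_ne_id[OF x(1) z(1)] h z by auto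
  ultimately show ?thesis
    using commutator_mem[OF z(1) x(1)] by (auto simp: has_small_def)
qed

end


section \<open>Pairs of involutions\<close>

context perm_group
begin

lemma funpow_mem: "w \<in> P \<Longrightarrow> w ^^ k \<in> P"
  by (induction k) (auto simp: id_mem comp_mem simp flip: id_def)

lemma conj_by_transpose:
  assumes "h \<in> P"
  shows "conj_by h (transpose a b) = transpose (h a) (h b)"
proof
  fix p
  obtain q where "p = h q" using assms by (metis inverse_simps(1))
  then show "conj_by h (transpose a b) p = transpose (h a) (h b) p"
    using assms by (simp add: conj_by_apply transpose_def)
qed

lemma conj_by_comp:
  assumes "h \<in> P"
  shows "conj_by h (x \<circ> y) = conj_by h x \<circ> conj_by h y"
  using assms by (auto simp: conj_by_def fun_eq_iff)

text \<open>
  For involutions \<open>x\<close> and \<open>t\<close>, the orbits of the dihedral group generated by them are paths and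
  cycles with edges labelled alternately by \<open>x\<close> and \<open>t\<close>; the isolated points are the middle points of
  the paths with three points, on which \<open>x \<circ> t\<close> acts as a 3-cycle.
\<close>

definition isolated :: "('a \<Rightarrow> 'a) \<Rightarrow> ('a \<Rightarrow> 'a) \<Rightarrow> 'a set" where
  "isolated x t = {p \<in> moved x \<inter> moved t. x p \<notin> moved t \<and> t p \<notin> moved x}"

definition linked :: "('a \<Rightarrow> 'a) \<Rightarrow> ('a \<Rightarrow> 'a) \<Rightarrow> 'a set" where
  "linked x t = {p \<in> moved x \<inter> moved t. x p \<in> moved t \<or> t p \<in> moved x}"

end

locale involution_pair = perm_group +
  fixes x t :: "'a \<Rightarrow> 'a"
  assumes x_mem: "x \<in> P" and t_mem: "t \<in> P"
    and xx [simp]: "\<And>p. x (x p) = p" and tt [simp]: "\<And>p. t (t p) = p"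
begin

abbreviation "I \<equiv> isolated x t"
abbreviation "L \<equiv> linked x t"
abbreviation "w \<equiv> x \<circ> t"

lemma w_mem: "w ^^ k \<in> P"
  by (intro funpow_mem comp_mem x_mem t_mem)

lemma overlap_eq: "moved x \<inter> moved t = I \<union> L" and I_L_disjoint: "I \<inter> L = {}"
  by (auto simp: isolated_def linked_def)

lemma finite_I: "finite I" and finite_L: "finite L"
  using finite_moved[OF x_mem] by (auto simp: isolated_def linked_def)

lemma card_overlap: "card (moved x \<inter> moved t) = card I + card L"
  using overlap_eq I_L_disjoint finite_I finite_L by (simp add: card_Un_disjoint)

text \<open>A point outside the right-hand side lies on a path with at most two points, where
  \<open>w\<close> is the identity or a swap.\<close>

lemma moved_w2: "moved (w ^^ 2) \<subseteq> (I \<union> x ` I \<union> t ` I) \<union> (L \<union> x ` L \<union> t ` L)"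
proof
  fix p assume p: "p \<in> moved (w ^^ 2)"
  have "p \<in> moved x \<inter> moved t \<or> x p \<in> moved x \<inter> moved t \<or> t p \<in> moved x \<inter> moved t"
  proof (rule ccontr)
    assume n: "\<not> ?thesis"
    have "w (w p) = p"
    proof (cases "t p = p")
      case True
      then show ?thesis using n by (cases "x p = p") (auto simp: moved_def)
    next
      case False
      then have "x p = p" "x (t p) = t p" using n by (auto simp: moved_def)
      then show ?thesis by simp
    qed
    then show False using p by (simp add: moved_def numeral_2_eq_2)
  qed
  then have "p \<in> I \<union> L \<or> x p \<in> I \<union> L \<or> t p \<in> I \<union> L" by (simp only: overlap_eq)
  then show "p \<in> (I \<union> x ` I \<union> t ` I) \<union> (L \<union> x ` L \<union> t ` L)"
    using xx[of p] tt[of p] by (metis UnCI UnE imageI)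
qed

lemma w3_isolated:
  assumes "p \<in> I \<union> x ` I \<union> t ` I"
  shows "(w ^^ 3) p = p"
proof -
  obtain q where q: "q \<in> I" "p = q \<or> p = x q \<or> p = t q" using assms by auto
  then have "x (t q) = t q" "t (x q) = x q" by (auto simp: isolated_def moved_def)
  then show ?thesis using q(2) by (auto simp: eval_nat_numeral)
qed

text \<open>The exponent 6 is a common multiple of 2 and 3: it annihilates the paths with two points
  as well as the 3-cycles around isolated points, so only linked points and their neighbours
  remain.\<close>

lemma moved_w6: "moved (w ^^ 6) \<subseteq> L \<union> x ` L \<union> t ` L"
proof
  fix p assume p: "p \<in> moved (w ^^ 6)"
  have "(w ^^ 6) p = p" if "(w ^^ 2) p = p" using that by (simp add: eval_nat_numeral)
  moreover have "(w ^^ 6) p = p" if "(w ^^ 3) p = p" using that by (simp add: eval_nat_numeral)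
  ultimately have "p \<in> moved (w ^^ 2)" "p \<notin> I \<union> x ` I \<union> t ` I"
    using p w3_isolated[of p] by (auto simp: moved_def)
  then show "p \<in> L \<union> x ` L \<union> t ` L" using moved_w2 by blast
qed

text \<open>The neighbour that makes p linked is itself linked, because it has p as a neighbour in
  the overlap.\<close>

lemma linked_closed:
  assumes "p \<in> L"
  shows "x p \<in> L \<or> t p \<in> L" "x p \<noteq> p" "t p \<noteq> p"
  using assms x_mem t_mem by (auto simp: linked_def moved_def)

text \<open>By \<open>linked_closed\<close> at least one neighbour of a linked point is linked, so
  each linked point contributes at most one new point, and none if both neighbours are
  linked.\<close>

lemma card_linked:
  "card (L \<union> x ` L \<union> t ` L) \<le> 2 * card L - card {p \<in> L. x p \<in> L \<and> t p \<in> L}"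
proof -
  let ?A = "{p \<in> L. x p \<in> L}" and ?B = "{p \<in> L. t p \<in> L}"
  have "L \<union> x ` L \<union> t ` L \<subseteq> L \<union> x ` (L - ?A) \<union> t ` (L - ?B)" by auto
  then have "card (L \<union> x ` L \<union> t ` L) \<le> card (L \<union> x ` (L - ?A) \<union> t ` (L - ?B))"
    using finite_L by (intro card_mono) auto
  also have "\<dots> \<le> card L + card (x ` (L - ?A)) + card (t ` (L - ?B))"
    by (meson add_mono card_Un_le le_refl order_trans)
  also have "\<dots> \<le> card L + (card (L - ?A) + card (L - ?B))"
    using finite_L card_image_le[of "L - ?A" x] card_image_le[of "L - ?B" t] by simp
  also have "card (L - ?A) + card (L - ?B) = card ((L - ?A) \<union> (L - ?B))"
    using finite_L linked_closed(1) by (intro card_Un_disjoint[symmetric]) auto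
  also have "(L - ?A) \<union> (L - ?B) = L - {p \<in> L. x p \<in> L \<and> t p \<in> L}" by auto
  also have "card \<dots> = card L - card {p \<in> L. x p \<in> L \<and> t p \<in> L}"
    using finite_L by (intro card_Diff_subset) auto
  also have "card L + (card L - card {p \<in> L. x p \<in> L \<and> t p \<in> L})
      = 2 * card L - card {p \<in> L. x p \<in> L \<and> t p \<in> L}"
    using card_mono[OF finite_L, of "{p \<in> L. x p \<in> L \<and> t p \<in> L}"] by auto
  finally show ?thesis by simp
qed

lemma card_isolated: "card (I \<union> x ` I \<union> t ` I) \<le> 3 * card I"
proof -
  have "card (I \<union> x ` I \<union> t ` I) \<le> card I + card (x ` I) + card (t ` I)"
    by (meson add_mono card_Un_le le_refl order_trans)
  also have "\<dots> \<le> 3 * card I"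
    using card_image_le[OF finite_I, of x] card_image_le[OF finite_I, of t] by simp
  finally show ?thesis .
qed

lemma card_moved_w2:
  "card (moved (w ^^ 2)) \<le> 3 * card I + (2 * card L - card {p \<in> L. x p \<in> L \<and> t p \<in> L})"
proof -
  have "card (moved (w ^^ 2)) \<le> card ((I \<union> x ` I \<union> t ` I) \<union> (L \<union> x ` L \<union> t ` L))"
    using moved_w2 finite_I finite_L by (intro card_mono) auto
  also have "\<dots> \<le> card (I \<union> x ` I \<union> t ` I) + card (L \<union> x ` L \<union> t ` L)"
    by (rule card_Un_le)
  finally show ?thesis using card_isolated card_linked by simp
qed

lemma has_small_w2: "w ^^ 2 \<noteq> id \<Longrightarrow> has_small (3 * card I + 2 * card L)"
  using card_moved_w2 w_mem[of 2] unfolding has_small_def by force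

lemma has_small_w6:
  assumes "w ^^ 6 \<noteq> id"
  shows "has_small (2 * card L)"
proof -
  have "card (moved (w ^^ 6)) \<le> card (L \<union> x ` L \<union> t ` L)"
    using moved_w6 finite_L by (intro card_mono) auto
  then show ?thesis
    using card_linked assms w_mem[of 6] unfolding has_small_def by force
qed

lemma card_L_ne_1: "card L \<noteq> 1"
proof
  assume "card L = 1"
  then obtain p where "L = {p}" by (auto simp: card_1_singleton_iff)
  then show False using linked_closed[of p] by auto
qed

text \<open>Without linked points every component is a path with at most three points, so the cube
  of \<open>w\<close> is trivial on the 3-cycles and swaps the paths with two points. Each isolated
  point uses up one of the N two-cycles of x and one of those of t; the N - card I remaining ones of
  each survive in the cube.\<close>

lemma isolated_involution:
  assumes "L = {}" "card (moved x) = 2 * N" "card (moved t) = 2 * N"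
  shows "\<exists>u\<in>P. (\<forall>p. u (u p) = p) \<and> card (moved u) = 4 * (N - card I)"
proof -
  let ?D = "moved x \<inter> moved t"
  have D: "?D = I" using assms(1) overlap_eq by simp
  define X where "X = moved x - (I \<union> x ` I)"
  define T where "T = moved t - (I \<union> t ` I)"
  have X: "(w ^^ 3) p = x p" "x p \<in> X" if "p \<in> X" for p
  proof -
    have "x p \<notin> I" using that xx[of p] unfolding X_def by (metis Diff_iff UnCI imageI)
    then have p: "x p \<noteq> p" "t p = p" "t (x p) = x p" "x p \<in> moved x"
      using that D x_mem by (auto simp: X_def moved_def)
    then show "(w ^^ 3) p = x p" by (simp add: eval_nat_numeral)
    have "x p \<notin> x ` I" using that x_mem by (auto simp: X_def)
    with p \<open>x p \<notin> I\<close> show "x p \<in> X" by (simp add: X_def)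
  qed
  have T: "(w ^^ 3) p = t p" "t p \<in> T" if "p \<in> T" for p
  proof -
    have "t p \<notin> I" using that tt[of p] unfolding T_def by (metis Diff_iff UnCI imageI)
    then have p: "t p \<noteq> p" "x p = p" "x (t p) = t p" "t p \<in> moved t"
      using that D t_mem by (auto simp: T_def moved_def)
    then show "(w ^^ 3) p = t p" by (simp add: eval_nat_numeral)
    have "t p \<notin> t ` I" using that t_mem by (auto simp: T_def)
    with p \<open>t p \<notin> I\<close> show "t p \<in> T" by (simp add: T_def)
  qed
  have rest: "(w ^^ 3) p = p" if "p \<notin> X" "p \<notin> T" for p
  proof (cases "p \<in> I \<union> x ` I \<union> t ` I")
    case True
    then show ?thesis by (rule w3_isolated)
  next
    case False
    then have "x p = p" "t p = p" using that by (auto simp: X_def T_def moved_def)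
    then show ?thesis by (simp add: eval_nat_numeral)
  qed
  have "moved (w ^^ 3) = X \<union> T"
  proof (intro Set.set_eqI iffI)
    fix p assume "p \<in> moved (w ^^ 3)"
    then show "p \<in> X \<union> T" using rest[of p] by (auto simp: moved_def)
  next
    fix p assume "p \<in> X \<union> T"
    then show "p \<in> moved (w ^^ 3)"
      using X(1)[of p] T(1)[of p] by (auto simp: moved_def X_def T_def)
  qed
  moreover have "X \<inter> T = {}" using D by (auto simp: X_def T_def)
  moreover have fin: "finite (moved x)" "finite (moved t)"
    using finite_moved x_mem t_mem by auto
  moreover have "card X = 2 * N - 2 * card I"
  proof -
    have "I \<union> x ` I \<subseteq> moved x" using x_mem by (auto simp: isolated_def moved_def)
    moreover have "I \<inter> x ` I = {}" by (auto simp: isolated_def)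
    moreover have "card (x ` I) = card I" using x_mem by (simp add: card_image inj_on_def)
    ultimately show ?thesis
      using finite_I assms(2) by (simp add: X_def card_Diff_subset card_Un_disjoint)
  qed
  moreover have "card T = 2 * N - 2 * card I"
  proof -
    have "I \<union> t ` I \<subseteq> moved t" using t_mem by (auto simp: isolated_def moved_def)
    moreover have "I \<inter> t ` I = {}" by (auto simp: isolated_def)
    moreover have "card (t ` I) = card I" using t_mem by (simp add: card_image inj_on_def)
    ultimately show ?thesis
      using finite_I assms(3) by (simp add: T_def card_Diff_subset card_Un_disjoint)
  qed
  ultimately have "card (moved (w ^^ 3)) = 4 * (N - card I)"
    by (simp add: X_def T_def card_Un_disjoint)
  moreover have "(w ^^ 3) ((w ^^ 3) p) = p" for p
    using X[of p] T[of p] rest[of p] X(1)[of "x p"] T(1)[of "t p"] by (metis xx tt)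
  ultimately show ?thesis using w_mem by blast
qed

text \<open>Near the end of a path \<open>w\<close> runs out to the end point and back: t p is moved
  by t but not linked, hence fixed by x, so \<open>w\<close> takes p to t p and then to x p. The
  next lemma is the mirror case.\<close>

lemma w2_x:
  assumes "p \<in> L" "t p \<notin> L"
  shows "(w ^^ 2) p = x p"
  using assms t_mem by (auto simp: linked_def moved_def eval_nat_numeral)

lemma w2_t:
  assumes "t p \<in> L" "x (t p) \<notin> L"
  shows "(w ^^ 2) p = t p"
  using assms x_mem by (auto simp: linked_def moved_def eval_nat_numeral)

lemma w6_eq: "(w ^^ 6) p = (w ^^ 2) ((w ^^ 2) ((w ^^ 2) p))"
  and w4_eq: "(w ^^ 4) p = (w ^^ 2) ((w ^^ 2) p)"
  by (simp_all add: eval_nat_numeral)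

text \<open>The two linked points are neighbours. If only one of x and t joins them, they are the
  middle of a path with four points, where the square of \<open>w\<close> swaps them, so the sixth
  power is non-trivial and moves at most 4 points. If both join them, they form a component of their
  own on which the square is trivial, leaving only the 3-cycles.\<close>

lemma two_linked:
  assumes "card L = 2" "w ^^ 2 \<noteq> id"
  shows "has_small 4 \<or> has_small (3 * card I)"
proof -
  obtain \<delta> \<epsilon> where L: "L = {\<delta>, \<epsilon>}" "\<delta> \<noteq> \<epsilon>"
    using assms(1) by (auto simp: card_2_iff)
  have nb: "x \<delta> = \<epsilon> \<or> t \<delta> = \<epsilon>" "x \<delta> \<noteq> \<delta>" "t \<delta> \<noteq> \<delta>" "x \<epsilon> \<noteq> \<epsilon>" "t \<epsilon> \<noteq> \<epsilon>"
    using linked_closed[of \<delta>] linked_closed[of \<epsilon>] L by auto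
  have mem: "\<delta> \<in> L" "\<epsilon> \<in> L" by (simp_all add: L)
  have "w ^^ 6 \<noteq> id" if "x \<delta> \<noteq> \<epsilon> \<or> t \<delta> \<noteq> \<epsilon>"
  proof -
    have "(w ^^ 2) \<delta> = \<epsilon> \<and> (w ^^ 2) \<epsilon> = \<delta>"
    proof (cases "x \<delta> = \<epsilon>")
      case True
      then have "x \<epsilon> = \<delta>" "t \<delta> \<noteq> \<epsilon>" using that xx[of \<delta>] by auto
      moreover from this have "t \<epsilon> \<noteq> \<delta>" using tt[of \<epsilon>] by metis
      ultimately have "t \<delta> \<notin> L" "t \<epsilon> \<notin> L" using nb(3,5) by (simp_all add: L)
      then have "(w ^^ 2) \<delta> = x \<delta>" "(w ^^ 2) \<epsilon> = x \<epsilon>"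
        using w2_x[of \<delta>] w2_x[of \<epsilon>] mem by blast+
      with True \<open>x \<epsilon> = \<delta>\<close> show ?thesis by (simp only:)
    next
      case False
      then have td: "t \<delta> = \<epsilon>" "t \<epsilon> = \<delta>" using nb(1) tt[of \<delta>] by auto
      have "x \<epsilon> \<noteq> \<delta>" using False xx[of \<epsilon>] by metis
      then have "x \<delta> \<notin> L" "x \<epsilon> \<notin> L" using nb(2,4) False by (simp_all add: L)
      then have "(w ^^ 2) \<delta> = t \<delta>" "(w ^^ 2) \<epsilon> = t \<epsilon>"
        using w2_t[of \<delta>] w2_t[of \<epsilon>] mem by (simp_all only: td simp_thms)
      with td show ?thesis by (simp only:)
    qed
    then have "(w ^^ 6) \<delta> \<noteq> \<delta>" using L(2)[symmetric] by (simp only: w6_eq simp_thms)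
    then show ?thesis by auto
  qed
  moreover have "has_small (3 * card I)" if xt: "x \<delta> = \<epsilon>" "t \<delta> = \<epsilon>"
  proof -
    have "x \<epsilon> = \<delta>" "t \<epsilon> = \<delta>" using xt xx[of \<delta>] tt[of \<delta>] by metis+
    then have "L \<union> x ` L \<union> t ` L = L" "\<forall>p\<in>L. (w ^^ 2) p = p"
      using xt L by (auto simp: eval_nat_numeral)
    then have "moved (w ^^ 2) \<subseteq> I \<union> x ` I \<union> t ` I"
      using moved_w2 by (auto simp: moved_def)
    then have "card (moved (w ^^ 2)) \<le> card (I \<union> x ` I \<union> t ` I)"
      using finite_I by (intro card_mono) auto
    then show ?thesis
      using card_isolated assms(2) w_mem[of 2] unfolding has_small_def by force
  qed
  ultimately show ?thesis using has_small_w6 assms(1) by fastforce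
qed

text \<open>The linked points turn out to be the three inner points of a path with five points.
  There \<open>w\<close> is a 5-cycle, so its sixth power acts as \<open>w\<close> itself and is not
  the identity.\<close>

lemma three_linked:
  assumes "card L = 3"
  shows "has_small 6"
proof -
  have third: "\<exists>r\<in>L. r \<noteq> u \<and> r \<noteq> v" for u v
  proof (rule ccontr)
    assume "\<not> ?thesis"
    then have "L \<subseteq> {u, v}" by blast
    then have "card L \<le> card {u, v}" by (rule card_mono[rotated]) simp
    also have "\<dots> \<le> 2" by (simp add: card_insert_if)
    finally show False using assms by simp
  qed
  \<comment> \<open>Otherwise t would match the three points of L in pairs, by
    \<open>linked_closed\<close>.\<close>
  have "\<exists>p\<in>L. x p \<in> L"
  proof (rule ccontr)
    assume "\<not> ?thesis"
    then have tL: "t p \<in> L" if "p \<in> L" for p using linked_closed(1) that by blast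
    obtain a where a: "a \<in> L" using third by blast
    obtain r where r: "r \<in> L" "r \<noteq> a" "r \<noteq> t a" using third by blast
    have "t r \<noteq> a" "t r \<noteq> t a" using r tt[of r] tt[of a] by metis+
    then have "card {a, t a, r, t r} = 4" using a r linked_closed(3)[of a] linked_closed(3)[of r] by auto
    moreover have "{a, t a, r, t r} \<subseteq> L" using a r tL by blast
    ultimately show False using card_mono[OF finite_L, of "{a, t a, r, t r}"] assms by simp
  qed
  then obtain p where p: "p \<in> L" "x p \<in> L" by blast
  obtain r where r: "r \<in> L" "r \<noteq> p" "r \<noteq> x p" using third by blast
  have "x r \<notin> L"
  proof
    assume "x r \<in> L"
    moreover have "x r \<noteq> p" "x r \<noteq> x p" using r xx[of r] xx[of p] by metis+
    ultimately have "card {p, x p, r, x r} = 4" "{p, x p, r, x r} \<subseteq> L"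
      using p r linked_closed(2)[of p] linked_closed(2)[of r] by auto
    then show False using card_mono[OF finite_L, of "{p, x p, r, x r}"] assms by simp
  qed
  then have "t r \<in> L" using linked_closed(1) r(1) by blast
  moreover have "t r \<in> {p, x p}"
  proof (rule ccontr)
    assume "t r \<notin> {p, x p}"
    then have "card {p, x p, r, t r} = 4" "{p, x p, r, t r} \<subseteq> L"
      using p r linked_closed(2)[of p] linked_closed(3)[of r] \<open>t r \<in> L\<close> by auto
    then show False using card_mono[OF finite_L, of "{p, x p, r, t r}"] assms by simp
  qed
  ultimately have "x (t r) \<in> {p, x p}" by auto
  then have "\<exists>\<epsilon>\<in>L. x \<epsilon> \<in> L \<and> t \<epsilon> \<in> L \<and> x \<epsilon> \<noteq> t \<epsilon>"
    using p r \<open>t r \<in> L\<close> tt[of r] by (intro bexI[of _ "t r"]) auto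
  then obtain \<epsilon> where e: "\<epsilon> \<in> L" "x \<epsilon> \<in> L" "t \<epsilon> \<in> L" "x \<epsilon> \<noteq> t \<epsilon>" by auto
  define \<delta> \<zeta> where "\<delta> = x \<epsilon>" and "\<zeta> = t \<epsilon>"
  have ne: "\<delta> \<noteq> \<epsilon>" "\<zeta> \<noteq> \<epsilon>" "\<delta> \<noteq> \<zeta>" "x \<delta> = \<epsilon>" "t \<zeta> = \<epsilon>"
    using e linked_closed[of \<epsilon>] by (auto simp: \<delta>_def \<zeta>_def)
  have "{\<delta>, \<epsilon>, \<zeta>} \<subseteq> L" using e by (auto simp: \<delta>_def \<zeta>_def)
  moreover have "card {\<delta>, \<epsilon>, \<zeta>} = card L" using ne assms by simp
  ultimately have L': "L = {\<delta>, \<epsilon>, \<zeta>}" using card_subset_eq[OF finite_L] by metis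
  have mem: "\<delta> \<in> L" "\<zeta> \<in> L" using e by (simp_all only: \<delta>_def \<zeta>_def)
  have "t \<delta> \<noteq> \<epsilon>" "t \<delta> \<noteq> \<zeta>" using ne(1,3,5) tt[of \<delta>] \<zeta>_def tt[of \<zeta>] by metis+
  then have "t \<delta> \<notin> L" using linked_closed(3)[OF mem(1)] by (simp add: L')
  have "x \<zeta> \<noteq> \<epsilon>" "x \<zeta> \<noteq> \<delta>" using ne(2,3,4) xx[of \<zeta>] \<delta>_def xx[of \<delta>] by metis+
  then have "x \<zeta> \<notin> L" using linked_closed(2)[OF mem(2)] by (simp add: L')
  have "x (t \<delta>) = t \<delta>" "t (x \<zeta>) = x \<zeta>"
    using \<open>t \<delta> \<notin> L\<close> \<open>x \<zeta> \<notin> L\<close> mem by (auto simp: linked_def moved_def)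
  then have "(w ^^ 6) \<epsilon> = x \<zeta>"
    using ne by (simp add: eval_nat_numeral flip: \<delta>_def \<zeta>_def)
  then have "(w ^^ 6) \<epsilon> \<noteq> \<epsilon>" using \<open>x \<zeta> \<notin> L\<close> L' by auto
  then have "w ^^ 6 \<noteq> id" by auto
  then show ?thesis using has_small_w6 assms by simp
qed

text \<open>If some linked point has two linked neighbours, \<open>card_moved_w2\<close> leaves at
  most 7 points. Otherwise the linked points form two adjacent pairs in paths with four points, so
  the square of \<open>w\<close> is an involution. It moves at most 8 points, and exactly 8 is kept
  as an outcome of its own since an involution can be processed again.\<close>

lemma four_linked:
  assumes "card L = 4" "I = {}" "w ^^ 2 \<noteq> id"
  shows "has_small 7 \<or> (\<exists>u\<in>P. (\<forall>p. u (u p) = p) \<and> card (moved u) = 8)"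
proof (cases "{p \<in> L. x p \<in> L \<and> t p \<in> L} = {}")
  case False
  then have "card {p \<in> L. x p \<in> L \<and> t p \<in> L} > 0" using finite_L by (simp add: card_gt_0_iff)
  then have "card (moved (w ^^ 2)) \<le> 7" using card_moved_w2 assms by simp
  then show ?thesis using assms(3) w_mem[of 2] unfolding has_small_def by blast
next
  case True
  have L4: "(w ^^ 4) p = p" if p: "p \<in> L" for p
  proof (cases "x p \<in> L")
    case x: True
    then have "t p \<notin> L" "t (x p) \<notin> L" using True p xx[of p] by fastforce+
    then show ?thesis using w2_x p x by (simp only: w4_eq) simp
  next
    case False
    then have "t p \<in> L" using linked_closed p by blast
    moreover from this have "x (t p) \<notin> L" using True p tt[of p] by fastforce
    ultimately show ?thesis using w2_t[of p] w2_t[of "t p"] p False by (simp only: w4_eq) simp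
  qed
  have w4: "(w ^^ 4) p = p" for p
  proof -
    consider "p \<in> L" | q where "q \<in> L" "p = x q" "p \<notin> L" | q where "q \<in> L" "p = t q" "p \<notin> L"
      | "p \<notin> L \<union> x ` L \<union> t ` L" by blast
    then show ?thesis
    proof cases
      case 1 then show ?thesis by (rule L4)
    next
      case (2 q)
      \<comment> \<open>Here p is an end point of its path with linked neighbour q; the claim is
        carried over from q by \<open>w\<close>, which commutes with its powers.\<close>
      then have "t p = p" using x_mem by (auto simp: linked_def moved_def)
      then have "w p = q" using 2 by simp
      then have "w ((w ^^ 4) p) = w p"
        using L4[OF 2(1)] funpow_swap1[of w 4 p] by (simp only:)
      moreover have "w \<in> P" using w_mem[of 1] by simp
      ultimately show ?thesis by (simp only: apply_eq_iff)
    next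
      case (3 q)
      then have "x p = p" using t_mem by (auto simp: linked_def moved_def)
      then have "p = w q" using 3 by simp
      then show ?thesis using L4[OF 3(1)] funpow_swap1[of w 4 q] by (simp only:)
    next
      case 4
      then have "(w ^^ 2) p = p" using moved_w2 assms(2) by (auto simp: moved_def)
      then show ?thesis by (simp only: w4_eq)
    qed
  qed
  have "card (moved (w ^^ 2)) \<le> 8" using card_moved_w2 assms by simp
  then consider "card (moved (w ^^ 2)) \<le> 7" | "card (moved (w ^^ 2)) = 8" by linarith
  then show ?thesis
  proof cases
    case 1
    then show ?thesis using assms(3) w_mem[of 2] unfolding has_small_def by blast
  next
    case 2
    then show ?thesis using w_mem[of 2] w4 by (intro disjI2 bexI[of _ "w ^^ 2"]) (simp_all only: w4_eq simp_thms)
  qed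
qed

end

context triply_transitive
begin

text \<open>For involutions the square of x \<circ> z is a commutator, so its being non-trivial is
  the argument of \<open>commutator_ne_id\<close> again, at the same point \<alpha>. The partner z
  is a conjugate of x and therefore moves equally many points.\<close>

lemma ex_involution_pair:
  assumes "x \<in> P" "\<And>p. x (x p) = p" "card (moved x) = 2 * N" "0 < N" "2 * N < card \<Omega>"
  shows "\<exists>z. involution_pair \<Omega> P x z \<and> card (moved z) = 2 * N \<and> (x \<circ> z) ^^ 2 \<noteq> id \<and>
    card (isolated x z) + card (linked x z) \<noteq> 0 \<and>
    card (isolated x z) + card (linked x z) \<le> Suc ((2 * N - 1) * (2 * N - 2) div (card \<Omega> - 2))"
proof -
  have "moved x \<noteq> {}" using assms(3,4) by auto
  then obtain \<alpha> where \<alpha>: "\<alpha> \<in> moved x" by blast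
  obtain h where h: "h \<in> P" "\<alpha> \<in> h ` moved x" "x \<alpha> \<notin> h ` moved x"
    and c: "(card (moved x \<inter> h ` moved x) - 1) * (card \<Omega> - 2) \<le> (card (moved x) - 1) * (card (moved x) - 2)"
    using small_overlap[OF assms(1) \<alpha>] assms(3,5) by auto
  define z where "z = conj_by h x"
  have z: "z \<in> P" "moved z = h ` moved x" "card (moved z) = 2 * N"
    using h assms card_moved_conj_by[of h x] by (auto simp: z_def conj_by_mem moved_conj_by)
  have zz: "z (z p) = p" for p using h(1) assms(2) by (simp add: z_def conj_by_def)
  interpret ip: involution_pair \<Omega> P x z
    by unfold_locales (use assms z zz in auto)
  have "z (x \<alpha>) \<noteq> x (z \<alpha>)"
  proof -
    have "z (x \<alpha>) = x \<alpha>" "z \<alpha> \<noteq> \<alpha>"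
      using h(2,3) by (simp_all only: z(2)[symmetric] in_moved_iff simp_thms)
    then show ?thesis using assms(1) by simp
  qed
  moreover have "z (x \<alpha>) = x (z \<alpha>)" if "(x \<circ> z) ^^ 2 = id"
  proof -
    have "x (z (x (z (z (x \<alpha>))))) = z (x \<alpha>)"
      using fun_cong[OF that, of "z (x \<alpha>)"] by (simp add: numeral_2_eq_2)
    then show ?thesis using assms(2) zz by simp
  qed
  ultimately have "(x \<circ> z) ^^ 2 \<noteq> id" by blast
  moreover have "card (moved x \<inter> moved z) \<noteq> 0"
    using \<alpha> h z finite_moved[OF assms(1)] by auto
  moreover have "card (moved x \<inter> moved z) - 1 \<le> (2 * N - 1) * (2 * N - 2) div (card \<Omega> - 2)"
    using c z assms(3) card_ge_3 by (simp add: less_eq_div_iff_mult_less_eq)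
  ultimately show ?thesis
    using ip.involution_pair_axioms z(3) ip.card_overlap by (intro exI[of _ z]) auto
qed

end


section \<open>Elements of small support\<close>

context triply_transitive
begin

section \<open>The alternating group from minimal degree 3\<close>

text \<open>A non-trivial element moving at most three points is a transposition or a 3-cycle.
  Double transitivity conjugates a transposition to all others, and triple transitivity does the
  same for 3-cycles.\<close>

lemma three_cycles_mem:
  assumes "has_small 3" "a \<in> \<Omega>" "b \<in> \<Omega>" "c \<in> \<Omega>" "a \<noteq> b" "a \<noteq> c" "b \<noteq> c"
  shows "transpose a b \<circ> transpose b c \<in> P"
proof -
  obtain y where y: "y \<in> P" "y \<noteq> id" "card (moved y) \<le> 3"
    using assms(1) by (auto simp: has_small_def)
  obtain p where p: "y p \<noteq> p" using y(2) by (auto simp: fun_eq_iff)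
  define q where "q = y p"
  have pq: "p \<noteq> q" "y q \<noteq> q" using p y(1) by (auto simp: q_def)
  have Om: "p \<in> \<Omega>" "q \<in> \<Omega>"
    using p pq moved_subset[OF y(1)] by (auto simp: moved_def)
  show ?thesis
  proof (cases "y q = p")
    case True
    have "y r = r" if r: "r \<noteq> p" "r \<noteq> q" for r
    proof (rule ccontr)
      assume "y r \<noteq> r"
      moreover have "y r \<noteq> p" "y r \<noteq> q" using r True y(1) by (metis apply_eq_iff q_def)+
      ultimately have "card {p, q, r, y r} = 4" "{p, q, r, y r} \<subseteq> moved y"
        using r p pq y(1) by (auto simp: moved_def)
      then show False using card_mono[OF finite_moved[OF y(1)], of "{p, q, r, y r}"] y(3) by simp
    qed
    then have y_eq: "y = transpose p q"
      using True by (auto simp: fun_eq_iff transpose_def q_def)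
    have "transpose u v \<in> P" if uv: "u \<in> \<Omega>" "v \<in> \<Omega>" "u \<noteq> v" for u v
    proof -
      obtain h where "h \<in> P" "h p = u" "h q = v"
        using trans2[OF Om pq(1) uv] by blast
      then show ?thesis using conj_by_mem[OF _ y(1), of h] by (simp add: y_eq conj_by_transpose)
    qed
    then show ?thesis using assms by (intro comp_mem) auto
  next
    case False
    define r where "r = y q"
    have r: "r \<noteq> p" "r \<noteq> q" "y r \<noteq> r" "y r \<noteq> q"
      using False pq y(1) by (auto simp: r_def) (metis apply_eq_iff q_def)
    have sub: "{p, q, r} \<subseteq> moved y" using p pq r by (auto simp: moved_def)
    moreover have "card {p, q, r} = 3" using pq r by auto
    ultimately have M: "moved y = {p, q, r}"
      using card_seteq[OF finite_moved[OF y(1)] sub] y(3) by simp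
    moreover have "y r \<in> moved y" using r y(1) by (simp add: moved_def)
    ultimately have "y r = p" using r by auto
    then have y_eq: "y = transpose p q \<circ> transpose q r"
      using M pq r by (auto simp: fun_eq_iff transpose_def q_def[symmetric] r_def[symmetric] moved_def)
    have "r \<in> \<Omega>" using sub moved_subset[OF y(1)] by auto
    then obtain h where h: "h \<in> P" "h p = a" "h q = b" "h r = c"
      using trans3[OF Om(1,2) _ pq(1) r(1)[symmetric] r(2)[symmetric], of a b c] assms by blast
    then have "conj_by h y = transpose a b \<circ> transpose b c"
      by (simp add: y_eq conj_by_comp conj_by_transpose)
    then show ?thesis using conj_by_mem[OF h(1) y(1)] by simp
  qed
qed

text \<open>Two transpositions with a common point give a 3-cycle or the identity; for disjoint ones
  the factor \<open>transpose b c\<close> is inserted twice, which cancels and yields two such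
  products.\<close>

lemma two_transpositions_mem:
  assumes small: "has_small 3" and ab: "a \<in> \<Omega>" "b \<in> \<Omega>" "a \<noteq> b" and cd: "c \<in> \<Omega>" "d \<in> \<Omega>" "c \<noteq> d"
  shows "transpose a b \<circ> transpose c d \<in> P"
proof -
  have share: "transpose a b \<circ> transpose c d \<in> P" if "b = c" "a \<noteq> b" "c \<noteq> d" "{a, b, c, d} \<subseteq> \<Omega>" for a b c d
  proof (cases "a = d")
    case True
    then have "transpose a b \<circ> transpose c d = id"
      using that by (simp add: fun_eq_iff transpose_def)
    then show ?thesis using id_mem by simp
  next
    case False
    then show ?thesis using three_cycles_mem[OF small, of a b d] that by auto
  qed
  consider "b = c" | "b = d" | "a = c" | "a = d" | "b \<noteq> c" by blast
  then show ?thesis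
  proof cases
    case 1
    show ?thesis by (rule share) (use assms 1 in auto)
  next
    case 2
    have "transpose a b \<circ> transpose d c \<in> P" by (rule share) (use assms 2 in auto)
    then show ?thesis by (simp only: transpose_commute[of d c])
  next
    case 3
    have "transpose b a \<circ> transpose c d \<in> P" by (rule share) (use assms 3 in auto)
    then show ?thesis by (simp only: transpose_commute[of b a])
  next
    case 4
    have "transpose b a \<circ> transpose d c \<in> P" by (rule share) (use assms 4 in auto)
    then show ?thesis by (simp only: transpose_commute[of b a] transpose_commute[of d c])
  next
    case 5
    have "(transpose a b \<circ> transpose b c) \<circ> (transpose b c \<circ> transpose c d) \<in> P"
      by (intro comp_mem share) (use assms 5 in auto)
    also have "(transpose a b \<circ> transpose b c) \<circ> (transpose b c \<circ> transpose c d) = transpose a b \<circ> transpose c d"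
      by (simp add: fun_eq_iff)
    finally show ?thesis .
  qed
qed

lemma alternating_subset:
  assumes small: "has_small 3" and "\<pi> permutes \<Omega>" "evenperm \<pi>"
  shows "\<pi> \<in> P"
proof -
  \<comment> \<open>The clause on odd permutations carries the induction: an odd \<pi> need not be
    in P, but its composition with any transposition of two points of \<Omega> is.\<close>
  have "(evenperm \<pi> \<longrightarrow> \<pi> \<in> P) \<and>
      (\<not> evenperm \<pi> \<longrightarrow> (\<forall>a\<in>\<Omega>. \<forall>b\<in>\<Omega>. a \<noteq> b \<longrightarrow> transpose a b \<circ> \<pi> \<in> P))"
    using assms(2) finite_Omega
  proof (induction rule: permutes_induct)
    case id
    then show ?case using id_mem by (simp add: id_def)
  next
    case (swap a b \<pi>)
    have per: "permutation \<pi>" using swap finite_Omega permutes_imp_permutation by blast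
    have ev: "evenperm (transpose a b \<circ> \<pi>) \<longleftrightarrow> \<not> evenperm \<pi>" if "a \<noteq> b"
      using evenperm_comp[OF permutation_swap_id per] that by (simp add: evenperm_swap)
    show ?case
    proof (cases "a = b")
      case True
      then show ?thesis using swap by simp
    next
      case False
      have "transpose c d \<circ> (transpose a b \<circ> \<pi>) \<in> P"
        if "evenperm \<pi>" "c \<in> \<Omega>" "d \<in> \<Omega>" "c \<noteq> d" for c d
        using comp_mem[OF two_transpositions_mem[OF small that(2,3,4) swap(1,2) False], of \<pi>] swap that
        by (simp add: comp_assoc)
      then show ?thesis using swap ev[OF False] False by (auto simp: comp_def)
    qed
  qed
  then show ?thesis using assms(3) by blast
qed

text \<open>
  Here \<open>i\<close> and \<open>l\<close> are the numbers of isolated and linked points of \<open>x\<close> and a conjugate of \<open>x\<close>.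
\<close>

lemma involution_outcomes:
  assumes "x \<in> P" "\<And>p. x (x p) = p" "card (moved x) = 2 * N" "0 < N" "2 * N < card \<Omega>"
    and bound: "Suc ((2 * N - 1) * (2 * N - 2) div (card \<Omega> - 2)) \<le> d"
  obtains i l where "0 < i + l" "i + l \<le> d" "l \<noteq> 1" "has_small (3 * i + 2 * l)"
    "l = 0 \<Longrightarrow> \<exists>u\<in>P. (\<forall>p. u (u p) = p) \<and> card (moved u) = 4 * (N - i)"
    "l = 2 \<Longrightarrow> has_small 4 \<or> has_small (3 * i)"
    "l = 3 \<Longrightarrow> has_small 6"
    "l = 4 \<Longrightarrow> i = 0 \<Longrightarrow> has_small 7 \<or> (\<exists>u\<in>P. (\<forall>p. u (u p) = p) \<and> card (moved u) = 8)"
proof -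
  obtain z where z: "involution_pair \<Omega> P x z" "card (moved z) = 2 * N" "(x \<circ> z) ^^ 2 \<noteq> id"
    "card (isolated x z) + card (linked x z) \<noteq> 0"
    "card (isolated x z) + card (linked x z) \<le> Suc ((2 * N - 1) * (2 * N - 2) div (card \<Omega> - 2))"
    using ex_involution_pair[OF assms(1-5)] by blast
  interpret ip: involution_pair \<Omega> P x z by (rule z(1))
  show thesis
  proof (rule that[of "card (isolated x z)" "card (linked x z)"])
    show "card (linked x z) \<noteq> 1" by (rule ip.card_L_ne_1)
    show "has_small (3 * card (isolated x z) + 2 * card (linked x z))" by (rule ip.has_small_w2[OF z(3)])
    show "\<exists>u\<in>P. (\<forall>p. u (u p) = p) \<and> card (moved u) = 4 * (N - card (isolated x z))"
      if "card (linked x z) = 0"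
      using ip.isolated_involution[OF _ assms(3) z(2)] that ip.finite_L by simp
    show "has_small 4 \<or> has_small (3 * card (isolated x z))" if "card (linked x z) = 2"
      by (rule ip.two_linked[OF that z(3)])
    show "has_small 6" if "card (linked x z) = 3" by (rule ip.three_linked[OF that])
    show "has_small 7 \<or> (\<exists>u\<in>P. (\<forall>p. u (u p) = p) \<and> card (moved u) = 8)"
      if "card (linked x z) = 4" "card (isolated x z) = 0"
      using ip.four_linked[OF that(1) _ z(3)] that(2) ip.finite_I by simp
  qed (use z(4,5) bound in auto)
qed

lemma has_small_of_moved:
  "u \<in> P \<Longrightarrow> card (moved u) = k \<Longrightarrow> 0 < k \<Longrightarrow> has_small k"
  unfolding has_small_def by (intro bexI[of _ u]) (auto simp: moved_def)

lemma has_small_step_to: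
  assumes "has_small k" "k < card \<Omega>" "3 * Suc (((k - 1) * (k - 2)) div (card \<Omega> - 2)) \<le> l"
  shows "has_small l"
  using has_small_step[OF assms(1,2)] assms(3) has_small_mono by blast

section \<open>Descents for the individual numbers of edges\<close>

text \<open>The overlap has at most 1 + 17 * 16 div 53 = 6 points. Six isolated points would give
  only 18 again, but then the cube of the product is an involution moving 4 * (9 - 6) = 12 points;
  all other cases give at most 16, because l = 1 is impossible. From 16 the plain steps run through
  12, 9, 6 and 3.\<close>

lemma descent_11:
  assumes "card \<Omega> = 55" "x \<in> P" "\<And>p. x (x p) = p" "card (moved x) = 18"
  shows "has_small 3"
proof -
  have "has_small 16"
  proof (rule involution_outcomes[of x 9 6])
    fix i l :: nat
    assume il: "0 < i + l" "i + l \<le> 6" "l \<noteq> 1" "has_small (3 * i + 2 * l)"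
      and l0: "l = 0 \<Longrightarrow> \<exists>u\<in>P. (\<forall>p. u (u p) = p) \<and> card (moved u) = 4 * (9 - i)"
    show "has_small 16"
    proof (cases "l = 0 \<and> i = 6")
      case True
      then show ?thesis using l0 has_small_of_moved has_small_mono[of 12 16] by auto
    next
      case False
      then have "3 * i + 2 * l \<le> 16" using il by presburger
      then show ?thesis using il(4) has_small_mono by blast
    qed
  qed (use assms in auto)
  then have "has_small 12" by (rule has_small_step_to) (simp_all add: assms)
  then have "has_small 9" by (rule has_small_step_to) (simp_all add: assms)
  then have "has_small 6" by (rule has_small_step_to) (simp_all add: assms)
  then show ?thesis by (rule has_small_step_to) (simp_all add: assms)
qed

text \<open>The overlap has at most 1 + 15 * 14 div 43 = 5 points. The value 13 is low enough for
  the plain steps 12, 9, 6, 3, whereas 15, the value for five isolated points, reproduces itself and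
  is replaced by 4 * (8 - 5) = 12.\<close>

lemma descent_10:
  assumes "card \<Omega> = 45" "x \<in> P" "\<And>p. x (x p) = p" "card (moved x) = 16"
  shows "has_small 3"
proof -
  have "has_small 13"
  proof (rule involution_outcomes[of x 8 5])
    fix i l :: nat
    assume il: "0 < i + l" "i + l \<le> 5" "l \<noteq> 1" "has_small (3 * i + 2 * l)"
      and l0: "l = 0 \<Longrightarrow> \<exists>u\<in>P. (\<forall>p. u (u p) = p) \<and> card (moved u) = 4 * (8 - i)"
    show "has_small 13"
    proof (cases "l = 0 \<and> i = 5")
      case True
      then show ?thesis using l0 has_small_of_moved has_small_mono[of 12 13] by auto
    next
      case False
      then have "3 * i + 2 * l \<le> 13" using il by presburger
      then show ?thesis using il(4) has_small_mono by blast
    qed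
  qed (use assms in auto)
  then have "has_small 12" by (rule has_small_step_to) (simp_all add: assms)
  then have "has_small 9" by (rule has_small_step_to) (simp_all add: assms)
  then have "has_small 6" by (rule has_small_step_to) (simp_all add: assms)
  then show ?thesis by (rule has_small_step_to) (simp_all add: assms)
qed

text \<open>Plain steps reproduce 12 but lead from 11 to 9, 6 and 3, hence the target 11. Four
  isolated points produce an involution with 4 * (7 - 4) = 12 moved points, on which the
  construction is repeated.\<close>

lemma descent_9:
  assumes "card \<Omega> = 36" "x \<in> P" "\<And>p. x (x p) = p" "card (moved x) = 14"
  shows "has_small 3"
proof -
  have twelve: "has_small 11" if u: "u \<in> P" "\<And>p. u (u p) = p" "card (moved u) = 12" for u
  proof (rule involution_outcomes[of u 6 4])
    fix i l :: nat
    assume il: "0 < i + l" "i + l \<le> 4" "l \<noteq> 1" "has_small (3 * i + 2 * l)"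
      and l0: "l = 0 \<Longrightarrow> \<exists>u\<in>P. (\<forall>p. u (u p) = p) \<and> card (moved u) = 4 * (6 - i)"
    show "has_small 11"
    proof (cases "l = 0 \<and> i = 4")
      case True
      then show ?thesis using l0 has_small_of_moved has_small_mono[of 8 11] by auto
    next
      case False
      then have "3 * i + 2 * l \<le> 11" using il by presburger
      then show ?thesis using il(4) has_small_mono by blast
    qed
  qed (use assms(1) u in auto)
  have "has_small 11"
  proof (rule involution_outcomes[of x 7 5])
    fix i l :: nat
    assume il: "0 < i + l" "i + l \<le> 5" "l \<noteq> 1" "has_small (3 * i + 2 * l)"
      and l0: "l = 0 \<Longrightarrow> \<exists>u\<in>P. (\<forall>p. u (u p) = p) \<and> card (moved u) = 4 * (7 - i)"
      and l2: "l = 2 \<Longrightarrow> has_small 4 \<or> has_small (3 * i)"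
      and l3: "l = 3 \<Longrightarrow> has_small 6"
    have "(l = 0 \<and> i = 5) \<or> (l = 0 \<and> i = 4) \<or> (l = 2 \<and> i = 3) \<or> l = 3 \<or> 3 * i + 2 * l \<le> 11"
      using il(1,2,3) by presburger
    then consider "l = 0" "i = 5" | "l = 0" "i = 4" | "l = 2" "i = 3" | "l = 3" | "3 * i + 2 * l \<le> 11"
      by blast
    then show "has_small 11"
    proof cases
      case 1
      then show ?thesis using l0 has_small_of_moved has_small_mono[of 8 11] by auto
    next
      case 2
      then show ?thesis using l0 twelve by auto
    next
      case 3
      then show ?thesis using l2 has_small_mono[of _ 11] by auto
    next
      case 4
      then show ?thesis using l3 has_small_mono[of 6 11] by auto
    next
      case 5
      then show ?thesis using il(4) has_small_mono by blast
    qed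
  qed (use assms in auto)
  then have "has_small 9" by (rule has_small_step_to) (simp_all add: assms)
  then have "has_small 6" by (rule has_small_step_to) (simp_all add: assms)
  then show ?thesis by (rule has_small_step_to) (simp_all add: assms)
qed

text \<open>The first aim is 7, since a plain step turns 8 into 9 but 7 into 6. Involutions with 8
  moved points, from three isolated or four linked points, are treated once more by
  \<open>eight\<close>. The value 6 reproduces itself for 21 points, so this descent ends
  there.\<close>

lemma descent_7:
  assumes "card \<Omega> = 21" "x \<in> P" "\<And>p. x (x p) = p" "card (moved x) = 10"
  shows "has_small 6"
proof -
  have eight: "has_small 7" if u: "u \<in> P" "\<And>p. u (u p) = p" "card (moved u) = 8" for u
  proof (rule involution_outcomes[of u 4 3])
    fix i l :: nat
    assume il: "0 < i + l" "i + l \<le> 3" "l \<noteq> 1" "has_small (3 * i + 2 * l)"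
      and l0: "l = 0 \<Longrightarrow> \<exists>u\<in>P. (\<forall>p. u (u p) = p) \<and> card (moved u) = 4 * (4 - i)"
    show "has_small 7"
    proof (cases "l = 0 \<and> i = 3")
      case True
      then show ?thesis using l0 has_small_of_moved has_small_mono[of 4 7] by auto
    next
      case False
      then have "3 * i + 2 * l \<le> 7" using il by presburger
      then show ?thesis using il(4) has_small_mono by blast
    qed
  qed (use assms(1) u in auto)
  have "has_small 7"
  proof (rule involution_outcomes[of x 5 4])
    fix i l :: nat
    assume il: "0 < i + l" "i + l \<le> 4" "l \<noteq> 1" "has_small (3 * i + 2 * l)"
      and l0: "l = 0 \<Longrightarrow> \<exists>u\<in>P. (\<forall>p. u (u p) = p) \<and> card (moved u) = 4 * (5 - i)"
      and l2: "l = 2 \<Longrightarrow> has_small 4 \<or> has_small (3 * i)"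
      and l3: "l = 3 \<Longrightarrow> has_small 6"
      and l4: "l = 4 \<Longrightarrow> i = 0 \<Longrightarrow> has_small 7 \<or> (\<exists>u\<in>P. (\<forall>p. u (u p) = p) \<and> card (moved u) = 8)"
    have "(l = 0 \<and> i = 4) \<or> (l = 0 \<and> i = 3) \<or> (l = 2 \<and> i = 2) \<or> l = 3 \<or> (l = 4 \<and> i = 0) \<or> 3 * i + 2 * l \<le> 7"
      using il(1,2,3) by presburger
    then consider "l = 0" "i = 4" | "l = 0" "i = 3" | "l = 2" "i = 2" | "l = 3" | "l = 4" "i = 0" | "3 * i + 2 * l \<le> 7"
      by blast
    then show "has_small 7"
    proof cases
      case 1
      then show ?thesis using l0 has_small_of_moved has_small_mono[of 4 7] by auto
    next
      case 2
      then show ?thesis using l0 eight by auto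
    next
      case 3
      then show ?thesis using l2 has_small_mono[of _ 7] by auto
    next
      case 4
      then show ?thesis using l3 has_small_mono[of 6 7] by auto
    next
      case 5
      then show ?thesis using l4 eight by auto
    next
      case 6
      then show ?thesis using il(4) has_small_mono by blast
    qed
  qed (use assms in auto)
  then show ?thesis by (rule has_small_step_to) (simp_all add: assms)
qed

text \<open>A plain step strictly decreases k as long as k is at least 4, so strong induction on k
  applies.\<close>

lemma descent_large:
  assumes "card \<Omega> = n choose 2" "12 \<le> n" "has_small k" "k \<le> 2 * (n - 2)"
  shows "has_small 3"
  using assms(3,4)
proof (induction k rule: less_induct)
  case (less k)
  show ?case
  proof (cases "k \<le> 3")
    case True
    then show ?thesis using less has_small_mono by blast
  next
    case False
    define q where "q = (k - 1) * (k - 2) div (card \<Omega> - 2)"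
    \<comment> \<open>Measured from the least values 12 of n and 4 of k, the required inequality 3
      (k - 1)(k - 2) < (k - 3)(m - 2), with m the number of edges, becomes one between polynomials
      in non-negative a and b.\<close>
    define a b where "a = int n - 12" and "b = int k - 4"
    have ab: "0 \<le> a" "0 \<le> b" "b \<le> 2 * a + 16" "int n = a + 12" "int k = b + 4"
      using assms(2) less.prems False by (auto simp: a_def b_def)
    have m: "2 * int (card \<Omega>) = int n * (int n - 1)"
    proof -
      have "even (n * (n - 1))" using assms(2) by (cases n) auto
      then have "2 * card \<Omega> = n * (n - 1)" unfolding assms(1) choose_two by simp
      then have "int (2 * card \<Omega>) = int (n * (n - 1))" by (rule arg_cong)
      then show ?thesis using assms(2) by (simp add: of_nat_diff)
    qed
    have "b * b \<le> b * (2 * a + 16)" using ab by (intro mult_left_mono) auto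
    then have 1: "b * b \<le> 2 * (a * b) + 16 * b" by (simp add: algebra_simps)
    \<comment> \<open>The factor 12 a + 126 is 6 (2 a + 16) + 30: by the estimate of b * b, the sum
      6 b * b + 30 b is at most b times this factor.\<close>
    have "b * (12 * a + 126) \<le> b * (a * a + 23 * a + 128)"
      using ab by (intro mult_left_mono) auto
    then have 2: "12 * (a * b) + 126 * b \<le> a * a * b + 23 * (a * b) + 128 * b"
      by (simp add: algebra_simps)
    have "6 * (b * b) + 30 * b + 36 < a * a * b + 23 * (a * b) + 128 * b + a * a + 23 * a + 128"
      using 1 2 ab(1) zero_le_square[of a] by linarith
    also have "\<dots> = (b + 1) * (a * a + 23 * a + 128)"
      by (simp add: algebra_simps)
    finally have "6 * (b * b) + 30 * b + 36 < (b + 1) * (a * a + 23 * a + 128)" .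
    then have key: "6 * ((int k - 1) * (int k - 2)) < (int k - 3) * (2 * (int (card \<Omega>) - 2))"
      unfolding right_diff_distrib m ab(4,5) by (simp add: algebra_simps)
    have "3 * Suc q < k"
    proof (rule ccontr)
      assume "\<not> 3 * Suc q < k"
      then have "int k - 3 \<le> 3 * int q" by simp
      then have "(int k - 3) * (2 * (int (card \<Omega>) - 2)) \<le> 3 * int q * (2 * (int (card \<Omega>) - 2))"
        using card_ge_3 by (intro mult_right_mono) auto
      also have "\<dots> = 6 * int (q * (card \<Omega> - 2))"
        using card_ge_3 by (simp add: of_nat_diff)
      also have "\<dots> \<le> 6 * int ((k - 1) * (k - 2))"
        unfolding q_def using div_times_less_eq_dividend by (simp only: mult_le_cancel_left_pos zero_less_numeral of_nat_le_iff)
      also have "\<dots> = 6 * ((int k - 1) * (int k - 2))"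
        using False by (simp add: of_nat_diff)
      finally show False using key by simp
    qed
    moreover have "k < card \<Omega>"
    proof -
      have "4 * int n - 8 < int n * (int n - 1)"
        using ab(1) unfolding ab(4) by (simp add: algebra_simps) (smt (verit) zero_le_square)
      then have "int (2 * k) < int (2 * card \<Omega>)" using m less.prems(2) assms(2) by simp
      then show ?thesis by linarith
    qed
    then have "has_small (3 * Suc q)" unfolding q_def by (rule has_small_step[OF less.prems(1)])
    ultimately show ?thesis using less.IH[of "3 * Suc q"] less.prems by auto
  qed
qed

end


section \<open>The symmetric group acting on pairs\<close>

text \<open>Cut down to the identity off the edges, as \<open>permutes\<close> requires; the bare
  image map also moves sets that are not edges.\<close>

definition induced :: "nat \<Rightarrow> (nat \<Rightarrow> nat) \<Rightarrow> nat set \<Rightarrow> nat set" where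
  "induced n \<sigma> = restrict_id ((`) \<sigma>) (pairs n)"

lemma induced_apply: "a \<in> pairs n \<Longrightarrow> induced n \<sigma> a = \<sigma> ` a"
  by (simp add: induced_def)

lemma pair_mem_iff: "{i, j} \<in> pairs n \<longleftrightarrow> i \<noteq> j \<and> i \<in> {1..n} \<and> j \<in> {1..n}"
  by (auto simp: pairs_eq card_insert_if)

lemma pairs_cases:
  assumes "x \<in> pairs n"
  obtains i j where "x = {i, j}" "i \<noteq> j" "i \<in> {1..n}" "j \<in> {1..n}"
proof -
  have "card x = 2" "x \<subseteq> {1..n}" using assms by (auto simp: pairs_eq)
  then obtain i j where "x = {i, j}" "i \<noteq> j" by (meson card_2_iff)
  then show thesis using that \<open>x \<subseteq> {1..n}\<close> by blast
qed

lemma induced_permutes: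
  assumes "\<sigma> permutes {1..n}"
  shows "induced n \<sigma> permutes pairs n"
  unfolding induced_def
proof (rule permutes_restrict_id, rule bij_betw_imageI)
  show "inj_on ((`) \<sigma>) (pairs n)"
    using permutes_inj[OF assms] by (auto intro!: inj_onI simp: inj_image_eq_iff)
  have "card ((`) \<sigma> ` pairs n) = card (pairs n)"
    by (rule card_image) fact
  moreover have "(`) \<sigma> ` pairs n \<subseteq> pairs n"
    using permutes_inj[OF assms] permutes_in_image[OF assms]
    by (auto simp: pairs_eq card_image inj_on_subset)
  ultimately show "(`) \<sigma> ` pairs n = pairs n"
    using card_pairs[of n] by (intro card_subset_eq) auto
qed

lemma ex_permutation_map:
  assumes "distinct xs" "distinct ys" "length xs = length ys" "set xs \<subseteq> V" "set ys \<subseteq> V" "finite V"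
  shows "\<exists>\<sigma>. \<sigma> permutes V \<and> map \<sigma> xs = ys"
proof -
  define f where "f = (\<lambda>x. the (map_of (zip xs ys) x))"
  have map_f: "map f xs = ys"
  proof (rule nth_equalityI)
    fix i assume "i < length (map f xs)"
    then show "map f xs ! i = ys ! i"
      using assms(1,3) by (simp add: f_def map_of_zip_nth)
  qed (use assms(3) in simp)
  have fi: "inj_on f (set xs)"
    using assms(2) map_f by (metis distinct_map)
  have fs: "f ` set xs = set ys" using map_f by (metis set_map)
  have "card (V - set xs) = card (V - set ys)"
    using assms by (simp add: card_Diff_subset distinct_card)
  then obtain g where g: "bij_betw g (V - set xs) (V - set ys)"
    using assms(6) finite_same_card_bij by (metis finite_Diff)
  define h where "h = (\<lambda>x. if x \<in> set xs then f x else g x)"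
  have "bij_betw h (set xs) (set ys)"
    using fi fs unfolding bij_betw_def h_def by (auto simp: inj_on_def)
  moreover have "bij_betw h (V - set xs) (V - set ys)"
    using g by (rule iffD1[OF bij_betw_cong, rotated]) (auto simp: h_def)
  ultimately have "bij_betw h (set xs \<union> (V - set xs)) (set ys \<union> (V - set ys))"
    by (rule bij_betw_combine) auto
  moreover have "set xs \<union> (V - set xs) = V" "set ys \<union> (V - set ys) = V" using assms(4,5) by auto
  ultimately have "restrict_id h V permutes V" by (simp add: permutes_restrict_id)
  moreover have "map (restrict_id h V) xs = ys"
  proof -
    have "map (restrict_id h V) xs = map f xs"
      using assms(4) by (intro map_cong) (auto simp: h_def)
    then show ?thesis using map_f by simp
  qed
  ultimately show ?thesis by blast
qed

section \<open>Automorphisms of the triangular graph\<close>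

text \<open>Pairwise intersecting edges form a star or a triangle, and four of them are too many for
  a triangle.\<close>

lemma intersecting_pairs_common:
  assumes F: "F \<subseteq> pairs n" "\<And>a b. a \<in> F \<Longrightarrow> b \<in> F \<Longrightarrow> a \<inter> b \<noteq> {}" and card: "card F \<ge> 4"
  shows "\<exists>c. \<forall>a\<in>F. c \<in> a"
proof -
  have other: "\<exists>d\<in>F. d \<notin> A" if "finite A" "card A \<le> 3" for A
    using card_mono[OF that(1), of F] card that(2) by fastforce
  have two: "card a = 2" if "a \<in> F" for a using that F(1) by (auto simp: pairs_eq)
  obtain a where a: "a \<in> F" using other[of "{}"] by auto
  obtain b where b: "b \<in> F" "b \<noteq> a" using other[of "{a}"] by auto
  obtain p where p: "p \<in> a" "p \<in> b" using F(2)[OF a b(1)] by auto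
  obtain q where q: "a = {p, q}" "p \<noteq> q"
    using two[OF a] p(1) by (auto simp: card_2_iff)
  obtain r where r: "b = {p, r}" "p \<noteq> r"
    using two[OF b(1)] p(2) by (auto simp: card_2_iff)
  have qr: "q \<noteq> r" using q r b by auto
  have qr_only: "d = {q, r}" if "d \<in> F" "p \<notin> d" for d
  proof -
    have "q \<in> d" "r \<in> d" using F(2)[OF that(1) a] F(2)[OF that(1) b(1)] that(2) q r by auto
    then show ?thesis using two[OF that(1)] qr by (auto simp: card_2_iff)
  qed
  show ?thesis
  proof (rule exI[of _ p], rule ccontr)
    assume "\<not> (\<forall>a\<in>F. p \<in> a)"
    then have c: "{q, r} \<in> F" using qr_only by blast
    obtain d where d: "d \<in> F" "d \<notin> {a, b, {q, r}}"
      using other[of "{a, b, {q, r}}"] card_length[of "[a, b, {q, r}]"] by auto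
    then have "p \<in> d" using qr_only by blast
    moreover have "q \<in> d \<or> r \<in> d" using F(2)[OF d(1) c] by auto
    ultimately have "d = a \<or> d = b"
      using two[OF d(1)] q r by (auto simp: card_2_iff)
    then show False using d by simp
  qed
qed

lemma card_star:
  assumes "i \<in> {1..n}"
  shows "card {a \<in> pairs n. i \<in> a} = n - 1"
proof -
  have "{a \<in> pairs n. i \<in> a} = (\<lambda>j. {i, j}) ` ({1..n} - {i})"
    using assms by (auto simp: pair_mem_iff elim!: pairs_cases)
  moreover have "inj_on (\<lambda>j. {i, j}) ({1..n} - {i})"
    by (auto simp: inj_on_def doubleton_eq_iff)
  ultimately show ?thesis using assms by (simp add: card_image)
qed

text \<open>For n >= 5 a star has at least four edges, so \<pi> maps it into a star; the centres of
  the image stars define \<sigma>.\<close>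

lemma adjacency_preserving_induced:
  assumes \<pi>: "\<pi> permutes pairs n" and n: "n \<ge> 5"
    and adj: "\<And>a b. a \<in> pairs n \<Longrightarrow> b \<in> pairs n \<Longrightarrow> a \<inter> b \<noteq> {} \<Longrightarrow> \<pi> a \<inter> \<pi> b \<noteq> {}"
  shows "\<exists>\<sigma>. \<sigma> permutes {1..n} \<and> \<pi> = induced n \<sigma>"
proof -
  define S where "S = (\<lambda>i. {a \<in> pairs n. i \<in> a})"
  have fin: "finite (pairs n)" using card_pairs by auto
  have inj: "inj \<pi>" using \<pi> by (rule permutes_inj)
  have "\<exists>c. \<forall>a\<in>pairs n. i \<in> a \<longrightarrow> c \<in> \<pi> a" if i: "i \<in> {1..n}" for i
  proof -
    have "\<exists>c. \<forall>a\<in>\<pi> ` S i. c \<in> a"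
    proof (rule intersecting_pairs_common)
      show "\<pi> ` S i \<subseteq> pairs n" using permutes_in_image[OF \<pi>] by (auto simp: S_def)
      show "a \<inter> b \<noteq> {}" if "a \<in> \<pi> ` S i" "b \<in> \<pi> ` S i" for a b
        using that adj by (auto simp: S_def)
      have "card (\<pi> ` S i) = n - 1"
        using card_star[OF i] inj_on_subset[OF inj] by (simp add: S_def card_image)
      then show "4 \<le> card (\<pi> ` S i)" using n by simp
    qed
    then show ?thesis by (auto simp: S_def)
  qed
  then obtain \<sigma>0 where \<sigma>0: "\<And>i a. i \<in> {1..n} \<Longrightarrow> a \<in> pairs n \<Longrightarrow> i \<in> a \<Longrightarrow> \<sigma>0 i \<in> \<pi> a"
    by metis
  have range: "\<sigma>0 i \<in> {1..n}" if i: "i \<in> {1..n}" for i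
  proof -
    have "card (S i) \<noteq> 0" using card_star[OF i] n by (simp add: S_def)
    then obtain a where a: "a \<in> S i" by fastforce
    then have "\<sigma>0 i \<in> \<pi> a" "\<pi> a \<in> pairs n"
      using \<sigma>0[OF i] permutes_in_image[OF \<pi>] by (auto simp: S_def)
    then show ?thesis by (auto simp: pairs_eq)
  qed
  have "inj_on \<sigma>0 {1..n}"
  proof (rule inj_onI, rule ccontr)
    fix i j assume ij: "i \<in> {1..n}" "j \<in> {1..n}" "\<sigma>0 i = \<sigma>0 j" "i \<noteq> j"
    \<comment> \<open>Two stars with the same image centre would put at least 2 (n - 1) - 1 edges
      into a star with n - 1.\<close>
    have "\<pi> ` (S i \<union> S j) \<subseteq> S (\<sigma>0 i)"
      using \<sigma>0[OF ij(1)] \<sigma>0[OF ij(2)] ij(3) permutes_in_image[OF \<pi>] by (auto simp: S_def)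
    then have "card (\<pi> ` (S i \<union> S j)) \<le> card (S (\<sigma>0 i))"
      using fin by (intro card_mono) (auto simp: S_def)
    then have "card (S i \<union> S j) \<le> n - 1"
      using card_star[OF range[OF ij(1)]] inj_on_subset[OF inj] by (simp add: S_def card_image)
    moreover have "card (S i \<union> S j) + card (S i \<inter> S j) = 2 * (n - 1)"
      using card_Un_Int[of "S i" "S j"] fin card_star[OF ij(1)] card_star[OF ij(2)] by (simp add: S_def)
    moreover have "card (S i \<inter> S j) \<le> card {{i, j}}"
      using ij(4) by (intro card_mono) (auto simp: S_def elim!: pairs_cases)
    ultimately show False using n by simp
  qed
  moreover have "\<sigma>0 ` {1..n} \<subseteq> {1..n}" using range by auto
  ultimately have "bij_betw \<sigma>0 {1..n} {1..n}"
    by (simp add: bij_betw_def endo_inj_surj)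
  then have perm: "restrict_id \<sigma>0 {1..n} permutes {1..n}" by (rule permutes_restrict_id)
  moreover have "\<pi> = induced n (restrict_id \<sigma>0 {1..n})"
  proof
    fix a
    show "\<pi> a = induced n (restrict_id \<sigma>0 {1..n}) a"
    proof (cases "a \<in> pairs n")
      case True
      then obtain i j where ij: "a = {i, j}" "i \<noteq> j" "i \<in> {1..n}" "j \<in> {1..n}" by (rule pairs_cases)
      have "{\<sigma>0 i, \<sigma>0 j} \<subseteq> \<pi> a" using \<sigma>0 ij True by auto
      moreover have "card (\<pi> a) = 2"
        using True permutes_in_image[OF \<pi>, of a] by (simp add: pairs_eq)
      moreover from this have "finite (\<pi> a)" by (metis card.infinite zero_neq_numeral)
      moreover have "\<sigma>0 i \<noteq> \<sigma>0 j"
        using inj_onD[OF \<open>inj_on \<sigma>0 {1..n}\<close> _ ij(3,4)] ij(2) by blast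
      then have "card {\<sigma>0 i, \<sigma>0 j} = 2" by simp
      ultimately have "\<pi> a = {\<sigma>0 i, \<sigma>0 j}"
        using card_subset_eq[of "\<pi> a" "{\<sigma>0 i, \<sigma>0 j}"] by simp
      then show ?thesis using True ij by (simp add: induced_apply)
    next
      case False
      then show ?thesis using permutes_not_in[OF \<pi>] by (simp add: induced_def)
    qed
  qed
  ultimately show ?thesis by blast
qed

section \<open>Double transitivity of proper overgroups\<close>

locale overgroup = perm_group "pairs n" P for n :: nat and P +
  assumes n_ge_7: "7 \<le> n" and n_ne_8: "n \<noteq> 8"
    and induced_mem: "\<sigma> permutes {1..n} \<Longrightarrow> induced n \<sigma> \<in> P"
    and proper: "\<exists>\<pi>\<in>P. \<forall>\<sigma>. \<sigma> permutes {1..n} \<longrightarrow> \<pi> \<noteq> induced n \<sigma>"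
begin

definition verts :: "nat list \<Rightarrow> bool" where
  "verts xs \<longleftrightarrow> distinct xs \<and> set xs \<subseteq> {1..n}"

lemma ex_induced:
  assumes "verts xs" "verts ys" "length xs = length ys"
  shows "\<exists>\<pi>\<in>P. \<exists>\<sigma>. map \<sigma> xs = ys \<and> (\<forall>a\<in>pairs n. \<pi> a = \<sigma> ` a)"
  using ex_permutation_map[of xs ys "{1..n}"] assms induced_mem induced_apply
  by (auto simp: verts_def) metis

lemma adjacent_cases:
  assumes "x \<in> pairs n" "y \<in> pairs n" "x \<noteq> y"
  obtains a b c where "verts [a, b, c]" "x = {a, b}" "y = {a, c}"
    | a b c d where "verts [a, b, c, d]" "x = {a, b}" "y = {c, d}"
proof -
  from assms obtain i j k l where *: "x = {i, j}" "i \<noteq> j" "i \<in> {1..n}" "j \<in> {1..n}"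
    "y = {k, l}" "k \<noteq> l" "k \<in> {1..n}" "l \<in> {1..n}"
    by (elim pairs_cases) auto
  consider "i = k" "j \<noteq> l" | "i = l" "j \<noteq> k" | "j = k" "i \<noteq> l" | "j = l" "i \<noteq> k" | "distinct [i, j, k, l]"
    using * assms(3) by (auto simp: doubleton_eq_iff)
  then show thesis
  proof cases
    case 1 then show ?thesis using that(1)[of i j l] * by (auto simp: verts_def)
  next
    case 2 then show ?thesis using that(1)[of i j k] * by (auto simp: verts_def)
  next
    case 3 then show ?thesis using that(1)[of j i l] * by (auto simp: verts_def)
  next
    case 4 then show ?thesis using that(1)[of j i k] * by (auto simp: verts_def)
  next
    case 5 then show ?thesis using that(2)[of i j k l] * by (auto simp: verts_def)
  qed
qed

lemma ex_verts: "\<exists>a b c d e f. verts [a, b, c, d, e, f]"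
proof -
  have "verts [1, 2, 3, 4, 5, 6]" using n_ge_7 by (simp add: verts_def)
  then show ?thesis by blast
qed

lemma pair_mem: "verts xs \<Longrightarrow> i \<in> set xs \<Longrightarrow> j \<in> set xs \<Longrightarrow> i \<noteq> j \<Longrightarrow> {i, j} \<in> pairs n"
  unfolding pair_mem_iff verts_def by auto

lemma two_transitive_base:
  assumes v: "verts [a, b, c]" and x: "x \<in> pairs n" "y \<in> pairs n" "x \<noteq> y"
  shows "\<exists>\<pi>\<in>P. \<pi> {a, b} = x \<and> \<pi> {a, c} = y"
proof -
  have adj: "\<exists>\<pi>\<in>P. \<pi> {a, b} = {a', b'} \<and> \<pi> {a, c} = {a', c'}" if v': "verts [a', b', c']" for a' b' c'
  proof -
    obtain \<pi> \<sigma> where "\<pi> \<in> P" "map \<sigma> [a, b, c] = [a', b', c']" "\<forall>a\<in>pairs n. \<pi> a = \<sigma> ` a"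
      using ex_induced[OF v v'] by auto
    then show ?thesis using v pair_mem[OF v] by (intro bexI[of _ \<pi>]) (auto simp: verts_def)
  qed
  from x show ?thesis
  proof (cases rule: adjacent_cases)
    case (1 a' b' c')
    then show ?thesis using adj by blast
  next
    case (2 a' b' c' d')
    \<comment> \<open>A non-induced element joins the two orbits of the vertex permutations on
      ordered pairs of distinct edges, the adjacent and the disjoint ones.\<close>
    obtain \<pi>0 where \<pi>0: "\<pi>0 \<in> P" "\<forall>\<sigma>. \<sigma> permutes {1..n} \<longrightarrow> \<pi>0 \<noteq> induced n \<sigma>"
      using proper by blast
    then obtain u w where uw: "u \<in> pairs n" "w \<in> pairs n" "u \<inter> w \<noteq> {}" "\<pi>0 u \<inter> \<pi>0 w = {}"
      using adjacency_preserving_induced[OF permutes[OF \<pi>0(1)]] n_ge_7 by fastforce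
    have "u \<noteq> w"
    proof
      assume "u = w"
      then have "\<pi>0 u = {}" using uw(4) by simp
      moreover have "\<pi>0 u \<in> pairs n" using uw(1) \<pi>0(1) by simp
      ultimately show False by (simp add: pairs_eq)
    qed
    with uw(1,2) obtain a1 b1 c1 where 1: "verts [a1, b1, c1]" "u = {a1, b1}" "w = {a1, c1}"
      by (cases rule: adjacent_cases) (use uw(3) in \<open>auto simp: verts_def\<close>)
    obtain \<pi>1 where \<pi>1: "\<pi>1 \<in> P" "\<pi>1 {a, b} = u" "\<pi>1 {a, c} = w"
      using adj[OF 1(1)] 1(2,3) by auto
    have "\<pi>0 u \<in> pairs n" "\<pi>0 w \<in> pairs n" "\<pi>0 u \<noteq> \<pi>0 w"
      using uw \<open>u \<noteq> w\<close> \<pi>0(1) by auto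
    then obtain p q r s where pq: "verts [p, q, r, s]" "\<pi>0 u = {p, q}" "\<pi>0 w = {r, s}"
      by (cases rule: adjacent_cases) (use uw(4) in auto)
    obtain \<pi>2 \<sigma> where \<pi>2: "\<pi>2 \<in> P" "map \<sigma> [p, q, r, s] = [a', b', c', d']" "\<forall>a\<in>pairs n. \<pi>2 a = \<sigma> ` a"
      using ex_induced[OF pq(1) 2(1)] by auto
    have "\<pi>2 {p, q} = x" "\<pi>2 {r, s} = y"
      using \<pi>2 2 pair_mem[OF pq(1)] pq(1) by (auto simp: verts_def)
    then have "(\<pi>2 \<circ> \<pi>0 \<circ> \<pi>1) {a, b} = x \<and> (\<pi>2 \<circ> \<pi>0 \<circ> \<pi>1) {a, c} = y"
      using \<pi>1 pq by simp
    then show ?thesis using comp_mem[OF comp_mem[OF \<pi>2(1) \<pi>0(1)] \<pi>1(1)] by blast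
  qed
qed

lemma two_transitive:
  assumes "x \<in> pairs n" "y \<in> pairs n" "x \<noteq> y" "x' \<in> pairs n" "y' \<in> pairs n" "x' \<noteq> y'"
  shows "\<exists>\<pi>\<in>P. \<pi> x = x' \<and> \<pi> y = y'"
proof -
  obtain a b c d e f where v: "verts [a, b, c, d, e, f]" using ex_verts by blast
  then have v3: "verts [a, b, c]" by (auto simp: verts_def)
  obtain \<pi> \<pi>' where p: "\<pi> \<in> P" "\<pi> {a, b} = x" "\<pi> {a, c} = y" "\<pi>' \<in> P" "\<pi>' {a, b} = x'" "\<pi>' {a, c} = y'"
    using two_transitive_base[OF v3] assms by metis
  have "(\<pi>' \<circ> Hilbert_Choice.inv \<pi>) x = x' \<and> (\<pi>' \<circ> Hilbert_Choice.inv \<pi>) y = y'"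
    using p by (metis comp_apply inverse_simps(2))
  then show ?thesis using comp_mem[OF p(4) inv_mem[OF p(1)]] by blast
qed

end


section \<open>Overgroups are triply transitive\<close>

context overgroup
begin

text \<open>The orbit of the triangles under \<open>P\<close>, with the three edges in order so that
  images can be matched edge by edge; by \<open>block_swap\<close> the relation is
  symmetric.\<close>

definition block :: "nat set \<Rightarrow> nat set \<Rightarrow> nat set \<Rightarrow> bool" where
  "block x y z \<longleftrightarrow> (\<exists>\<pi>\<in>P. \<exists>a b c. verts [a, b, c] \<and> x = \<pi> {a, b} \<and> y = \<pi> {a, c} \<and> z = \<pi> {b, c})"

lemma block_swap: "block x y z \<longleftrightarrow> block y x z" "block x y z \<longleftrightarrow> block x z y"
proof -
  have 1: "block y x z" if xyz: "block x y z" for x y z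
  proof -
    obtain \<pi> a b c where "\<pi> \<in> P" "verts [a, b, c]" "x = \<pi> {a, b}" "y = \<pi> {a, c}" "z = \<pi> {b, c}"
      using xyz by (auto simp: block_def)
    then show ?thesis unfolding block_def
      by (intro bexI[of _ \<pi>] exI[of _ a] exI[of _ c] exI[of _ b]) (auto simp: insert_commute verts_def)
  qed
  have 2: "block x z y" if xyz: "block x y z" for x y z
  proof -
    obtain \<pi> a b c where "\<pi> \<in> P" "verts [a, b, c]" "x = \<pi> {a, b}" "y = \<pi> {a, c}" "z = \<pi> {b, c}"
      using xyz by (auto simp: block_def)
    then show ?thesis unfolding block_def
      by (intro bexI[of _ \<pi>] exI[of _ b] exI[of _ a] exI[of _ c]) (auto simp: insert_commute verts_def)
  qed
  show "block x y z \<longleftrightarrow> block y x z" "block x y z \<longleftrightarrow> block x z y" using 1 2 by blast+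
qed

lemma block_rotate: "block x y z \<longleftrightarrow> block y z x" "block x y z \<longleftrightarrow> block z x y"
  using block_swap by blast+

lemma block_triangle: "verts [a, b, c] \<Longrightarrow> block {a, b} {a, c} {b, c}"
  unfolding block_def using id_mem by (intro bexI[of _ id]) auto

lemma block_image:
  assumes "\<pi> \<in> P" "block x y z"
  shows "block (\<pi> x) (\<pi> y) (\<pi> z)"
proof -
  obtain \<rho> a b c where "\<rho> \<in> P" "verts [a, b, c]" "x = \<rho> {a, b}" "y = \<rho> {a, c}" "z = \<rho> {b, c}"
    using assms(2) by (auto simp: block_def)
  then show ?thesis unfolding block_def
    by (intro bexI[of _ "\<pi> \<circ> \<rho>"] exI[of _ a] exI[of _ b] exI[of _ c])
      (simp_all add: comp_mem assms(1))
qed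

lemma block_image_iff: "\<pi> \<in> P \<Longrightarrow> block (\<pi> x) (\<pi> y) (\<pi> z) \<longleftrightarrow> block x y z"
  using block_image[of \<pi> x y z] block_image[OF inv_mem, of \<pi> "\<pi> x" "\<pi> y" "\<pi> z"]
  by (auto simp only: inverse_simps)

lemma block_pairs:
  assumes "block x y z"
  shows "x \<in> pairs n" "y \<in> pairs n" "z \<in> pairs n" "x \<noteq> y" "x \<noteq> z" "y \<noteq> z"
proof -
  obtain \<pi> a b c where *: "\<pi> \<in> P" "verts [a, b, c]" "x = \<pi> {a, b}" "y = \<pi> {a, c}" "z = \<pi> {b, c}"
    using assms by (auto simp: block_def)
  have "{a, b} \<in> pairs n" "{a, c} \<in> pairs n" "{b, c} \<in> pairs n"
    "{a, b} \<noteq> {a, c}" "{a, b} \<noteq> {b, c}" "{a, c} \<noteq> {b, c}"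
    using *(2) by (auto simp: pair_mem_iff verts_def doubleton_eq_iff)
  then show "x \<in> pairs n" "y \<in> pairs n" "z \<in> pairs n" "x \<noteq> y" "x \<noteq> z" "y \<noteq> z"
    using * by auto
qed

text \<open>Vertex permutations make the property depend on the isomorphism type of the three edges
  only. Naming edges by positions in a vertex list lets a single statement serve every type.\<close>

lemma block_transfer:
  assumes "block {xs ! i, xs ! j} {xs ! k, xs ! l} {xs ! p, xs ! q}"
    and "verts xs" "verts ys" "length xs = length ys"
    and "{i, j, k, l, p, q} \<subseteq> {..<length xs}" "i \<noteq> j" "k \<noteq> l" "p \<noteq> q"
  shows "block {ys ! i, ys ! j} {ys ! k, ys ! l} {ys ! p, ys ! q}"
proof -
  obtain \<pi> \<sigma> where \<pi>: "\<pi> \<in> P" "map \<sigma> xs = ys" "\<forall>a\<in>pairs n. \<pi> a = \<sigma> ` a"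
    using ex_induced[OF assms(2,3,4)] by blast
  have "\<pi> {xs ! u, xs ! v} = {ys ! u, ys ! v}" if "u \<noteq> v" "u < length xs" "v < length xs" for u v
  proof -
    have "{xs ! u, xs ! v} \<in> pairs n"
      using that assms(2) by (intro pair_mem[OF assms(2)]) (auto simp: verts_def nth_eq_iff_index_eq)
    then show ?thesis using \<pi> that by auto
  qed
  then show ?thesis using block_image[OF \<pi>(1) assms(1)] assms(5-) by simp
qed

section \<open>The design of triangle images\<close>

text \<open>Together with the triangle, this and the next three are all isomorphism types of three
  distinct edges, so four truth values describe the blocks.\<close>

definition star where "star \<longleftrightarrow> (\<exists>a b c d. verts [a, b, c, d] \<and> block {a, b} {a, c} {a, d})"
definition path where "path \<longleftrightarrow> (\<exists>a b c d. verts [a, b, c, d] \<and> block {a, b} {b, c} {c, d})"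
definition cherry where "cherry \<longleftrightarrow> (\<exists>a b c d e. verts [a, b, c, d, e] \<and> block {a, b} {b, c} {d, e})"
definition matching where
  "matching \<longleftrightarrow> (\<exists>a b c d e f. verts [a, b, c, d, e, f] \<and> block {a, b} {c, d} {e, f})"

lemma star_iff:
  assumes v: "verts [a, b, c, d]"
  shows "block {a, b} {a, c} {a, d} \<longleftrightarrow> star"
proof
  assume "block {a, b} {a, c} {a, d}"
  with v show star unfolding star_def by blast
next
  assume star
  then obtain a' b' c' d' where "verts [a', b', c', d']" "block {a', b'} {a', c'} {a', d'}"
    unfolding star_def by blast
  then show "block {a, b} {a, c} {a, d}"
    using block_transfer[OF _ _ v, of "[a', b', c', d']" 0 1 0 2 0 3] by simp
qed

lemma path_iff:
  assumes v: "verts [a, b, c, d]"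
  shows "block {a, b} {b, c} {c, d} \<longleftrightarrow> path"
proof
  assume "block {a, b} {b, c} {c, d}"
  with v show path unfolding path_def by blast
next
  assume path
  then obtain a' b' c' d' where "verts [a', b', c', d']" "block {a', b'} {b', c'} {c', d'}"
    unfolding path_def by blast
  then show "block {a, b} {b, c} {c, d}"
    using block_transfer[OF _ _ v, of "[a', b', c', d']" 0 1 1 2 2 3] by simp
qed

lemma cherry_iff:
  assumes v: "verts [a, b, c, d, e]"
  shows "block {a, b} {b, c} {d, e} \<longleftrightarrow> cherry"
proof
  assume "block {a, b} {b, c} {d, e}"
  with v show cherry unfolding cherry_def by blast
next
  assume cherry
  then obtain a' b' c' d' e' where "verts [a', b', c', d', e']" "block {a', b'} {b', c'} {d', e'}"
    unfolding cherry_def by blast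
  then show "block {a, b} {b, c} {d, e}"
    using block_transfer[OF _ _ v, of "[a', b', c', d', e']" 0 1 1 2 3 4] by simp
qed

lemma matching_iff:
  assumes v: "verts [a, b, c, d, e, f]"
  shows "block {a, b} {c, d} {e, f} \<longleftrightarrow> matching"
proof
  assume "block {a, b} {c, d} {e, f}"
  with v show matching unfolding matching_def by blast
next
  assume matching
  then obtain a' b' c' d' e' f' where "verts [a', b', c', d', e', f']" "block {a', b'} {c', d'} {e', f'}"
    unfolding matching_def by blast
  then show "block {a, b} {c, d} {e, f}"
    using block_transfer[OF _ _ v, of "[a', b', c', d', e', f']" 0 1 2 3 4 5] by simp
qed

lemma block_adjacent:
  assumes v: "verts [a, b, c]" and i: "i \<in> {1..n} - {a, b, c}"
  shows "block {a, b} {a, c} {a, i} \<longleftrightarrow> star"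
    "block {a, b} {a, c} {b, i} \<longleftrightarrow> path" "block {a, b} {a, c} {c, i} \<longleftrightarrow> path"
    "j \<in> {1..n} - {a, b, c} \<Longrightarrow> i \<noteq> j \<Longrightarrow> block {a, b} {a, c} {i, j} \<longleftrightarrow> cherry"
proof -
  show "block {a, b} {a, c} {a, i} \<longleftrightarrow> star"
    using v i by (intro star_iff) (auto simp: verts_def)
  have "verts [i, b, a, c]" "verts [i, c, a, b]" using v i by (auto simp: verts_def)
  then have "block {i, b} {b, a} {a, c} \<longleftrightarrow> path" "block {i, c} {c, a} {a, b} \<longleftrightarrow> path"
    by (simp_all only: path_iff)
  then show "block {a, b} {a, c} {b, i} \<longleftrightarrow> path" "block {a, b} {a, c} {c, i} \<longleftrightarrow> path"
    using block_swap block_rotate by (metis insert_commute)+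
  show "block {a, b} {a, c} {i, j} \<longleftrightarrow> cherry" if "j \<in> {1..n} - {a, b, c}" "i \<noteq> j"
  proof -
    have "block {b, a} {a, c} {i, j} \<longleftrightarrow> cherry"
      using v i that by (intro cherry_iff) (auto simp: verts_def)
    then show ?thesis by (simp add: insert_commute)
  qed
qed

lemma block_disjoint:
  assumes v: "verts [a, b, c, d]"
  shows "block {a, b} {c, d} {a, c} \<longleftrightarrow> path"
    "i \<in> {1..n} - {a, b, c, d} \<Longrightarrow> block {a, b} {c, d} {a, i} \<longleftrightarrow> cherry"
    "i \<in> {1..n} - {a, b, c, d} \<Longrightarrow> j \<in> {1..n} - {a, b, c, d} \<Longrightarrow> i \<noteq> j \<Longrightarrow>
      block {a, b} {c, d} {i, j} \<longleftrightarrow> matching"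
proof -
  have "block {b, a} {a, c} {c, d} \<longleftrightarrow> path"
    using v by (intro path_iff) (auto simp: verts_def)
  then show "block {a, b} {c, d} {a, c} \<longleftrightarrow> path"
    using block_swap by (metis insert_commute)
  show "block {a, b} {c, d} {a, i} \<longleftrightarrow> cherry" if "i \<in> {1..n} - {a, b, c, d}"
  proof -
    have "block {b, a} {a, i} {c, d} \<longleftrightarrow> cherry"
      using v that by (intro cherry_iff) (auto simp: verts_def)
    then show ?thesis using block_swap by (metis insert_commute)
  qed
  show "block {a, b} {c, d} {i, j} \<longleftrightarrow> matching"
    if "i \<in> {1..n} - {a, b, c, d}" "j \<in> {1..n} - {a, b, c, d}" "i \<noteq> j"
    using v that by (intro matching_iff) (auto simp: verts_def)
qed

lemma card_cone: "u \<notin> W \<Longrightarrow> card ((\<lambda>i. {u, i}) ` W) = card W"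
  by (intro card_image) (auto simp: inj_on_def doubleton_eq_iff)

lemma card_verts_Diff: "verts xs \<Longrightarrow> card ({1..n} - set xs) = n - length xs"
  by (simp add: verts_def card_Diff_subset distinct_card)

lemma disjoint_by_image:
  assumes "\<And>z. z \<in> X \<Longrightarrow> f z \<in> S" "\<And>z. z \<in> Y \<Longrightarrow> f z \<in> T" "S \<inter> T = {}"
  shows "X \<inter> Y = {}"
  using assms by blast

text \<open>The third edge is classified by its vertices in W: besides the closing edge bc, an edge
  from a to W makes a star, one from b or c makes a path, and one inside W makes a cherry.\<close>

lemma card_block_adjacent:
  assumes v: "verts [a, b, c]"
  shows "card {z. block {a, b} {a, c} z} =
    1 + (if star then n - 3 else 0) + (if path then 2 * (n - 3) else 0) +
      (if cherry then (n - 3) choose 2 else 0)"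
proof -
  define W where "W = {1..n} - {a, b, c}"
  have W: "finite W" "card W = n - 3" "a \<notin> W" "b \<notin> W" "c \<notin> W"
    using card_verts_Diff[OF v] by (auto simp: W_def)
  have ne: "a \<noteq> b" "a \<noteq> c" "b \<noteq> c" using v by (auto simp: verts_def)
  define A where "A = (if star then (\<lambda>i. {a, i}) ` W else {})"
  define B where "B = (if path then (\<lambda>i. {b, i}) ` W else {})"
  define C where "C = (if path then (\<lambda>i. {c, i}) ` W else {})"
  define E where "E = (if cherry then {z. z \<subseteq> W \<and> card z = 2} else {})"
  have "{z. block {a, b} {a, c} z} = {{b, c}} \<union> A \<union> B \<union> C \<union> E"
  proof (intro Set.set_eqI iffI)
    fix z assume "z \<in> {z. block {a, b} {a, c} z}"
    then have z: "block {a, b} {a, c} z" by simp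
    then obtain i j where ij: "z = {i, j}" "i \<noteq> j" "i \<in> {1..n}" "j \<in> {1..n}"
      using block_pairs pairs_cases by metis
    have part: "z \<in> {{b, c}} \<union> A \<union> B \<union> C \<union> E"
      if h: "z = {i, j}" "i \<noteq> j" "i \<in> {1..n}" "j \<in> {1..n}" "i \<in> W \<Longrightarrow> j \<in> W" for i j
    proof (cases "j \<in> W")
      case True
      then have jW: "j \<in> {1..n} - {a, b, c}" by (simp add: W_def)
      consider "i = a" | "i = b" | "i = c" | "i \<in> W" using h(3) unfolding W_def by blast
      then show ?thesis
      proof cases
        case 1
        then have star using z h(1) block_adjacent(1)[OF v jW] by simp
        then have "z \<in> A" using h(1) True 1 by (simp add: A_def)
        then show ?thesis by blast
      next
        case 2
        then have path using z h(1) block_adjacent(2)[OF v jW] by simp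
        then have "z \<in> B" using h(1) True 2 by (simp add: B_def)
        then show ?thesis by blast
      next
        case 3
        then have path using z h(1) block_adjacent(3)[OF v jW] by simp
        then have "z \<in> C" using h(1) True 3 by (simp add: C_def)
        then show ?thesis by blast
      next
        case 4
        then have "i \<in> {1..n} - {a, b, c}" by (simp add: W_def)
        then have cherry using z h(1) block_adjacent(4)[OF v _ jW h(2)] by simp
        then have "z \<in> E" using h(1,2) True 4 by (simp add: E_def)
        then show ?thesis by blast
      qed
    next
      case False
      then have "i \<in> {a, b, c}" "j \<in> {a, b, c}" using h by (auto simp: W_def)
      then have "z = {b, c}"
        using block_pairs(5,6)[OF z] h(1,2) by (auto simp: insert_commute)
      then show ?thesis by simp
    qed
    show "z \<in> {{b, c}} \<union> A \<union> B \<union> C \<union> E"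
    proof (cases "i \<in> W \<longrightarrow> j \<in> W")
      case True
      then show ?thesis using part[of i j] ij by blast
    next
      case False
      then show ?thesis using part[of j i] ij insert_commute[of i j "{}"] by simp
    qed
  next
    fix z assume "z \<in> {{b, c}} \<union> A \<union> B \<union> C \<union> E"
    then consider "z = {b, c}" | "z \<in> A" | "z \<in> B" | "z \<in> C" | "z \<in> E" by blast
    then have "block {a, b} {a, c} z"
    proof cases
      case 5
      then obtain i j where "cherry" "z = {i, j}" "i \<noteq> j" "i \<in> W" "j \<in> W"
        by (auto simp: E_def card_2_iff split: if_splits)
      then show ?thesis using block_adjacent(4)[OF v] by (auto simp: W_def)
    next
      case 1
      then show ?thesis using block_triangle[OF v] by simp
    next
      case 2
      then obtain i where "star" "z = {a, i}" "i \<in> W" by (auto simp: A_def split: if_splits)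
      then show ?thesis using block_adjacent(1)[OF v, of i] by (simp add: W_def)
    next
      case 3
      then obtain i where "path" "z = {b, i}" "i \<in> W" by (auto simp: B_def split: if_splits)
      then show ?thesis using block_adjacent(2)[OF v, of i] by (simp add: W_def)
    next
      case 4
      then obtain i where "path" "z = {c, i}" "i \<in> W" by (auto simp: C_def split: if_splits)
      then show ?thesis using block_adjacent(3)[OF v, of i] by (simp add: W_def)
    qed
    then show "z \<in> {z. block {a, b} {a, c} z}" by simp
  qed
  moreover have fin: "finite A" "finite B" "finite C" "finite E"
    using W(1) by (auto simp: A_def B_def C_def E_def)
  \<comment> \<open>The part of an edge outside W tells the five families apart.\<close>
  moreover define g where "g = (\<lambda>z. z - W)"
  have off: "g {b, c} = {b, c}" "z \<in> A \<Longrightarrow> g z = {a}" "z \<in> B \<Longrightarrow> g z = {b}" "z \<in> C \<Longrightarrow> g z = {c}"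
    "z \<in> E \<Longrightarrow> g z = {}" for z
    using W by (auto simp: g_def A_def B_def C_def E_def split: if_splits)
  moreover have "{{b, c}} \<inter> A = {}"
    by (rule disjoint_by_image[of _ g "{{b, c}}" _ "{{a}}"]) (use ne in \<open>auto simp: off\<close>)
  moreover have "({{b, c}} \<union> A) \<inter> B = {}"
    by (rule disjoint_by_image[of _ g "{{b, c}, {a}}" _ "{{b}}"]) (use ne in \<open>auto simp: off\<close>)
  moreover have "({{b, c}} \<union> A \<union> B) \<inter> C = {}"
    by (rule disjoint_by_image[of _ g "{{b, c}, {a}, {b}}" _ "{{c}}"]) (use ne in \<open>auto simp: off\<close>)
  moreover have "({{b, c}} \<union> A \<union> B \<union> C) \<inter> E = {}"
    by (rule disjoint_by_image[of _ g "{{b, c}, {a}, {b}, {c}}" _ "{{}}"]) (use ne in \<open>auto simp: off\<close>)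
  ultimately have "card {z. block {a, b} {a, c} z} = 1 + card A + card B + card C + card E"
    by (simp only: card_Un_disjoint finite_Un finite.intros) simp
  moreover have "card A = (if star then n - 3 else 0)" "card B = (if path then n - 3 else 0)"
    "card C = (if path then n - 3 else 0)" "card E = (if cherry then (n - 3) choose 2 else 0)"
    using W n_subsets[OF W(1), of 2] by (simp_all add: A_def B_def C_def E_def card_cone)
  ultimately show ?thesis by simp
qed

text \<open>Four edges join ab to cd and make paths; an edge from one of the four vertices to W
  makes a cherry, one inside W a matching.\<close>

lemma card_block_disjoint:
  assumes v: "verts [a, b, c, d]"
  shows "card {z. block {a, b} {c, d} z} =
    (if path then 4 else 0) + (if cherry then 4 * (n - 4) else 0) +
      (if matching then (n - 4) choose 2 else 0)"
proof -
  define W where "W = {1..n} - {a, b, c, d}"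
  have W: "finite W" "card W = n - 4" "a \<notin> W" "b \<notin> W" "c \<notin> W" "d \<notin> W"
    using card_verts_Diff[OF v] by (auto simp: W_def)
  have ne: "a \<noteq> b" "a \<noteq> c" "a \<noteq> d" "b \<noteq> c" "b \<noteq> d" "c \<noteq> d" using v by (auto simp: verts_def)
  have v': "verts [a, b, d, c]" "verts [b, a, c, d]" "verts [b, a, d, c]"
    "verts [c, d, a, b]" "verts [d, c, a, b]"
    using v by (auto simp: verts_def)
  have cross: "block {a, b} {c, d} {a, c} \<longleftrightarrow> path" "block {a, b} {c, d} {a, d} \<longleftrightarrow> path"
    "block {a, b} {c, d} {b, c} \<longleftrightarrow> path" "block {a, b} {c, d} {b, d} \<longleftrightarrow> path"
    using block_disjoint(1)[OF v] block_disjoint(1)[OF v'(1)] block_disjoint(1)[OF v'(2)] block_disjoint(1)[OF v'(3)]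
    by (simp_all add: insert_commute[of b a] insert_commute[of d c])
  have out: "block {a, b} {c, d} {a, i} \<longleftrightarrow> cherry" "block {a, b} {c, d} {b, i} \<longleftrightarrow> cherry"
    "block {a, b} {c, d} {c, i} \<longleftrightarrow> cherry" "block {a, b} {c, d} {d, i} \<longleftrightarrow> cherry" if "i \<in> W" for i
  proof -
    have i: "i \<in> {1..n} - {a, b, c, d}" "i \<in> {1..n} - {b, a, c, d}"
      "i \<in> {1..n} - {c, d, a, b}" "i \<in> {1..n} - {d, c, a, b}"
      using that by (auto simp: W_def)
    show "block {a, b} {c, d} {a, i} \<longleftrightarrow> cherry" by (rule block_disjoint(2)[OF v i(1)])
    show "block {a, b} {c, d} {b, i} \<longleftrightarrow> cherry"
      using block_disjoint(2)[OF v'(2) i(2)] by (simp add: insert_commute[of b a])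
    show "block {a, b} {c, d} {c, i} \<longleftrightarrow> cherry"
      using block_disjoint(2)[OF v'(4) i(3)] block_swap(1)[of "{a, b}" "{c, d}"] by simp
    show "block {a, b} {c, d} {d, i} \<longleftrightarrow> cherry"
      using block_disjoint(2)[OF v'(5) i(4)] block_swap(1)[of "{a, b}" "{c, d}"] by (simp add: insert_commute[of d c])
  qed
  have two: "block {a, b} {c, d} {i, j} \<longleftrightarrow> matching" if "i \<in> W" "j \<in> W" "i \<noteq> j" for i j
    using block_disjoint(3)[OF v] that by (simp add: W_def)
  define X where "X = (if path then {{a, c}, {a, d}, {b, c}, {b, d}} else {})"
  define Y where "Y = (\<lambda>u. if cherry then (\<lambda>i. {u, i}) ` W else {})"
  define E where "E = (if matching then {z. z \<subseteq> W \<and> card z = 2} else {})"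
  have "{z. block {a, b} {c, d} z} = X \<union> Y a \<union> Y b \<union> Y c \<union> Y d \<union> E"
  proof (intro Set.set_eqI iffI)
    fix z assume "z \<in> {z. block {a, b} {c, d} z}"
    then have z: "block {a, b} {c, d} z" by simp
    then obtain i j where ij: "z = {i, j}" "i \<noteq> j" "i \<in> {1..n}" "j \<in> {1..n}"
      using block_pairs pairs_cases by metis
    have part: "z \<in> X \<union> Y a \<union> Y b \<union> Y c \<union> Y d \<union> E"
      if h: "z = {i, j}" "i \<noteq> j" "i \<in> {1..n}" "j \<in> {1..n}" "i \<in> W \<Longrightarrow> j \<in> W" for i j
    proof (cases "j \<in> W")
      case True
      consider "i = a" | "i = b" | "i = c" | "i = d" | "i \<in> W" using h(3) unfolding W_def by blast
      then show ?thesis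
      proof cases
        case 5
        then have matching using two[OF 5 True h(2)] z h(1) by simp
        then have "z \<in> E" using h(1,2) True 5 by (simp add: E_def)
        then show ?thesis by blast
      next
        case 1
        then have "z \<in> Y a" using out(1)[OF True] z h(1) True by (simp add: Y_def)
        then show ?thesis by blast
      next
        case 2
        then have "z \<in> Y b" using out(2)[OF True] z h(1) True by (simp add: Y_def)
        then show ?thesis by blast
      next
        case 3
        then have "z \<in> Y c" using out(3)[OF True] z h(1) True by (simp add: Y_def)
        then show ?thesis by blast
      next
        case 4
        then have "z \<in> Y d" using out(4)[OF True] z h(1) True by (simp add: Y_def)
        then show ?thesis by blast
      qed
    next
      case False
      then have "i \<in> {a, b, c, d}" "j \<in> {a, b, c, d}" using h by (auto simp: W_def)
      then have "z \<in> {{a, c}, {a, d}, {b, c}, {b, d}}"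
        using block_pairs(5,6)[OF z] h(2) unfolding h(1) insert_iff empty_iff doubleton_eq_iff by blast
      then consider "z = {a, c}" | "z = {a, d}" | "z = {b, c}" | "z = {b, d}" by blast
      then have path "z \<in> {{a, c}, {a, d}, {b, c}, {b, d}}"
        using z cross by (cases; simp)+
      then have "z \<in> X" by (simp only: X_def if_True)
      then show ?thesis by blast
    qed
    show "z \<in> X \<union> Y a \<union> Y b \<union> Y c \<union> Y d \<union> E"
    proof (cases "i \<in> W \<longrightarrow> j \<in> W")
      case True
      then show ?thesis using part[of i j] ij by blast
    next
      case False
      then show ?thesis using part[of j i] ij insert_commute[of i j "{}"] by simp
    qed
  next
    fix z assume "z \<in> X \<union> Y a \<union> Y b \<union> Y c \<union> Y d \<union> E"
    then consider "z \<in> X" | "z \<in> Y a \<union> Y b \<union> Y c \<union> Y d" | "z \<in> E" by blast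
    then have "block {a, b} {c, d} z"
    proof cases
      case 1 then show ?thesis using cross by (auto simp: X_def split: if_splits)
    next
      case 2 then show ?thesis using out by (auto simp: Y_def split: if_splits)
    next
      case 3
      then obtain i j where "matching" "z = {i, j}" "i \<noteq> j" "i \<in> W" "j \<in> W"
        by (auto simp: E_def card_2_iff split: if_splits)
      then show ?thesis using two by auto
    qed
    then show "z \<in> {z. block {a, b} {c, d} z}" by simp
  qed
  moreover have fin: "finite X" "finite (Y u)" "finite E" for u
    using W(1) by (auto simp: X_def Y_def E_def)
  moreover define g where "g = (\<lambda>z. z - W)"
  have "card ({u, v} - W) = 2" if "u \<notin> W" "v \<notin> W" "u \<noteq> v" for u v
    using that by (simp add: insert_Diff_if)
  then have offX: "z \<in> X \<Longrightarrow> card (g z) = 2" for z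
    using W ne by (auto simp: g_def X_def simp del: insert_Diff_if split: if_splits)
  have off: "z \<in> E \<Longrightarrow> g z = {}" "z \<in> Y a \<Longrightarrow> g z = {a}"
    "z \<in> Y b \<Longrightarrow> g z = {b}" "z \<in> Y c \<Longrightarrow> g z = {c}" "z \<in> Y d \<Longrightarrow> g z = {d}" for z
    using W ne by (auto simp: g_def Y_def E_def split: if_splits)
  note off = this offX
  moreover have "X \<inter> Y a = {}"
    by (rule disjoint_by_image[of _ g "{u. card u = 2}" _ "{{a}}"]) (use ne in \<open>auto simp: off\<close>)
  moreover have "(X \<union> Y a) \<inter> Y b = {}"
    by (rule disjoint_by_image[of _ g "{u. card u = 2} \<union> {{a}}" _ "{{b}}"]) (use ne in \<open>auto simp: off\<close>)
  moreover have "(X \<union> Y a \<union> Y b) \<inter> Y c = {}"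
    by (rule disjoint_by_image[of _ g "{u. card u = 2} \<union> {{a}, {b}}" _ "{{c}}"]) (use ne in \<open>auto simp: off\<close>)
  moreover have "(X \<union> Y a \<union> Y b \<union> Y c) \<inter> Y d = {}"
    by (rule disjoint_by_image[of _ g "{u. card u = 2} \<union> {{a}, {b}, {c}}" _ "{{d}}"]) (use ne in \<open>auto simp: off\<close>)
  moreover have "(X \<union> Y a \<union> Y b \<union> Y c \<union> Y d) \<inter> E = {}"
    by (rule disjoint_by_image[of _ g "- {{}}" _ "{{}}"]) (use offX in \<open>fastforce simp: off\<close>)+
  ultimately have "card {z. block {a, b} {c, d} z}
      = card X + card (Y a) + card (Y b) + card (Y c) + card (Y d) + card E"
    by (simp only: card_Un_disjoint finite_Un)
  moreover have "card X = (if path then 4 else 0)"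
    using ne by (simp add: X_def doubleton_eq_iff)
  moreover have "card (Y a) = (if cherry then n - 4 else 0)" "card (Y b) = (if cherry then n - 4 else 0)"
    "card (Y c) = (if cherry then n - 4 else 0)" "card (Y d) = (if cherry then n - 4 else 0)"
    "card E = (if matching then (n - 4) choose 2 else 0)"
    using W n_subsets[OF W(1), of 2] by (simp_all add: Y_def E_def card_cone)
  ultimately show ?thesis by simp
qed

text \<open>
  Both sides count the blocks through a pair of edges, for a pair with a common vertex and for a
  disjoint pair.
\<close>

lemma design_equation:
  "1 + (if star then n - 3 else 0) + (if path then 2 * (n - 3) else 0) +
      (if cherry then (n - 3) choose 2 else 0) =
    (if path then 4 else 0) + (if cherry then 4 * (n - 4) else 0) +
      (if matching then (n - 4) choose 2 else 0)"
proof -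
  obtain a b c d e f where "verts [a, b, c, d, e, f]" using ex_verts by blast
  then have v: "verts [a, b, c]" "verts [a, b, c, d]" by (auto simp: verts_def)
  have p: "{a, b} \<in> pairs n" "{a, c} \<in> pairs n" "{c, d} \<in> pairs n" "{a, b} \<noteq> {a, c}" "{a, b} \<noteq> {c, d}"
    using v by (auto simp: pair_mem_iff verts_def doubleton_eq_iff)
  obtain \<pi> where \<pi>: "\<pi> \<in> P" "\<pi> {a, b} = {a, b}" "\<pi> {a, c} = {c, d}"
    using two_transitive[OF p(1,2,4,1,3,5)] by blast
  have "\<pi> ` {z. block {a, b} {a, c} z} = {z. block {a, b} {c, d} z}"
  proof (intro Set.set_eqI iffI)
    fix z assume "z \<in> \<pi> ` {z. block {a, b} {a, c} z}"
    then show "z \<in> {z. block {a, b} {c, d} z}" using block_image[OF \<pi>(1), of "{a, b}" "{a, c}"] \<pi> by auto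
  next
    fix z assume "z \<in> {z. block {a, b} {c, d} z}"
    then have "block (\<pi> {a, b}) (\<pi> {a, c}) (\<pi> (Hilbert_Choice.inv \<pi> z))" using \<pi> by simp
    then have "block {a, b} {a, c} (Hilbert_Choice.inv \<pi> z)" using block_image_iff[OF \<pi>(1)] by blast
    then show "z \<in> \<pi> ` {z. block {a, b} {a, c} z}"
      using \<pi>(1) by (intro image_eqI[of _ _ "Hilbert_Choice.inv \<pi> z"]) auto
  qed
  then have "card {z. block {a, b} {a, c} z} = card {z. block {a, b} {c, d} z}"
    using card_image[OF inj_on_subset[OF inj[OF \<pi>(1)]]] by (metis subset_UNIV)
  then show ?thesis using card_block_adjacent[OF v(1)] card_block_disjoint[OF v(2)] by simp
qed

text \<open>With n = k + 7, the values k = 0, 2, 3, 4, 5 are checked one by one, and k >= 6 needs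
  only that k * k >= 6 k. The value k = 1 has to be left out: there star and cherry alone satisfy
  the equation. Among the solutions obtained, cherry can fail only for k = 4.\<close>

lemma design_solutions: "star \<and> path \<and> (cherry \<or> matching)"
proof -
  define k where "k = n - 7"
  have k: "n - 3 = k + 4" "n - 4 = k + 3" and k1: "k \<noteq> 1"
    using n_ge_7 n_ne_8 by (auto simp: k_def)
  have two: "2 * (m choose 2) = m * (m - 1)" for m :: nat
  proof -
    have "even (m * (m - 1))" by (cases m) auto
    then show ?thesis by (simp add: choose_two)
  qed
  \<comment> \<open>Naming the square makes the equation linear; the relation of \<open>sq\<close>
    to \<open>k\<close> is tabulated below.\<close>
  define sq where "sq = k * k"
  have c: "2 * ((k + 4) choose 2) = sq + 7 * k + 12" "2 * ((k + 3) choose 2) = sq + 5 * k + 6"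
    unfolding two sq_def by (simp_all add: algebra_simps)
  have eq: "1 + (if star then k + 4 else 0) + (if path then 2 * (k + 4) else 0) +
      (if cherry then (k + 4) choose 2 else 0) =
    (if path then 4 else 0) + (if cherry then 4 * (k + 3) else 0) +
      (if matching then (k + 3) choose 2 else 0)"
    using design_equation unfolding k .
  have "k \<in> {0, 2, 3, 4, 5} \<or> 6 \<le> k" using k1 by auto
  then have "(k = 0 \<and> sq = 0) \<or> (k = 2 \<and> sq = 4) \<or> (k = 3 \<and> sq = 9) \<or> (k = 4 \<and> sq = 16) \<or>
      (k = 5 \<and> sq = 25) \<or> (6 \<le> k \<and> 6 * k \<le> sq)"
    by (auto simp: sq_def)
  then show ?thesis
    using eq c by (elim disjE conjE) (auto split: if_splits)
qed

text \<open>
  If \<open>cherry\<close> fails (the remaining solution for \<open>n = 11\<close>), the edges \<open>ab\<close> and \<open>bc\<close> of a triangle form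
  blocks with \<open>ac\<close> and the same third edges. This property of a block is invariant under \<open>P\<close>, but
  fails for three edges with a common vertex.
\<close>

lemma cherry: cherry
proof (rule ccontr)
  assume nc: "\<not> cherry"
  have sp: star path using design_solutions by auto
  obtain a b c d e f where v6: "verts [a, b, c, d, e, f]" using ex_verts by blast
  then have v: "verts [a, b, c]" "verts [b, a, c]" by (auto simp: verts_def)
  have "block {a, b} {a, c} {a, d}" using star_iff[of a b c d] sp(1) v6 by (auto simp: verts_def)
  \<comment> \<open>Since star holds, the star ab, ac, ad is the image of a triangle. The edge ce
    forms a path with ab and ac but shares no vertex with ab and ad.\<close>
  then obtain \<pi> a' b' c' where \<pi>: "\<pi> \<in> P" "verts [a', b', c']"
    "\<pi> {a', b'} = {a, b}" "\<pi> {a', c'} = {a, c}" "\<pi> {b', c'} = {a, d}"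
    by (auto simp: block_def)
  define z where "z = Hilbert_Choice.inv \<pi> {c, e}"
  have z: "\<pi> z = {c, e}" using \<pi>(1) by (simp add: z_def)
  have v': "verts [b', a', c']" using \<pi>(2) by (auto simp: verts_def)
  have "block {a, b} {a, c} {c, e}" using block_adjacent(3)[OF v(1), of e] sp v6 by (auto simp: verts_def)
  then have "block (\<pi> {a', b'}) (\<pi> {a', c'}) (\<pi> z)" by (simp only: z \<pi>)
  then have Rz: "block {a', b'} {a', c'} z" using block_image_iff[OF \<pi>(1)] by simp
  then obtain i j where ij: "z = {i, j}" "i \<noteq> j" "i \<in> {1..n}" "j \<in> {1..n}"
    using block_pairs pairs_cases by metis
  have "z \<noteq> {b', c'}" using \<pi>(5) z v6 by (auto simp: verts_def doubleton_eq_iff)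
  \<comment> \<open>An edge meeting the triangle in exactly one vertex makes a star or a path with
    any two of its sides, and hence a block.\<close>
  have part: "block {b', a'} {b', c'} z"
    if h: "z = {i, j}" "i \<noteq> j" "i \<in> {1..n}" "j \<in> {1..n}" "i \<in> {a', b', c'}" for i j
  proof -
    have "j \<in> {1..n} - {a', b', c'}"
    proof (rule ccontr)
      assume "j \<notin> {1..n} - {a', b', c'}"
      then have "j \<in> {a', b', c'}" using h(4) by simp
      then show False
        using block_pairs(5,6)[OF Rz] \<open>z \<noteq> {b', c'}\<close> h(1,2,5) by (auto simp: insert_commute)
    qed
    then have "j \<in> {1..n} - {b', a', c'}" by auto
    then show ?thesis using block_adjacent(1-3)[OF v'] h(1,5) sp by auto
  qed
  have "block {b', a'} {b', c'} z"
  proof (cases "i \<in> {a', b', c'} \<or> j \<in> {a', b', c'}")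
    case True
    then show ?thesis using part[of i j] part[of j i] ij by (auto simp: insert_commute)
  next
    case False
    then show ?thesis using block_adjacent(4)[OF \<pi>(2), of i j] Rz ij nc by auto
  qed
  then have "block (\<pi> {a', b'}) (\<pi> {b', c'}) (\<pi> z)"
    using block_image[OF \<pi>(1)] by (simp add: insert_commute)
  then have "block {b, a} {a, d} {c, e}" by (simp add: \<pi> z insert_commute)
  then show False using cherry_iff[of b a d c e] nc v6 by (auto simp: verts_def)
qed

lemma block_base:
  assumes v: "verts [a, b, c]" and z: "z \<in> pairs n" "z \<noteq> {a, b}" "z \<noteq> {a, c}"
  shows "block {a, b} {a, c} z"
proof -
  have sp: star path using design_solutions by auto
  obtain i j where ij: "z = {i, j}" "i \<noteq> j" "i \<in> {1..n}" "j \<in> {1..n}"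
    using z(1) by (rule pairs_cases)
  have part: ?thesis if h: "z = {i, j}" "i \<noteq> j" "i \<in> {1..n}" "j \<in> {1..n} - {a, b, c}" for i j
  proof -
    consider "i = a" | "i = b" | "i = c" | "i \<in> {1..n} - {a, b, c}" using h(3) by blast
    then show ?thesis
      using block_adjacent[OF v h(4)] block_adjacent(4)[OF v _ h(4) h(2)] sp cherry h(1)
      by cases auto
  qed
  consider "j \<in> {1..n} - {a, b, c}" | "i \<in> {1..n} - {a, b, c}" | "i \<in> {a, b, c}" "j \<in> {a, b, c}"
    using ij by blast
  then show ?thesis
  proof cases
    case 1 then show ?thesis using part[of i j] ij by blast
  next
    case 2 then show ?thesis using part[of j i] ij by (simp add: insert_commute)
  next
    case 3
    then have "z = {b, c}" using ij z by (auto simp: insert_commute)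
    then show ?thesis using block_triangle[OF v] by simp
  qed
qed

text \<open>Pulled back to two sides of a triangle, x and y form a block with every third edge by
  \<open>block_base\<close>. So x, y, z is the image of some labelled triangle, and vertex
  permutations act transitively on those.\<close>

lemma three_transitive_base:
  assumes v: "verts [a, b, c]" and "x \<in> pairs n" "y \<in> pairs n" "z \<in> pairs n" "x \<noteq> y" "x \<noteq> z" "y \<noteq> z"
  shows "\<exists>\<pi>\<in>P. \<pi> {a, b} = x \<and> \<pi> {a, c} = y \<and> \<pi> {b, c} = z"
proof -
  obtain \<pi> where \<pi>: "\<pi> \<in> P" "\<pi> {a, b} = x" "\<pi> {a, c} = y"
    using two_transitive_base[OF v assms(2,3,5)] by blast
  define z' where "z' = Hilbert_Choice.inv \<pi> z"
  have z': "\<pi> z' = z" "z' \<in> pairs n"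
    using \<pi>(1) assms(4) inv_mem[OF \<pi>(1)] by (auto simp: z'_def)
  have z'': "z' \<noteq> {a, b}" "z' \<noteq> {a, c}"
    using z'(1) \<pi>(2,3) assms(6,7) by metis+
  have "block x y z" using block_image[OF \<pi>(1) block_base[OF v z'(2) z'']] \<pi> z' by simp
  then obtain \<rho> a' b' c' where \<rho>: "\<rho> \<in> P" "verts [a', b', c']"
    "x = \<rho> {a', b'}" "y = \<rho> {a', c'}" "z = \<rho> {b', c'}"
    by (auto simp: block_def)
  obtain \<tau> \<sigma> where \<tau>: "\<tau> \<in> P" "map \<sigma> [a, b, c] = [a', b', c']" "\<forall>a\<in>pairs n. \<tau> a = \<sigma> ` a"
    using ex_induced[OF v \<rho>(2)] by auto
  have "\<tau> {a, b} = {a', b'}" "\<tau> {a, c} = {a', c'}" "\<tau> {b, c} = {b', c'}"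
    using \<tau> v by (auto simp: pair_mem_iff verts_def)
  then show ?thesis using comp_mem[OF \<rho>(1) \<tau>(1)] \<rho> by (intro bexI[of _ "\<rho> \<circ> \<tau>"]) auto
qed

end

sublocale overgroup \<subseteq> triply_transitive "pairs n" P
proof
  have "3 * 2 \<le> n * (n - 1)" using n_ge_7 by (intro mult_le_mono) auto
  then show "3 \<le> card (pairs n)" using card_pairs[of n] by (simp add: choose_two)
next
  fix x y z x' y' z'
  assume *: "x \<in> pairs n" "y \<in> pairs n" "z \<in> pairs n" "x \<noteq> y" "x \<noteq> z" "y \<noteq> z"
    "x' \<in> pairs n" "y' \<in> pairs n" "z' \<in> pairs n" "x' \<noteq> y'" "x' \<noteq> z'" "y' \<noteq> z'"
  obtain a b c d e f where "verts [a, b, c, d, e, f]" using ex_verts by blast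
  then have v: "verts [a, b, c]" by (auto simp: verts_def)
  obtain \<pi> \<rho> where "\<pi> \<in> P" "\<pi> {a, b} = x" "\<pi> {a, c} = y" "\<pi> {b, c} = z"
    and "\<rho> \<in> P" "\<rho> {a, b} = x'" "\<rho> {a, c} = y'" "\<rho> {b, c} = z'"
    using three_transitive_base[OF v] * by metis
  then show "\<exists>\<pi>\<in>P. \<pi> x = x' \<and> \<pi> y = y' \<and> \<pi> z = z'"
    using comp_mem[OF _ inv_mem, of \<rho> \<pi>] inverse_simps(2)[of \<pi>]
    by (intro bexI[of _ "\<rho> \<circ> Hilbert_Choice.inv \<pi>"]) auto
qed


section \<open>Overgroups contain the alternating group\<close>

fun pick :: "nat \<Rightarrow> 'a list \<Rightarrow> 'a list list" where
  "pick 0 xs = [[]]"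
| "pick (Suc k) [] = []"
| "pick (Suc k) (x # xs) = map ((#) x) (pick k xs) @ pick (Suc k) xs"

lemma pick_complete:
  assumes "F \<subseteq> set xs" "card F = k"
  shows "\<exists>ys\<in>set (pick k xs). set ys = F"
  using assms
proof (induction k xs arbitrary: F rule: pick.induct)
  case (1 xs)
  then have "F = {}" using finite_subset by fastforce
  then show ?case by simp
next
  case (2 k)
  then show ?case by simp
next
  case (3 k x xs)
  show ?case
  proof (cases "x \<in> F")
    case True
    then have "F - {x} \<subseteq> set xs" "card (F - {x}) = k" using 3(3,4) by auto
    then obtain ys where "ys \<in> set (pick k xs)" "set ys = F - {x}" using 3(1) by blast
    then show ?thesis using True by (intro bexI[of _ "x # ys"]) auto
  next
    case False
    then have "F \<subseteq> set xs" using 3(3) by auto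
    then show ?thesis using 3(2)[OF _ 3(4)] by auto
  qed
qed

text \<open>A form of \<open>permutation_of_list\<close> that evaluation can run, with the identity
  as default.\<close>

fun lookup_perm :: "(nat \<times> nat) list \<Rightarrow> nat \<Rightarrow> nat" where
  "lookup_perm [] x = x"
| "lookup_perm ((a, b) # ps) x = (if x = a then b else lookup_perm ps x)"

lemma lookup_perm_eq: "lookup_perm ps = permutation_of_list ps"
proof
  show "lookup_perm ps x = permutation_of_list ps x" for x
    by (induction ps) (auto simp: permutation_of_list_Cons permutation_of_list_def)
qed

text \<open>An edge is stored as an ordered pair and \<sigma> may reverse the order, hence both
  orientations. For a permutation \<sigma> and a repetition-free list the length counts the edges
  common to the graph and its image.\<close>

definition meets_once :: "(nat \<Rightarrow> nat) \<Rightarrow> (nat \<times> nat) list \<Rightarrow> bool" where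
  "meets_once \<sigma> xs \<longleftrightarrow>
    length (filter (\<lambda>(i, j). List.member xs (\<sigma> i, \<sigma> j) \<or> List.member xs (\<sigma> j, \<sigma> i)) xs) = Suc 0"

definition other_edges :: "(nat \<times> nat) list" where
  "other_edges = [(1,4), (1,5), (1,6), (1,7), (2,4), (2,5), (2,6), (2,7), (3,4), (3,5), (3,6), (3,7),
    (4,5), (4,6), (4,7), (5,6), (5,7), (6,7)]"

text \<open>
  Found by computer search: every graph on seven vertices with six edges that contains the triangle
  on 1, 2, 3 shares exactly one edge with its image under one of these permutations.
\<close>

definition six_perms :: "(nat \<times> nat) list list" where
  "six_perms = map (zip [1, 2, 3, 4, 5, 6, 7])
    [[1,4,5,6,7,2,3], [4,3,5,6,2,1,7], [4,7,2,5,1,6,3], [2,6,5,3,4,1,7], [3,5,7,4,6,1,2], [2,1,5,7,3,6,4]]"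

text \<open>There are 18 choose 3 = 816 ways to complete the triangle by three further
  edges.\<close>

lemma six_perms_suffice:
  "list_all (\<lambda>ys. list_ex (\<lambda>p. meets_once (lookup_perm p) ((1,2) # (1,3) # (2,3) # ys)) six_perms)
    (pick (Suc (Suc (Suc 0))) other_edges)"
  by code_simp

lemma six_perms_permute:
  assumes "p \<in> set six_perms"
  shows "lookup_perm p permutes {1..7}"
proof -
  have "list_all (\<lambda>p. map fst p = [1,2,3,4,5,6,7] \<and> set (map snd p) = {1,2,3,4,5,6,7} \<and> distinct (map snd p)) six_perms"
    by (auto simp: six_perms_def)
  moreover have "{1..7::nat} = {1,2,3,4,5,6,7}" by auto
  ultimately have "list_permutes p {1..7}"
    using assms by (auto simp: list_all_iff list_permutes_def)
  then show ?thesis by (simp add: lookup_perm_eq)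
qed

lemma other_edges_complete:
  "list_all (\<lambda>i. list_all (\<lambda>j. i < j \<longrightarrow> List.member ((1,2) # (1,3) # (2,3) # other_edges) (i, j)) [1..<8]) [1..<8]"
  by code_simp

lemma pairs_7: "pairs 7 \<subseteq> (\<lambda>(i, j). {i, j}) ` set ((1,2) # (1,3) # (2,3) # other_edges)"
proof
  fix z assume "z \<in> pairs 7"
  then obtain i j where ij: "z = {i, j}" "1 \<le> i" "i < j" "j \<le> 7" by (auto simp: pairs_def)
  then have "i \<in> set [1..<8]" "j \<in> set [1..<8]" by auto
  then have "(i, j) \<in> set ((1,2) # (1,3) # (2,3) # other_edges)"
    using other_edges_complete ij(3) unfolding list_all_iff List.member_iff by blast
  then show "z \<in> (\<lambda>(i, j). {i, j}) ` set ((1,2) # (1,3) # (2,3) # other_edges)"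
    by (rule rev_image_eqI) (simp add: ij(1))
qed

lemma meet_once_edge_set:
  assumes M: "M \<subseteq> pairs 7" "card M = 6" "{{1, 2}, {1, 3}, {2, 3}} \<subseteq> M"
  shows "\<exists>\<sigma>. \<sigma> permutes {1..7} \<and> card (M \<inter> (`) \<sigma> ` M) = 1"
proof -
  let ?e = "\<lambda>(i, j). {i, j :: nat}"
  define F where "F = {p \<in> set other_edges. ?e p \<in> M}"
  have inj: "inj_on ?e (set ((1,2) # (1,3) # (2,3) # other_edges))"
  proof (rule inj_onI, clarify)
    fix i j k l assume "(i, j) \<in> set ((1,2) # (1,3) # (2,3) # other_edges)"
      "(k, l) \<in> set ((1,2) # (1,3) # (2,3) # other_edges)" "{i, j} = {k, l}"
    moreover have "\<forall>(i, j)\<in>set ((1,2) # (1,3) # (2,3) # other_edges). i < j"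
      by (simp add: other_edges_def)
    ultimately have "i < j" "k < l" "{i, j} = {k, l}" by blast+
    then show "i = k \<and> j = l" by (auto simp: doubleton_eq_iff)
  qed
  let ?T = "{{1, 2}, {1, 3}, {2, 3}} :: nat set set"
  have nT: "?e p \<notin> ?T" if "p \<in> set other_edges" for p
    using that by (auto simp: other_edges_def doubleton_eq_iff)
  have MF: "M = ?T \<union> ?e ` F"
  proof
    show "?T \<union> ?e ` F \<subseteq> M" using M(3) unfolding F_def by blast
    show "M \<subseteq> ?T \<union> ?e ` F"
    proof
      fix z assume z: "z \<in> M"
      then obtain p where p: "p \<in> set ((1,2) # (1,3) # (2,3) # other_edges)" "z = ?e p"
        using M(1) pairs_7 by blast
      then consider "z \<in> ?T" | "p \<in> set other_edges" by (simp only: set_simps insert_iff) force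
      then show "z \<in> ?T \<union> ?e ` F"
      proof cases
        case 2
        then have "p \<in> F" using z p(2) by (simp add: F_def)
        then show ?thesis using p(2) by blast
      qed blast
    qed
  qed
  moreover have "?T \<inter> ?e ` F = {}" using nT by (auto simp: F_def)
  moreover have "card ?T = 3" by (simp add: doubleton_eq_iff)
  moreover have fF: "finite F" by (simp add: F_def)
  ultimately have "6 = 3 + card (?e ` F)"
    using M(2) card_Un_disjoint[of ?T "?e ` F"] by (simp only: finite.intros finite_imageI simp_thms)
  then have "card (?e ` F) = 3" by simp
  moreover have "card (?e ` F) = card F"
    by (rule card_image, rule inj_on_subset[OF inj]) (auto simp: F_def)
  ultimately have "card F = Suc (Suc (Suc 0))" by simp
  then obtain ys where ys: "ys \<in> set (pick (Suc (Suc (Suc 0))) other_edges)" "set ys = F"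
    using pick_complete[of F other_edges] by (auto simp: F_def)
  define xs where "xs = (1,2) # (1,3) # (2,3) # ys"
  obtain p where p: "p \<in> set six_perms" "meets_once (lookup_perm p) xs"
    using six_perms_suffice ys(1) unfolding list_all_iff list_ex_iff xs_def by blast
  define \<sigma> where "\<sigma> = lookup_perm p"
  have Mxs: "M = ?e ` set xs" unfolding MF xs_def by (simp add: ys(2))
  obtain k where k: "filter (\<lambda>(i, j). List.member xs (\<sigma> i, \<sigma> j) \<or> List.member xs (\<sigma> j, \<sigma> i)) xs = [k]"
    using p(2) by (auto simp: meets_once_def \<sigma>_def length_Suc_conv)
  define Q where "Q = {q \<in> set xs. (\<sigma> (fst q), \<sigma> (snd q)) \<in> set xs \<or> (\<sigma> (snd q), \<sigma> (fst q)) \<in> set xs}"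
  have set_k: "Q = {k}"
    using arg_cong[OF k, of set] by (simp add: Q_def case_prod_beta)
  have "M \<inter> (`) \<sigma> ` M = {\<sigma> ` ?e k}"
  proof (intro Set.set_eqI iffI)
    fix z assume z: "z \<in> M \<inter> (`) \<sigma> ` M"
    then obtain i j where ij: "(i, j) \<in> set xs" "z = {\<sigma> i, \<sigma> j}" by (auto simp: Mxs)
    obtain a b where ab: "(a, b) \<in> set xs" "z = {a, b}" using z by (auto simp: Mxs)
    have "(\<sigma> i, \<sigma> j) \<in> set xs \<or> (\<sigma> j, \<sigma> i) \<in> set xs"
      using ij(2) ab by (auto simp: doubleton_eq_iff)
    then have "(i, j) \<in> Q" using ij(1) by (simp add: Q_def)
    then have "(i, j) = k" by (simp add: set_k)
    then show "z \<in> {\<sigma> ` ?e k}" using ij(2) by auto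
  next
    fix z assume "z \<in> {\<sigma> ` ?e k}"
    moreover obtain i j where ij: "k = (i, j)" by (cases k)
    ultimately have z: "z = {\<sigma> i, \<sigma> j}" by simp
    have k': "(i, j) \<in> set xs" "(\<sigma> i, \<sigma> j) \<in> set xs \<or> (\<sigma> j, \<sigma> i) \<in> set xs"
    proof -
      have "(i, j) \<in> Q" by (simp add: set_k ij)
      then show "(i, j) \<in> set xs" "(\<sigma> i, \<sigma> j) \<in> set xs \<or> (\<sigma> j, \<sigma> i) \<in> set xs"
        by (simp_all add: Q_def)
    qed
    have "z \<in> M"
      using k'(2)
    proof
      assume "(\<sigma> i, \<sigma> j) \<in> set xs"
      then show ?thesis unfolding Mxs z by (rule rev_image_eqI) simp
    next
      assume "(\<sigma> j, \<sigma> i) \<in> set xs"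
      then show ?thesis unfolding Mxs z by (rule rev_image_eqI) (simp add: insert_commute)
    qed
    moreover have "z \<in> (`) \<sigma> ` M"
    proof -
      have "{i, j} \<in> M" using k'(1) unfolding Mxs by (rule rev_image_eqI) simp
      then show ?thesis using z by (intro image_eqI[of _ _ "{i, j}"]) auto
    qed
    ultimately show "z \<in> M \<inter> (`) \<sigma> ` M" by simp
  qed
  then have "card (M \<inter> (`) \<sigma> ` M) = 1" by simp
  then show ?thesis using six_perms_permute[OF p(1)] by (auto simp: \<sigma>_def)
qed

context overgroup
begin

lemma card_pairs_eq: "card (pairs n) = n choose 2"
  using card_pairs by simp

text \<open>The moved edges are those with exactly one end in {a, b}.\<close>

lemma induced_transposition:
  assumes "a \<in> {1..n}" "b \<in> {1..n}" "a \<noteq> b"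
  defines "t \<equiv> induced n (transpose a b)"
  shows "t \<in> P" "t (t z) = z" "card (moved t) = 2 * (n - 2)"
proof -
  have per: "transpose a b permutes {1..n}" using assms by (simp add: permutes_swap_id)
  then show tP: "t \<in> P" unfolding t_def by (rule induced_mem)
  show "t (t z) = z"
  proof (cases "z \<in> pairs n")
    case True
    then have "t z \<in> pairs n" using tP by simp
    then show ?thesis using True by (simp add: t_def induced_apply image_comp)
  next
    case False
    then show ?thesis by (simp add: t_def induced_def)
  qed
  define W where "W = {1..n} - {a, b}"
  have W: "finite W" "card W = n - 2" "a \<notin> W" "b \<notin> W"
    using assms by (auto simp: W_def card_Diff_subset)
  have "moved t = (\<lambda>i. {a, i}) ` W \<union> (\<lambda>i. {b, i}) ` W"
  proof (intro Set.set_eqI iffI)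
    fix z assume z: "z \<in> moved t"
    then have "z \<in> pairs n" using moved_subset[OF tP] by auto
    then obtain i j where ij: "z = {i, j}" "i \<noteq> j" "i \<in> {1..n}" "j \<in> {1..n}" by (rule pairs_cases)
    have "transpose a b ` z \<noteq> z" using z \<open>z \<in> pairs n\<close> by (simp add: moved_def t_def induced_apply)
    then have "(i \<in> {a, b} \<and> j \<notin> {a, b}) \<or> (j \<in> {a, b} \<and> i \<notin> {a, b})"
      using ij(1,2) by (auto simp: insert_commute)
    then show "z \<in> (\<lambda>i. {a, i}) ` W \<union> (\<lambda>i. {b, i}) ` W"
      using ij by (auto simp: W_def insert_commute)
  next
    fix z assume "z \<in> (\<lambda>i. {a, i}) ` W \<union> (\<lambda>i. {b, i}) ` W"
    then obtain i where i: "i \<in> W" "z = {a, i} \<or> z = {b, i}" by auto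
    then have "z \<in> pairs n" using assms(1,2) by (auto simp: W_def pair_mem_iff)
    moreover have "transpose a b ` z \<noteq> z"
    proof -
      have "i \<noteq> a" "i \<noteq> b" using i(1) W(3,4) by metis+
      then have "transpose a b ` {a, i} = {b, i}" "transpose a b ` {b, i} = {a, i}" "{a, i} \<noteq> {b, i}"
        using assms(3) by (simp_all add: doubleton_eq_iff)
      then show ?thesis using i(2) by metis
    qed
    ultimately show "z \<in> moved t" by (simp add: moved_def t_def induced_apply)
  qed
  moreover have "(\<lambda>i. {a, i}) ` W \<inter> (\<lambda>i. {b, i}) ` W = {}"
    using W assms(3) by (auto simp: doubleton_eq_iff)
  ultimately show "card (moved t) = 2 * (n - 2)"
    using W by (simp add: card_Un_disjoint card_cone)
qed

text \<open>With 21 points averaging only bounds the overlap of two six-point supports by 2, which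
  gives 6 again; a smaller support drops to 3 at once. So an overlap of exactly one point is
  produced: triple transitivity conjugates three moved edges onto a triangle, and
  \<open>meet_once_edge_set\<close> provides a vertex permutation for a further conjugate.\<close>

lemma has_small_6_to_3:
  assumes "has_small 6" "n = 7"
  shows "has_small 3"
proof -
  have m: "card (pairs n) = 21" using card_pairs_eq by (simp add: assms(2) choose_two)
  obtain x where x: "x \<in> P" "x \<noteq> id" "card (moved x) \<le> 6"
    using assms(1) by (auto simp: has_small_def)
  show ?thesis
  proof (cases "card (moved x) = 6")
    case False
    then have "has_small 5" using x by (auto simp: has_small_def)
    then show ?thesis by (rule has_small_step_to) (simp_all add: m)
  next
    case True
    then obtain S where "S \<subseteq> moved x" "card S = 3"
      using obtain_subset_with_card_n[of 3 "moved x"] by auto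
    then obtain p q r where pqr: "{p, q, r} \<subseteq> moved x" "p \<noteq> q" "p \<noteq> r" "q \<noteq> r"
      by (metis card_3_iff)
    then have "p \<in> pairs n" "q \<in> pairs n" "r \<in> pairs n" using moved_subset[OF x(1)] by auto
    moreover have "{1, 2} \<in> pairs n" "{1, 3} \<in> pairs n" "{2, 3} \<in> pairs n"
      "{1, 2} \<noteq> {1, 3::nat}" "{1, 2} \<noteq> {2, 3::nat}" "{1, 3} \<noteq> {2, 3::nat}"
      by (auto simp: pair_mem_iff assms(2) doubleton_eq_iff)
    ultimately obtain h where h: "h \<in> P" "h p = {1, 2}" "h q = {1, 3}" "h r = {2, 3}"
      using trans3[of p q r] pqr by metis
    define y where "y = conj_by h x"
    have y: "y \<in> P" "moved y = h ` moved x" "card (moved y) = 6"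
      using h x(1) True card_moved_conj_by[OF h(1), of x] by (auto simp: y_def conj_by_mem moved_conj_by)
    have "{{1, 2}, {1, 3}, {2, 3}} \<subseteq> moved y" using y(2) h pqr(1) by auto
    then obtain \<sigma> where \<sigma>: "\<sigma> permutes {1..n}" "card (moved y \<inter> (`) \<sigma> ` moved y) = 1"
      using meet_once_edge_set[of "moved y"] y(3) moved_subset[OF y(1)] assms(2) by auto
    define g where "g = induced n \<sigma>"
    have g: "g \<in> P" unfolding g_def by (rule induced_mem[OF \<sigma>(1)])
    have "g ` moved y = (`) \<sigma> ` moved y"
      using moved_subset[OF y(1)] by (intro image_cong) (auto simp: g_def induced_apply)
    define z where "z = conj_by g y"
    have z: "z \<in> P" "moved z = (`) \<sigma> ` moved y"
      using g y(1) \<open>g ` moved y = _\<close> by (simp_all add: z_def conj_by_mem moved_conj_by)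
    obtain \<delta> where \<delta>: "moved y \<inter> moved z = {\<delta>}"
      using \<sigma>(2) z(2) by (auto simp: card_1_singleton_iff)
    have "y \<delta> \<notin> moved z"
    proof
      assume "y \<delta> \<in> moved z"
      moreover have "y \<delta> \<in> moved y" using \<delta> moved_closed[OF y(1)] by auto
      ultimately have "y \<delta> = \<delta>" using \<delta> by auto
      then show False using \<delta> by (auto simp: moved_def)
    qed
    then have "commutator z y \<noteq> id" using commutator_ne_id[OF y(1) z(1)] \<delta> by auto
    moreover have "card (moved (commutator z y)) \<le> 3"
      using card_moved_commutator[OF y(1) z(1)] \<delta> by simp
    ultimately show ?thesis using commutator_mem[OF z(1) y(1)] by (auto simp: has_small_def)
  qed
qed

lemma has_small_3: "has_small 3"
proof -
  have v: "1 \<in> {1..n}" "2 \<in> {1..n}" "(1::nat) \<noteq> 2" using n_ge_7 by auto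
  note t = induced_transposition[OF v]
  have "n = 7 \<or> n = 9 \<or> n = 10 \<or> n = 11 \<or> 12 \<le> n" using n_ge_7 n_ne_8 by auto
  then show ?thesis
  proof (elim disjE)
    assume "n = 7"
    then show ?thesis
      using has_small_6_to_3 descent_7[OF _ t(1,2)] t(3) card_pairs_eq by (simp add: choose_two)
  next
    assume "n = 9"
    then show ?thesis using descent_9[OF _ t(1,2)] t(3) card_pairs_eq by (simp add: choose_two)
  next
    assume "n = 10"
    then show ?thesis using descent_10[OF _ t(1,2)] t(3) card_pairs_eq by (simp add: choose_two)
  next
    assume "n = 11"
    then show ?thesis using descent_11[OF _ t(1,2)] t(3) card_pairs_eq by (simp add: choose_two)
  next
    assume "12 \<le> n"
    moreover have "has_small (2 * (n - 2))"
      using has_small_of_moved[OF t(1) t(3)] n_ge_7 by simp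
    ultimately show ?thesis using descent_large[OF card_pairs_eq] by blast
  qed
qed

lemma evenperm_mem: "\<pi> permutes pairs n \<Longrightarrow> evenperm \<pi> \<Longrightarrow> \<pi> \<in> P"
  by (rule alternating_subset[OF has_small_3])

end


section \<open>Matrix groups with symmetric invariants\<close>

text \<open>By linearity the values of f at the u i add up to f 1 for every polynomial f without
  constant term. Testing against a suitable f excludes values other than 0 and 1; the first power
  sum then leaves a single 1.\<close>

lemma sum_power_eq_one_imp_unit:
  fixes u :: "nat \<Rightarrow> 'k::field_char_0"
  assumes "\<And>k. k \<ge> 1 \<Longrightarrow> (\<Sum>i<m. u i ^ k) = 1"
  shows "\<exists>i0<m. \<forall>i<m. u i = (if i = i0 then 1 else 0)"
proof -
  have poly_sum: "(\<Sum>i<m. poly f (u i)) = poly f 1" if f: "coeff f 0 = 0" for f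
  proof -
    have "(\<Sum>i<m. poly f (u i)) = (\<Sum>k\<le>degree f. coeff f k * (\<Sum>i<m. u i ^ k))"
      by (simp add: poly_altdef sum_distrib_left sum.swap[of _ "{..<m}"])
    also have "\<dots> = (\<Sum>k\<le>degree f. coeff f k * 1 ^ k)"
      by (intro sum.cong refl) (use assms f in \<open>metis less_one linorder_not_le mult_zero_left power_one\<close>)
    finally show ?thesis by (simp add: poly_altdef)
  qed
  have zero_one: "u i = 0 \<or> u i = 1" if "i < m" for i
  proof (rule ccontr)
    assume ne: "\<not> (u i = 0 \<or> u i = 1)"
    \<comment> \<open>With the additional factor for 0, f vanishes at 1 and at every value except u
      i. So only the multiplicity of u i remains, which is nonzero in characteristic zero.\<close>
    define Z where "Z = insert 1 (u ` {..<m}) - {u i}"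
    define f where "f = [:0, 1:] * (\<Prod>z\<in>Z. [:- z, 1:])"
    have val: "poly f x = x * (\<Prod>z\<in>Z. x - z)" for x
      by (simp add: f_def poly_prod)
    have "finite Z" by (simp add: Z_def)
    have "poly f 1 = 0" using ne \<open>finite Z\<close> by (auto simp: val Z_def prod_zero_iff)
    have nz: "poly f (u i) \<noteq> 0" using ne \<open>finite Z\<close> by (auto simp: val Z_def prod_zero_iff)
    have "poly f (u j) = (if u j = u i then poly f (u i) else 0)" if "j < m" for j
      using \<open>finite Z\<close> that by (auto simp: val Z_def prod_zero_iff)
    then have "(\<Sum>j<m. poly f (u j)) = (\<Sum>j<m. if u j = u i then poly f (u i) else 0)"
      by (intro sum.cong) auto
    also have "\<dots> = of_nat (card {j\<in>{..<m}. u j = u i}) * poly f (u i)"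
      by (simp add: sum.If_cases Int_def)
    finally have "of_nat (card {j\<in>{..<m}. u j = u i}) * poly f (u i) = 0"
      using poly_sum[of f] \<open>poly f 1 = 0\<close> by (simp add: f_def)
    then have "card {j\<in>{..<m}. u j = u i} = 0" using nz by simp
    then show False using that by auto
  qed
  have "1 = (\<Sum>i<m. u i)" using assms[of 1] by simp
  also have "\<dots> = (\<Sum>i<m. if u i = 1 then 1 else 0)"
    using zero_one by (intro sum.cong) auto
  also have "\<dots> = of_nat (card {i\<in>{..<m}. u i = 1})" by (simp add: sum.If_cases Int_def)
  finally have "card {i\<in>{..<m}. u i = 1} = 1" by (metis of_nat_1 of_nat_eq_iff)
  then obtain i0 where "{i\<in>{..<m}. u i = 1} = {i0}" by (auto simp: card_1_singleton_iff)
  then have "i0 < m" "\<And>i. i < m \<Longrightarrow> u i = 1 \<longleftrightarrow> i = i0" by auto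
  then show ?thesis using zero_one by (intro exI[of _ i0]) auto
qed

section \<open>Monomials and orbit sums under permutations of the variables\<close>

definition perm_monom :: "('v \<Rightarrow> 'v) \<Rightarrow> ('v \<Rightarrow>\<^sub>0 nat) \<Rightarrow> ('v \<Rightarrow>\<^sub>0 nat)" where
  "perm_monom \<pi> t = (\<Sum>v\<in>Poly_Mapping.keys t. Poly_Mapping.single (\<pi> v) (Poly_Mapping.lookup t v))"

lemma var_power:
  "(var v :: ('v, 'k::comm_semiring_1) mpoly) ^ k = Poly_Mapping.single (Poly_Mapping.single v k) 1"
proof (induction k)
  case (Suc k)
  then show ?case by (simp add: var_def mult_single flip: single_add)
qed simp

lemma prod_single_one:
  "(\<Prod>v\<in>S. Poly_Mapping.single (s v) (1 :: 'k::comm_semiring_1)) = Poly_Mapping.single (\<Sum>v\<in>S. s v) 1"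
  by (induction S rule: infinite_finite_induct) (simp_all add: mult_single)

lemma permute_vars_eq:
  fixes p :: "('v, 'k::comm_semiring_1) mpoly"
  assumes "finite S" "Poly_Mapping.keys p \<subseteq> S"
  shows "permute_vars \<pi> p = (\<Sum>t\<in>S. Poly_Mapping.single (perm_monom \<pi> t) (Poly_Mapping.lookup p t))"
  unfolding permute_vars_def subst_poly_def
  by (subst eval_poly_superset[OF assms])
    (simp_all add: const_def var_power prod_single_one mult_single perm_monom_def)

lemma permute_vars_single:
  "permute_vars \<pi> (Poly_Mapping.single t c) = Poly_Mapping.single (perm_monom \<pi> t) c"
  by (subst permute_vars_eq[of "{t}"]) auto

lemma permute_vars_add:
  "permute_vars \<pi> (p + q) = permute_vars \<pi> p + permute_vars \<pi> q"
proof -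
  let ?S = "Poly_Mapping.keys p \<union> Poly_Mapping.keys q"
  have "Poly_Mapping.keys (p + q) \<subseteq> ?S" by (rule Poly_Mapping.keys_add)
  then show ?thesis
    by (simp add: permute_vars_eq[of ?S] lookup_add single_add sum.distrib)
qed

lemma permute_vars_sum:
  "permute_vars \<pi> (sum f A) = (\<Sum>a\<in>A. permute_vars \<pi> (f a))"
proof (induction A rule: infinite_finite_induct)
  case (insert x A)
  then show ?case by (simp add: permute_vars_add)
qed (simp_all add: permute_vars_eq[of "{}"])

lemma lookup_perm_monom:
  assumes "inj \<pi>"
  shows "Poly_Mapping.lookup (perm_monom \<pi> t) (\<pi> v) = Poly_Mapping.lookup t v"
  using assms by (auto simp: perm_monom_def lookup_sum lookup_single when_def inj_eq in_keys_iff)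

lemma perm_monom_comp:
  assumes "bij \<pi>" "bij \<sigma>"
  shows "perm_monom \<pi> (perm_monom \<sigma> t) = perm_monom (\<pi> \<circ> \<sigma>) t"
proof (rule poly_mapping_eqI)
  fix x
  obtain y where y: "x = \<pi> (\<sigma> y)" using assms by (metis bij_pointE)
  have "inj \<pi>" "inj \<sigma>" "inj (\<pi> \<circ> \<sigma>)" using assms by (auto simp: bij_def inj_compose)
  then show "Poly_Mapping.lookup (perm_monom \<pi> (perm_monom \<sigma> t)) x
      = Poly_Mapping.lookup (perm_monom (\<pi> \<circ> \<sigma>) t) x"
    using lookup_perm_monom[of "\<pi> \<circ> \<sigma>" t y] unfolding y by (simp add: lookup_perm_monom)
qed

lemma keys_perm_monom: "Poly_Mapping.keys (perm_monom \<pi> t) \<subseteq> \<pi> ` Poly_Mapping.keys t"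
proof -
  have "Poly_Mapping.keys (perm_monom \<pi> t)
      \<subseteq> (\<Union>v\<in>Poly_Mapping.keys t. Poly_Mapping.keys (Poly_Mapping.single (\<pi> v) (Poly_Mapping.lookup t v)))"
    unfolding perm_monom_def by (rule keys_sum)
  then show ?thesis by (auto split: if_splits)
qed

lemma permute_vars_cong:
  assumes "p \<in> poly_ring V" "\<And>v. v \<in> V \<Longrightarrow> \<pi> v = \<rho> v"
  shows "permute_vars \<pi> p = permute_vars \<rho> p"
  unfolding permute_vars_def subst_poly_def
  by (rule eval_poly_cong[OF assms(1)]) (simp add: assms(2))

text \<open>Distinct exponents, one of which may be 0, give the monomial a trivial stabiliser among
  the permutations of V.\<close>

lemma ex_separating_monom:
  assumes "finite V"
  shows "\<exists>\<mu> :: 'v \<Rightarrow>\<^sub>0 nat. Poly_Mapping.keys \<mu> \<subseteq> V \<and> inj_on (Poly_Mapping.lookup \<mu>) V"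
proof -
  obtain f :: "'v \<Rightarrow> nat" where f: "inj_on f V"
    using finite_imp_inj_to_nat_seg[OF assms] by blast
  define \<mu> where "\<mu> = (\<Sum>v\<in>V. Poly_Mapping.single v (f v))"
  have "Poly_Mapping.lookup \<mu> v = f v" if "v \<in> V" for v
    using assms that by (simp add: \<mu>_def lookup_sum lookup_single when_def)
  moreover have "Poly_Mapping.keys \<mu> \<subseteq> (\<Union>v\<in>V. Poly_Mapping.keys (Poly_Mapping.single v (f v)))"
    unfolding \<mu>_def by (rule keys_sum)
  ultimately show ?thesis
    using f by (intro exI[of _ \<mu>]) (auto simp: inj_on_def split: if_splits)
qed

text \<open>
  The orbit sum of a monomial with pairwise distinct exponents is fixed by \<open>P\<close> and by no other
  permutation.
\<close>

lemma (in perm_group) mem_of_fixing_invariants: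
  assumes g: "g permutes \<Omega>"
    and fixed: "\<And>p :: ('a, 'k::field_char_0) mpoly. p \<in> poly_ring \<Omega> \<Longrightarrow>
      (\<And>\<pi>. \<pi> \<in> P \<Longrightarrow> permute_vars \<pi> p = p) \<Longrightarrow> permute_vars g p = p"
  shows "g \<in> P"
proof -
  obtain \<mu> :: "'a \<Rightarrow>\<^sub>0 nat" where \<mu>: "Poly_Mapping.keys \<mu> \<subseteq> \<Omega>" "inj_on (Poly_Mapping.lookup \<mu>) \<Omega>"
    using ex_separating_monom[OF finite_Omega] by blast
  define q :: "('a, 'k) mpoly" where "q = (\<Sum>\<sigma>\<in>P. Poly_Mapping.single (perm_monom \<sigma> \<mu>) 1)"
  have bij: "bij \<sigma>" if "\<sigma> \<in> P" for \<sigma> using permutes[OF that] by (rule permutes_bij)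
  \<comment> \<open>The coefficient counts the elements of P that produce the monomial s, so in
    characteristic zero the keys of q are exactly the images of \<mu> under P.\<close>
  have lookup_q: "Poly_Mapping.lookup q s = of_nat (card {\<sigma>\<in>P. perm_monom \<sigma> \<mu> = s})" for s
    using finite_P by (simp add: q_def lookup_sum lookup_single when_def sum.If_cases Int_def)
  have key: "s \<in> Poly_Mapping.keys q \<longleftrightarrow> (\<exists>\<sigma>\<in>P. perm_monom \<sigma> \<mu> = s)" for s
    using finite_P by (auto simp: in_keys_iff lookup_q)
  have "q \<in> poly_ring \<Omega>"
    unfolding poly_ring_def
  proof (intro CollectI ballI subsetI)
    fix s v assume "s \<in> Poly_Mapping.keys q" "v \<in> Poly_Mapping.keys s"
    then obtain \<sigma> where "\<sigma> \<in> P" "v \<in> Poly_Mapping.keys (perm_monom \<sigma> \<mu>)"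
      using key by auto
    then have "\<sigma> \<in> P" "v \<in> \<sigma> ` Poly_Mapping.keys \<mu>"
      using keys_perm_monom[of \<sigma> \<mu>] by auto
    then show "v \<in> \<Omega>" using \<mu>(1) by auto
  qed
  moreover have "permute_vars \<pi> q = q" if \<pi>: "\<pi> \<in> P" for \<pi>
  proof -
    have "permute_vars \<pi> q = (\<Sum>\<sigma>\<in>P. Poly_Mapping.single (perm_monom (\<pi> \<circ> \<sigma>) \<mu>) 1)"
      unfolding q_def permute_vars_sum permute_vars_single
      using bij \<pi> by (intro sum.cong) (auto simp: perm_monom_comp)
    also have "\<dots> = q"
      unfolding q_def
    proof (rule sum.reindex_bij_witness[where i = "\<lambda>\<sigma>. Hilbert_Choice.inv \<pi> \<circ> \<sigma>" and j = "\<lambda>\<sigma>. \<pi> \<circ> \<sigma>"])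
    qed (use \<pi> comp_mem inv_mem in \<open>auto simp: fun_eq_iff\<close>)
    finally show ?thesis .
  qed
  ultimately have gq: "permute_vars g q = q" by (rule fixed)
  have inj_g: "inj g" using g by (rule permutes_inj)
  \<comment> \<open>As g fixes q, it takes the key \<mu> to another key, which has the form
    \<open>perm_monom \<sigma> \<mu>\<close>; the distinct exponents then force g =
    \<sigma>.\<close>
  have "perm_monom g \<mu> \<in> Poly_Mapping.keys q"
  proof -
    have "Poly_Mapping.lookup (permute_vars g q) (perm_monom g \<mu>)
        = of_nat (card {\<sigma>\<in>P. perm_monom g (perm_monom \<sigma> \<mu>) = perm_monom g \<mu>})"
      using finite_P by (simp add: q_def permute_vars_sum permute_vars_single lookup_sum lookup_single
          when_def sum.If_cases Int_def)
    moreover have "perm_monom id \<mu> = \<mu>"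
      by (rule poly_mapping_eqI) (metis id_apply inj_on_id lookup_perm_monom)
    then have "id \<in> {\<sigma>\<in>P. perm_monom g (perm_monom \<sigma> \<mu>) = perm_monom g \<mu>}"
      using id_mem by simp
    then have "card {\<sigma>\<in>P. perm_monom g (perm_monom \<sigma> \<mu>) = perm_monom g \<mu>} \<noteq> 0"
      using finite_P by (metis (no_types, lifting) card_0_eq empty_iff finite_Collect_conjI finite_subset mem_Collect_eq subsetI)
    ultimately show ?thesis unfolding gq by (simp add: in_keys_iff)
  qed
  then obtain \<sigma> where \<sigma>: "\<sigma> \<in> P" "perm_monom \<sigma> \<mu> = perm_monom g \<mu>" using key by blast
  have "\<sigma> v = g v" for v
  proof (cases "v \<in> \<Omega>")
    case True
    define w where "w = Hilbert_Choice.inv \<sigma> (g v)"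
    have w: "\<sigma> w = g v" using \<sigma>(1) by (simp add: w_def)
    have "g v \<in> \<Omega>" using True g by (simp add: permutes_in_image)
    then have "w \<in> \<Omega>" using w \<sigma>(1) in_Omega_iff by metis
    have "Poly_Mapping.lookup \<mu> w = Poly_Mapping.lookup (perm_monom \<sigma> \<mu>) (g v)"
      using lookup_perm_monom[OF inj[OF \<sigma>(1)], of \<mu> w] w by simp
    also have "\<dots> = Poly_Mapping.lookup \<mu> v" unfolding \<sigma>(2) by (rule lookup_perm_monom[OF inj_g])
    finally have "w = v" using \<mu>(2) True \<open>w \<in> \<Omega>\<close> by (simp add: inj_on_eq_iff)
    then show ?thesis using w by simp
  next
    case False
    then show ?thesis using permutes_not_in[OF g] permutes_not_in[OF permutes[OF \<sigma>(1)]] by metis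
  qed
  then have "\<sigma> = g" by blast
  then show ?thesis using \<sigma>(1) by simp
qed

section \<open>Matrices fixing all power sums\<close>

definition power_sum :: "'v set \<Rightarrow> nat \<Rightarrow> ('v, 'k::field) mpoly" where
  "power_sum V k = (\<Sum>v\<in>V. Poly_Mapping.single (Poly_Mapping.single v k) 1)"

lemma power_sum_symmetric:
  assumes "finite V"
  shows "power_sum V k \<in> symmetric_polys V"
proof -
  have "Poly_Mapping.keys (power_sum V k :: ('a, 'b) mpoly)
      \<subseteq> (\<Union>v\<in>V. Poly_Mapping.keys (Poly_Mapping.single (Poly_Mapping.single v k) (1 :: 'b)))"
    unfolding power_sum_def by (rule keys_sum)
  then have "power_sum V k \<in> (poly_ring V :: ('a, 'b) mpoly set)"
    by (auto simp: poly_ring_def split: if_splits dest!: subsetD)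
  moreover have "permute_vars \<pi> (power_sum V k) = (power_sum V k :: ('a, 'b) mpoly)"
    if \<pi>: "\<pi> permutes V" for \<pi>
  proof -
    have "perm_monom \<pi> (Poly_Mapping.single v k) = Poly_Mapping.single (\<pi> v) k" for v
      by (cases "k = 0") (simp_all add: perm_monom_def)
    then have "permute_vars \<pi> (power_sum V k)
        = (\<Sum>v\<in>V. Poly_Mapping.single (Poly_Mapping.single (\<pi> v) k) (1 :: 'b))"
      by (simp add: power_sum_def permute_vars_sum permute_vars_single)
    also have "\<dots> = power_sum V k"
      unfolding power_sum_def
      using sum.permute[OF \<pi>, of "\<lambda>v. Poly_Mapping.single (Poly_Mapping.single v k) (1 :: 'b)"]
      by (simp add: comp_def)
    finally show ?thesis .
  qed
  ultimately show ?thesis by (simp add: symmetric_polys_def)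
qed

lemma coord_eq: "inj_on e {..<m} \<Longrightarrow> i < m \<Longrightarrow> coord e m (e i) = i"
  by (simp add: coord_def the_inv_into_f_f)

lemma poly_fun_power_sum:
  assumes "inj_on e {..<m}" "k \<ge> 1"
  shows "poly_fun e m (power_sum (e ` {..<m}) k) a = (\<Sum>i<m. (a $ i) ^ k)"
proof -
  have "poly_fun e m (power_sum (e ` {..<m}) k) a = (\<Sum>v\<in>e ` {..<m}. (a $ coord e m v) ^ k)"
    using assms(2) by (simp add: poly_fun_def power_sum_def eval_id_sum eval_id_single)
  also have "\<dots> = (\<Sum>i<m. (a $ i) ^ k)"
    using assms(1) by (subst sum.reindex) (simp_all add: coord_eq)
  finally show ?thesis .
qed

text \<open>The convention of \<open>permute_vars_eq_comp_mat\<close>: permuting the variables by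
  \<pi> is composition with this matrix, not with its inverse.\<close>

definition perm_matrix :: "(nat \<Rightarrow> 'v) \<Rightarrow> nat \<Rightarrow> ('v \<Rightarrow> 'v) \<Rightarrow> ('k::field) mat" where
  "perm_matrix e m \<pi> = mat m m (\<lambda>(i, j). if e j = \<pi> (e i) then 1 else 0)"

lemma perm_matrix_carrier: "perm_matrix e m \<pi> \<in> carrier_mat m m"
  by (simp add: perm_matrix_def)

lemma perm_matrix_id:
  assumes "inj_on e {..<m}"
  shows "perm_matrix e m id = 1\<^sub>m m"
  using assms by (intro eq_matI) (auto simp: perm_matrix_def inj_on_def)

text \<open>Row i carries its 1 in the column of \<pi> (e i), so the product of the matrices follows
  \<pi> first and \<rho> second.\<close>

lemma perm_matrix_mult:
  assumes "inj_on e {..<m}" "\<pi> permutes e ` {..<m}"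
  shows "perm_matrix e m \<pi> * perm_matrix e m \<rho> = (perm_matrix e m (\<rho> \<circ> \<pi>) :: 'k::field mat)"
proof (rule eq_matI)
  fix i j assume "i < dim_row (perm_matrix e m (\<rho> \<circ> \<pi>) :: 'k mat)" "j < dim_col (perm_matrix e m (\<rho> \<circ> \<pi>) :: 'k mat)"
  then have ij: "i < m" "j < m" by (simp_all add: perm_matrix_def)
  have "\<pi> (e i) \<in> e ` {..<m}" using assms(2) ij by (simp add: permutes_in_image)
  then obtain k where k: "k < m" "\<pi> (e i) = e k" by auto
  have "(perm_matrix e m \<pi> * perm_matrix e m \<rho>) $$ (i, j)
      = (\<Sum>l<m. (if e l = \<pi> (e i) then 1 else 0) * (if e j = \<rho> (e l) then 1 else (0 :: 'k)))"
    using ij by (simp add: perm_matrix_def scalar_prod_def lessThan_atLeast0)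
  also have "\<dots> = (\<Sum>l<m. if l = k then (if e j = \<rho> (e k) then 1 else 0) else 0)"
    using k assms(1) by (intro sum.cong) (auto simp: inj_on_def)
  also have "\<dots> = (perm_matrix e m (\<rho> \<circ> \<pi>)) $$ (i, j)"
    using k ij by (simp add: perm_matrix_def)
  finally show "(perm_matrix e m \<pi> * perm_matrix e m \<rho>) $$ (i, j) = (perm_matrix e m (\<rho> \<circ> \<pi>) :: 'k mat) $$ (i, j)" .
qed (simp_all add: perm_matrix_def)

lemma group_GL: "group (GL m)"
proof -
  interpret matrices: semiring "ring_mat TYPE('k::field) m ()" by (rule semiring_mat)
  show ?thesis unfolding GL_def by (rule matrices.units_group)
qed

lemma GL_simps:
  "mult (GL m) = (*)" "one (GL m) = 1\<^sub>m m" "carrier (GL m) \<subseteq> carrier_mat m m"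
  by (auto simp: GL_def units_of_def ring_mat_def Units_def)

text \<open>
  The power sums take the same values at the images of the unit vectors as at the unit vectors,
  so these images are unit vectors again.
\<close>

lemma matrix_group_perm_matrix:
  fixes H :: "'k::field_char_0 mat set"
  assumes e: "inj_on e {..<m}" and H: "matrix_group m H"
    and sym: "symmetric_polys (e ` {..<m}) \<subseteq> mat_invariants e m H" and A: "A \<in> H"
  shows "\<exists>\<pi>. \<pi> permutes e ` {..<m} \<and> A = perm_matrix e m \<pi>"
proof -
  have sub: "subgroup H (GL m)" using H by (simp add: matrix_group_def)
  interpret G: group "GL m :: 'k mat monoid" by (rule group_GL)
  have AG: "A \<in> carrier (GL m)" using A sub subgroup.subset by blast
  then have Am: "A \<in> carrier_mat m m" using GL_simps(3) by blast
  have "inv\<^bsub>GL m\<^esub> A \<in> H" by (rule subgroup.m_inv_closed[OF sub A])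
  \<comment> \<open>The action composes with the inverse matrix, so composition with A is the action
    of the inverse of A, which is in H as well.\<close>
  have inv_pol: "comp_mat e m A p = p" if "p \<in> symmetric_polys (e ` {..<m})" for p
  proof -
    have "mat_action e m (inv\<^bsub>GL m\<^esub> A) p = p"
      using sym that \<open>inv\<^bsub>GL m\<^esub> A \<in> H\<close> by (auto simp: mat_invariants_def)
    then show ?thesis using AG by (simp add: mat_action_def)
  qed
  have col: "\<exists>i0<m. \<forall>i<m. A $$ (i, j) = (if i = i0 then 1 else 0)" if j: "j < m" for j
  proof (rule sum_power_eq_one_imp_unit)
    fix k :: nat assume k: "k \<ge> 1"
    let ?p = "power_sum (e ` {..<m}) k :: (_, 'k) mpoly"
    have p: "?p \<in> symmetric_polys (e ` {..<m})" by (rule power_sum_symmetric) simp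
    have "(\<Sum>i<m. A $$ (i, j) ^ k) = (\<Sum>i<m. (A *\<^sub>v unit_vec m j) $ i ^ k)"
      using Am j by (intro sum.cong) auto
    also have "\<dots> = poly_fun e m ?p (A *\<^sub>v unit_vec m j)"
      by (rule poly_fun_power_sum[OF e k, symmetric])
    also have "\<dots> = poly_fun e m (comp_mat e m A ?p) (unit_vec m j)"
      using p Am by (intro poly_fun_comp_mat[OF e, symmetric]) (auto simp: symmetric_polys_def)
    also have "\<dots> = (\<Sum>i<m. (unit_vec m j $ i) ^ k)"
      unfolding inv_pol[OF p] by (rule poly_fun_power_sum[OF e k])
    also have "\<dots> = (\<Sum>i<m. if i = j then 1 else 0)"
      using j k by (intro sum.cong) auto
    finally show "(\<Sum>i<m. A $$ (i, j) ^ k) = 1" using j by simp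
  qed
  then obtain \<tau> where \<tau>: "\<And>j. j < m \<Longrightarrow> \<tau> j < m"
    "\<And>i j. i < m \<Longrightarrow> j < m \<Longrightarrow> A $$ (i, j) = (if i = \<tau> j then 1 else 0)" by metis
  have "inj_on \<tau> {..<m}"
  proof (rule inj_onI)
    fix j k assume jk: "j \<in> {..<m}" "k \<in> {..<m}" "\<tau> j = \<tau> k"
    have cols: "A *\<^sub>v unit_vec m j = A *\<^sub>v unit_vec m k"
      using Am jk \<tau>(2) by (intro eq_vecI) auto
    have BA: "inv\<^bsub>GL m\<^esub> A * A = 1\<^sub>m m"
      using G.l_inv[OF AG] by (simp add: GL_simps)
    have B: "inv\<^bsub>GL m\<^esub> A \<in> carrier_mat m m" using G.inv_closed[OF AG] GL_simps(3) by blast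
    have BAv: "inv\<^bsub>GL m\<^esub> A *\<^sub>v (A *\<^sub>v unit_vec m l) = unit_vec m l" for l
      using assoc_mult_mat_vec[OF B Am, of "unit_vec m l"] by (simp add: BA)
    have "unit_vec m j = inv\<^bsub>GL m\<^esub> A *\<^sub>v (A *\<^sub>v unit_vec m j)" by (rule BAv[symmetric])
    also have "\<dots> = inv\<^bsub>GL m\<^esub> A *\<^sub>v (A *\<^sub>v unit_vec m k)" by (simp only: cols)
    also have "\<dots> = unit_vec m k" by (rule BAv)
    finally have "unit_vec m j $ j = (unit_vec m k $ j :: 'k)" by simp
    then show "j = k" using jk by (simp add: unit_vec_def split: if_splits)
  qed
  moreover have "\<tau> ` {..<m} \<subseteq> {..<m}" using \<tau>(1) by auto
  ultimately have "bij_betw \<tau> {..<m} {..<m}" by (simp add: bij_betw_def endo_inj_surj)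
  then have "bij_betw (e \<circ> \<tau> \<circ> coord e m) (e ` {..<m}) (e ` {..<m})"
    using bij_betw_trans[OF bij_betw_trans[OF bij_betw_the_inv_into[OF inj_on_imp_bij_betw[OF e]] _]
        inj_on_imp_bij_betw[OF e], of \<tau>]
    by (simp add: coord_def comp_assoc)
  then have \<rho>: "restrict_id (e \<circ> \<tau> \<circ> coord e m) (e ` {..<m}) permutes e ` {..<m}" (is "?\<rho> permutes _")
    by (rule permutes_restrict_id)
  have \<rho>_e: "?\<rho> (e j) = e (\<tau> j)" if "j < m" for j
    using that e by (simp add: coord_eq)
  \<comment> \<open>The inverse appears because \<tau> describes the columns of A, whereas
    \<open>perm_matrix\<close> is described by its rows.\<close>
  have "A = perm_matrix e m (Hilbert_Choice.inv ?\<rho>)"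
  proof (rule eq_matI)
    fix i j assume "i < dim_row (perm_matrix e m (Hilbert_Choice.inv ?\<rho>) :: 'k mat)"
      "j < dim_col (perm_matrix e m (Hilbert_Choice.inv ?\<rho>) :: 'k mat)"
    then have ij: "i < m" "j < m" by (simp_all add: perm_matrix_def)
    have "e j = Hilbert_Choice.inv ?\<rho> (e i) \<longleftrightarrow> e (\<tau> j) = e i"
      using permutes_inv_eq[OF \<rho>] \<rho>_e[OF ij(2)] by metis
    also have "\<dots> \<longleftrightarrow> i = \<tau> j" using e ij \<tau>(1) by (auto simp: inj_on_def)
    finally show "A $$ (i, j) = perm_matrix e m (Hilbert_Choice.inv ?\<rho>) $$ (i, j)"
      using ij \<tau>(2) by (simp add: perm_matrix_def)
  qed (use Am in \<open>simp_all add: perm_matrix_def\<close>)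
  then show ?thesis using permutes_inv[OF \<rho>] by blast
qed

text \<open>Permuting by \<pi> is the action of the inverse of its matrix; closure of H under
  inverses makes the two invariance conditions equivalent. By
  \<open>matrix_group_perm_matrix\<close> no element of H is missed.\<close>

lemma matrix_group_as_perm_group:
  fixes H :: "'k::field_char_0 mat set"
  assumes e: "inj_on e {..<m}" and H: "matrix_group m H"
    and sym: "symmetric_polys (e ` {..<m}) \<subseteq> mat_invariants e m H"
  defines "P \<equiv> {\<pi>. \<pi> permutes e ` {..<m} \<and> perm_matrix e m \<pi> \<in> H}"
  shows "perm_group (e ` {..<m}) P"
    and "mat_invariants e m H = {p \<in> poly_ring (e ` {..<m}). \<forall>\<pi>\<in>P. permute_vars \<pi> p = p}"
proof -
  have sub: "subgroup H (GL m)" using H by (simp add: matrix_group_def)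
  interpret G: group "GL m :: 'k mat monoid" by (rule group_GL)
  have HG: "A \<in> carrier (GL m)" if "A \<in> H" for A using that sub subgroup.subset by blast
  have inv_eq: "(perm_matrix e m (Hilbert_Choice.inv \<pi>) :: 'k mat) = inv\<^bsub>GL m\<^esub> (perm_matrix e m \<pi>)"
    if \<pi>: "\<pi> \<in> P" for \<pi>
  proof -
    have A: "(perm_matrix e m \<pi> :: 'k mat) \<in> carrier (GL m)" using \<pi> HG by (simp add: P_def)
    let ?A = "perm_matrix e m \<pi> :: 'k mat" and ?B = "perm_matrix e m (Hilbert_Choice.inv \<pi>) :: 'k mat"
    have AB: "?A * ?B = 1\<^sub>m m"
    proof -
      have per: "\<pi> permutes e ` {..<m}" using \<pi> by (simp add: P_def)
      have "?A * ?B = perm_matrix e m (Hilbert_Choice.inv \<pi> \<circ> \<pi>)" by (rule perm_matrix_mult[OF e per])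
      also have "Hilbert_Choice.inv \<pi> \<circ> \<pi> = id" by (rule permutes_inv_o(2)[OF per])
      finally show ?thesis by (simp only: perm_matrix_id[OF e])
    qed
    have C: "inv\<^bsub>GL m\<^esub> ?A \<in> carrier_mat m m" using G.inv_closed[OF A] GL_simps(3) by blast
    have "inv\<^bsub>GL m\<^esub> ?A * ?A = 1\<^sub>m m" using G.l_inv[OF A] by (simp add: GL_simps)
    then have "?B = inv\<^bsub>GL m\<^esub> ?A * ?A * ?B" by (simp add: left_mult_one_mat[OF perm_matrix_carrier])
    also have "\<dots> = inv\<^bsub>GL m\<^esub> ?A"
      using AB C by (simp add: assoc_mult_mat[OF C perm_matrix_carrier perm_matrix_carrier])
    finally show ?thesis .
  qed
  have "perm_matrix e m id \<in> H"
    using subgroup.one_closed[OF sub] by (simp add: GL_simps perm_matrix_id[OF e])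
  moreover have "perm_matrix e m (\<pi> \<circ> \<rho>) \<in> H" if "\<pi> \<in> P" "\<rho> \<in> P" for \<pi> \<rho>
    using subgroup.m_closed[OF sub, of "perm_matrix e m \<rho>" "perm_matrix e m \<pi>"] that
    by (simp add: P_def GL_simps perm_matrix_mult[OF e])
  moreover have "perm_matrix e m (Hilbert_Choice.inv \<pi>) \<in> H" if "\<pi> \<in> P" for \<pi>
    using subgroup.m_inv_closed[OF sub, of "perm_matrix e m \<pi>"] that by (simp add: inv_eq P_def)
  ultimately show "perm_group (e ` {..<m}) P"
    by unfold_locales (auto simp: P_def permutes_compose permutes_inv permutes_id id_def[symmetric])
  then interpret perm_group "e ` {..<m}" P .
  have act: "(\<forall>A\<in>H. mat_action e m A p = p) \<longleftrightarrow> (\<forall>\<pi>\<in>P. permute_vars \<pi> p = p)"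
    if p: "p \<in> poly_ring (e ` {..<m})" for p :: "(_, 'k) mpoly"
  proof -
    have pv: "permute_vars \<pi> p = comp_mat e m (perm_matrix e m \<pi>) p" if "\<pi> \<in> P" for \<pi>
      unfolding perm_matrix_def using that by (intro permute_vars_eq_comp_mat[OF e p]) (simp add: P_def)
    show ?thesis
    proof (intro iffI ballI)
      fix \<pi> assume h: "\<forall>A\<in>H. mat_action e m A p = p" and \<pi>: "\<pi> \<in> P"
      then have A: "perm_matrix e m \<pi> \<in> H" by (simp add: P_def)
      then have "mat_action e m (inv\<^bsub>GL m\<^esub> (perm_matrix e m \<pi>)) p = p"
        using h subgroup.m_inv_closed[OF sub] by blast
      then show "permute_vars \<pi> p = p"
        using HG[OF A] by (simp add: pv[OF \<pi>] mat_action_def)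
    next
      fix A assume h: "\<forall>\<pi>\<in>P. permute_vars \<pi> p = p" and A: "A \<in> H"
      have "inv\<^bsub>GL m\<^esub> A \<in> H" using subgroup.m_inv_closed[OF sub A] .
      then obtain \<pi> where "\<pi> permutes e ` {..<m}" "inv\<^bsub>GL m\<^esub> A = perm_matrix e m \<pi>"
        using matrix_group_perm_matrix[OF e H sym] by blast
      moreover from this have "\<pi> \<in> P" using \<open>inv\<^bsub>GL m\<^esub> A \<in> H\<close> by (simp add: P_def)
      ultimately show "mat_action e m A p = p"
        using h pv[of \<pi>] by (simp add: mat_action_def)
    qed
  qed
  show "mat_invariants e m H = {p \<in> poly_ring (e ` {..<m}). \<forall>\<pi>\<in>P. permute_vars \<pi> p = p}"
    unfolding mat_invariants_def using act by auto
qed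

text \<open>Such a t is a product of N disjoint transpositions; the induction strips off the one
  that swaps p and t p.\<close>

lemma evenperm_involution:
  assumes "finite (moved t)" "\<And>p. t (t p) = p" "card (moved t) = 2 * N"
  shows "evenperm t \<longleftrightarrow> even N"
  using assms
proof (induction N arbitrary: t)
  case 0
  then have "t = id" by (auto simp: moved_def fun_eq_iff)
  then show ?case by simp
next
  case (Suc N)
  then have "moved t \<noteq> {}" by auto
  then obtain p where p: "t p \<noteq> p" by (auto simp: moved_def)
  define q where "q = t p"
  define s where "s = transpose p q \<circ> t"
  have tq: "t q = p" "p \<noteq> q" using p Suc.prems(2) by (auto simp: q_def)
  have inj: "t a = t b \<longleftrightarrow> a = b" for a b using Suc.prems(2) by metis
  have s_eq: "s r = (if r = p \<or> r = q then r else t r)" for r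
    using tq inj[of r p] inj[of r q] by (auto simp: s_def q_def[symmetric] transpose_def)
  have "moved s = moved t - {p, q}" using s_eq by (auto simp: moved_def)
  moreover have "{p, q} \<subseteq> moved t" using p tq by (auto simp: moved_def)
  ultimately have s: "finite (moved s)" "card (moved s) = 2 * N"
    using Suc.prems(1,3) tq(2) by (simp_all add: card_Diff_subset)
  have ss: "s (s r) = r" for r
    using s_eq[of r] s_eq[of "s r"] inj[of r p] inj[of r q] tq Suc.prems(2)[of r] by (auto simp: q_def)
  have "bij t" using Suc.prems(2) by (metis involuntory_imp_bij)
  then have "permutation t" using Suc.prems(1) by (simp add: permutation moved_def)
  then have "evenperm s \<longleftrightarrow> \<not> evenperm t"
    unfolding s_def using tq(2) by (simp add: evenperm_comp[OF permutation_swap_id] evenperm_swap)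
  then show ?case using Suc.IH[OF s(1) ss s(2)] by simp
qed


section \<open>Intermediate invariant rings\<close>

text \<open>For n = 3 an edge is the complement of its opposite vertex, so permutations of edges and
  of vertices correspond; for smaller n there is at most one edge.\<close>

lemma induced_surj_small:
  assumes "n \<le> 3" "\<pi> permutes pairs n"
  shows "\<exists>\<sigma>. \<sigma> permutes {1..n} \<and> \<pi> = induced n \<sigma>"
proof (cases "n = 3")
  case True
  define f where "f = (\<lambda>i. {1..3} - {i :: nat})"
  have f: "bij_betw f {1..3} (pairs 3)"
  proof (rule bij_betw_imageI)
    show inj: "inj_on f {1..3}" by (auto simp: f_def inj_on_def)
    have "f ` {1..3} \<subseteq> pairs 3" by (auto simp: f_def pairs_eq)
    moreover have "card (f ` {1..3}) = card (pairs 3)"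
      using card_pairs[of 3] card_image[OF inj] by (simp add: choose_two)
    ultimately show "f ` {1..3} = pairs 3" using card_pairs[of 3] by (intro card_subset_eq) auto
  qed
  define g where "g = the_inv_into {1..3} f"
  have g: "bij_betw g (pairs 3) {1..3}" unfolding g_def by (rule bij_betw_the_inv_into[OF f])
  have fg: "f (g a) = a" if "a \<in> pairs 3" for a
    using f_the_inv_into_f_bij_betw[OF f, of a] that by (simp add: g_def)
  define \<sigma> where "\<sigma> = restrict_id (g \<circ> \<pi> \<circ> f) {1..3}"
  have "bij_betw \<pi> (pairs 3) (pairs 3)" using assms(2) True by (simp add: permutes_imp_bij)
  then have "bij_betw (g \<circ> \<pi> \<circ> f) {1..3} {1..3}"
    using bij_betw_trans[OF f bij_betw_trans[OF _ g]] by (simp add: comp_assoc)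
  then have \<sigma>: "\<sigma> permutes {1..3}" unfolding \<sigma>_def by (rule permutes_restrict_id)
  have "\<pi> a = induced 3 \<sigma> a" for a
  proof (cases "a \<in> pairs 3")
    case a: True
    then have i: "g a \<in> {1..3}" using g by (auto simp: bij_betw_def)
    have \<pi>a: "\<pi> a \<in> pairs 3" using assms(2) True a by (simp add: permutes_in_image)
    have "\<sigma> ` a = \<sigma> ` ({1..3} - {g a})" using fg[OF a] by (simp add: f_def)
    also have "\<dots> = \<sigma> ` {1..3} - {\<sigma> (g a)}"
      using permutes_inj[OF \<sigma>] by (simp add: image_set_diff)
    also have "\<dots> = f (\<sigma> (g a))" using permutes_image[OF \<sigma>] by (simp add: f_def)
    also have "\<sigma> (g a) = g (\<pi> a)" using i fg[OF a] by (simp add: \<sigma>_def)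
    also have "f (g (\<pi> a)) = \<pi> a" by (rule fg[OF \<pi>a])
    finally show ?thesis using a by (simp add: induced_apply)
  next
    case False
    then show ?thesis using permutes_not_in[OF assms(2)] True by (simp add: induced_def)
  qed
  then show ?thesis using \<sigma> True by blast
next
  case False
  have "card (pairs n) \<le> 1"
  proof -
    have "n = 0 \<or> n = 1 \<or> n = 2" using assms(1) False by auto
    then show ?thesis using card_pairs[of n] by (auto simp: choose_two)
  qed
  then have one: "a = b" if "a \<in> pairs n" "b \<in> pairs n" for a b
    using that card_pairs[of n] card_le_Suc0_iff_eq[of "pairs n"] by auto
  have "\<pi> a = a" for a
    using one[of "\<pi> a" a] permutes_in_image[OF assms(2), of a] permutes_not_in[OF assms(2), of a] by blast
  then have "\<pi> = induced n id" by (auto simp: induced_def restrict_id_def fun_eq_iff)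
  then show ?thesis using permutes_id by blast
qed

lemma graph_invariants_eq:
  "(graph_invariants n :: (nat set, 'k::field) mpoly set) =
    {p \<in> poly_ring (pairs n). \<forall>\<sigma>. \<sigma> permutes {1..n} \<longrightarrow> permute_vars (induced n \<sigma>) p = p}"
proof -
  have "permute_vars ((`) \<sigma>) p = permute_vars (induced n \<sigma>) p"
    if "p \<in> poly_ring (pairs n)" for p :: "(nat set, 'k) mpoly" and \<sigma>
    by (rule permute_vars_cong[OF that]) (simp add: induced_apply)
  then show ?thesis by (auto simp: graph_invariants_def sym_group_def)
qed

lemma symmetric_subset_alternate: "symmetric_polys V \<subseteq> alternate_polys V"
  by (auto simp: symmetric_polys_def alternate_polys_def)

lemma intermediate_group_large:
  fixes H :: "'k::field_char_0 mat set"
  assumes n: "n \<notin> {4, 5, 6, 8}" and e: "bij_betw e {..<m} (pairs n)"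
    and H: "matrix_group m H"
    and sym: "symmetric_polys (pairs n) \<subseteq> mat_invariants e m H"
    and strict: "mat_invariants e m H \<subset> graph_invariants n"
  shows "mat_invariants e m H \<subseteq> alternate_polys (pairs n)"
    and "odd n \<Longrightarrow> mat_invariants e m H \<subseteq> symmetric_polys (pairs n)"
proof -
  have inj: "inj_on e {..<m}" and im: "e ` {..<m} = pairs n"
    using e by (auto simp: bij_betw_def)
  define P where "P = {\<pi>. \<pi> permutes pairs n \<and> (perm_matrix e m \<pi> :: 'k mat) \<in> H}"
  have P: "perm_group (pairs n) P"
    and inv: "mat_invariants e m H = {p \<in> poly_ring (pairs n). \<forall>\<pi>\<in>P. permute_vars \<pi> p = p}"
    using matrix_group_as_perm_group[OF inj H] sym by (simp_all add: im P_def)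
  interpret perm_group "pairs n" P by (rule P)
  have ind: "induced n \<sigma> \<in> P" if \<sigma>: "\<sigma> permutes {1..n}" for \<sigma>
  proof (rule mem_of_fixing_invariants)
    show "induced n \<sigma> permutes pairs n" by (rule induced_permutes[OF \<sigma>])
    fix p :: "(nat set, 'k) mpoly"
    assume "p \<in> poly_ring (pairs n)" "\<And>\<pi>. \<pi> \<in> P \<Longrightarrow> permute_vars \<pi> p = p"
    then have "p \<in> graph_invariants n" using inv strict by auto
    then show "permute_vars (induced n \<sigma>) p = p" using \<sigma> by (simp add: graph_invariants_eq)
  qed
  have proper: "\<exists>\<pi>\<in>P. \<forall>\<sigma>. \<sigma> permutes {1..n} \<longrightarrow> \<pi> \<noteq> induced n \<sigma>"
  proof (rule ccontr)
    assume "\<not> ?thesis"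
    then have "\<And>\<pi>. \<pi> \<in> P \<Longrightarrow> \<exists>\<sigma>. \<sigma> permutes {1..n} \<and> \<pi> = induced n \<sigma>" by blast
    then have "graph_invariants n \<subseteq> mat_invariants e m H"
      unfolding inv graph_invariants_eq by fastforce
    then show False using strict by auto
  qed
  \<comment> \<open>For n <= 3 every permutation of the edges is induced, which
    \<open>proper\<close> excludes.\<close>
  have "n > 3" using proper induced_surj_small permutes by (metis not_le)
  then have n7: "7 \<le> n" "n \<noteq> 8" using n by auto
  interpret overgroup n P by unfold_locales (use n7 ind proper in auto)
  show "mat_invariants e m H \<subseteq> alternate_polys (pairs n)"
    unfolding inv alternate_polys_def using evenperm_mem by auto
  assume "odd n"
  have v: "1 \<in> {1..n}" "2 \<in> {1..n}" "(1::nat) \<noteq> 2" using n7 by auto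
  define t where "t = induced n (transpose 1 2)"
  have t: "t \<in> P" "\<And>z. t (t z) = z" "card (moved t) = 2 * (n - 2)"
    unfolding t_def by (rule induced_transposition[OF v])+
  \<comment> \<open>The number n - 2 of swapped pairs of edges is odd; composing with t therefore
    turns odd permutations into even ones, which are in P already.\<close>
  have odd_t: "\<not> evenperm t"
    using evenperm_involution[OF finite_moved[OF t(1)] t(2,3)] \<open>odd n\<close> n7 by simp
  have "\<pi> \<in> P" if \<pi>: "\<pi> permutes pairs n" for \<pi>
  proof (cases "evenperm \<pi>")
    case True
    then show ?thesis using evenperm_mem \<pi> by blast
  next
    case False
    have fin: "finite (pairs n)" using card_pairs by blast
    have "\<pi> \<circ> t permutes pairs n" by (rule permutes_compose[OF permutes[OF t(1)] \<pi>])
    moreover have "evenperm (\<pi> \<circ> t)"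
      using False odd_t permutes_imp_permutation[OF fin] \<pi> permutes[OF t(1)]
      by (simp add: evenperm_comp)
    ultimately have "\<pi> \<circ> t \<circ> t \<in> P" by (intro comp_mem[OF evenperm_mem t(1)])
    moreover have "\<pi> \<circ> t \<circ> t = \<pi>" using t(2) by (simp add: fun_eq_iff)
    ultimately show ?thesis by simp
  qed
  then show "mat_invariants e m H \<subseteq> symmetric_polys (pairs n)"
    unfolding inv symmetric_polys_def by auto
qed

theorem theorem11p3:
  fixes n m :: nat and e :: "nat \<Rightarrow> nat set"
  assumes "n \<ge> 1" and "n \<notin> {4, 5, 6, 8}" and "m = n choose 2"
    and "bij_betw e {..<m} (pairs n)"
  shows "(odd n \<longrightarrow> \<not> (\<exists>H :: 'k::field_char_0 mat set. matrix_group m H \<and>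
            symmetric_polys (pairs n) \<subset> mat_invariants e m H \<and>
            mat_invariants e m H \<subset> graph_invariants n)) \<and>
         (even n \<longrightarrow> \<not> (\<exists>H :: 'k::field_char_0 mat set. matrix_group m H \<and>
            alternate_polys (pairs n) \<subset> mat_invariants e m H \<and>
            mat_invariants e m H \<subset> graph_invariants n))"
proof (intro conjI impI notI; elim exE conjE)
  fix H :: "'k mat set"
  assume "odd n" and H: "matrix_group m H"
    and lower: "symmetric_polys (pairs n) \<subset> mat_invariants e m H"
    and upper: "mat_invariants e m H \<subset> graph_invariants n"
  then show False
    using intermediate_group_large(2)[OF assms(2,4) H _ upper] by auto
next
  fix H :: "'k mat set"
  assume H: "matrix_group m H"
    and lower: "alternate_polys (pairs n) \<subset> mat_invariants e m H"
    and upper: "mat_invariants e m H \<subset> graph_invariants n"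
  have "symmetric_polys (pairs n) \<subseteq> mat_invariants e m H"
    using lower symmetric_subset_alternate by blast
  then show False
    using intermediate_group_large(1)[OF assms(2,4) H _ upper] lower by auto
qed

end
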